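(* Let $(W,S)$ be an infinite, irreducible Coxeter system, with positive system $\Phi^+$. Then every reflection order of $(W,S)$ (a total order on $\Phi^+$) is scattered if and only if $W$ is an affine Weyl group.
   Context: Root system. Let $(W,S)$ be a Coxeter system ($S$ an arbitrary set) with Coxeter matrix $m$. Let $V$ be a real vector space with a symmetric bilinear form $B$, and let $\Pi=\{\alpha_s\mid s\in S\}\subset V$ be a root basis: the $\alpha_s$ are in bijection with $S$; $B(\alpha_s,\alpha_{s'})=-\cos(\pi/m(s,s'))$ if $m(s,s')<\infty$ (so $B(\alpha_s,\alpha_s)=1$); $B(\alpha_s,\alpha_{s'})\le -1$ if $m(s,s')=\infty$; and $\Pi$ is positively independent (a finite sum $\sum k_s\alpha_s=0$ with all $k_s\ge 0$ forces all $k_s=0$). For instance, in the standard reflection representation $\Pi$ is a basis of $V$ and $B(\alpha_s,\alpha_{s'})=-\cos(\pi/m(s,s'))$, read as $-1$ if $m(s,s')=\infty$; this $B$ is the standard bilinear form. $W$ acts on $V$ by $s(v)=v-2B(v,\alpha_s)\alpha_s$ for $s\in S$. The root system is $\Phi=W\Pi$, and $\Phi^+$ is the set of roots that are nonnegative linear combinations of $\Pi$; then $\Phi=\Phi^+\sqcup -\Phi^+$. Reflection order. A total order $\prec$ on $\Phi^+$ is a reflection order of $(W,S)$ if for all $\alpha,\beta\in\Phi^+$ with $\alpha\prec\beta$ and all $\gamma=a\alpha+b\beta\in\Phi^+$ with real $a,b>0$, one has $\alpha\prec\gamma\prec\beta$. Scatteredness. A totally ordered set with at least two elements is dense if for any $a\prec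 b$ there is $c$ with $a\prec c\prec b$. A totally ordered set is scattered if it has no subset (with at least two elements) on which the restricted order is dense. Affine Weyl group. For $(W,S)$ infinite and irreducible, $W$ is an affine Weyl group if $S$ is finite and the standard bilinear form is positive semidefinite but not positive definite (this includes the infinite dihedral group). *)

theory Defs
  imports
    "HOL-Analysis.Analysis"
    "HOL-Algebra.Generated_Groups"
    "HOL-Algebra.Group_Action"
    "HOL-Library.Extended_Nat"
begin

section \<open>Coxeter systems\<close>

definition coxeter_matrix :: "'a set \<Rightarrow> ('a \<Rightarrow> 'a \<Rightarrow> enat) \<Rightarrow> bool" where
  "coxeter_matrix S m \<longleftrightarrow>
     (\<forall>s\<in>S. m s s = 1) \<and>
     (\<forall>s\<in>S. \<forall>t\<in>S. m s t = m t s) \<and>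
     (\<forall>s\<in>S. \<forall>t\<in>S. s \<noteq> t \<longrightarrow> 2 \<le> m s t)"

text \<open>One application of a defining relation \<open>(s t)\<^sup>k = 1\<close>, \<open>k = m(s,t) < \<infinity>\<close>, inside a word over
  \<open>S\<close>. There is no relation for \<open>m(s,t) = \<infinity>\<close>.\<close>

inductive insert_relator ::
    "'a set \<Rightarrow> ('a \<Rightarrow> 'a \<Rightarrow> enat) \<Rightarrow> 'a list \<Rightarrow> 'a list \<Rightarrow> bool" for S m where
  "\<lbrakk>u \<in> lists S; v \<in> lists S; s \<in> S; t \<in> S; m s t = enat k\<rbrakk> \<Longrightarrow>
     insert_relator S m (u @ v) (u @ concat (replicate k [s, t]) @ v)"

definition word_prod :: "('a, 'b) monoid_scheme \<Rightarrow> 'a list \<Rightarrow> 'a" where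
  "word_prod G ws = foldr (\<otimes>\<^bsub>G\<^esub>) ws \<one>\<^bsub>G\<^esub>"

text \<open>\<open>W\<close> is the group with generating set \<open>S\<close> and defining relations \<open>(s t)\<^bsup>m(s,t)\<^esup> = 1\<close> for
  \<open>m(s,t) < \<infinity>\<close>. Since \<open>m(s,s) = 1\<close> makes every generator its own inverse, words without formal
  inverses suffice: two words have the same value in \<open>W\<close> exactly when inserting and deleting
  relators turns one into the other.\<close>

locale coxeter_system = group W
  for W :: "('a, 'b) monoid_scheme" (structure) and S :: "'a set" and m :: "'a \<Rightarrow> 'a \<Rightarrow> enat" +
  assumes coxeter_matrix: "coxeter_matrix S m"
    and gens_subset: "S \<subseteq> carrier W"
    and generated: "generate W S = carrier W"
    and presentation: "\<And>u v. u \<in> lists S \<Longrightarrow> v \<in> lists S \<Longrightarrow>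
      word_prod W u = word_prod W v \<longleftrightarrow> equivclp (insert_relator S m) u v"

text \<open>The Coxeter graph, with an edge whenever \<open>m(s,t) \<ge> 3\<close>, is connected.\<close>

definition irreducible_coxeter :: "'a set \<Rightarrow> ('a \<Rightarrow> 'a \<Rightarrow> enat) \<Rightarrow> bool" where
  "irreducible_coxeter S m \<longleftrightarrow>
     S \<noteq> {} \<and> (\<forall>s\<in>S. \<forall>t\<in>S. (s, t) \<in> {(x, y). x \<in> S \<and> y \<in> S \<and> 3 \<le> m x y}\<^sup>*)"

section \<open>Root bases and root systems\<close>

locale root_basis =
  fixes S :: "'a set" and m :: "'a \<Rightarrow> 'a \<Rightarrow> enat"
    and B :: "'v::real_vector \<Rightarrow> 'v \<Rightarrow> real" and \<alpha> :: "'a \<Rightarrow> 'v"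
  assumes bilinear: "bilinear B"
    and symmetric: "\<And>x y. B x y = B y x"
    and inj: "inj_on \<alpha> S"
    and finite_bond: "\<And>s t k. s \<in> S \<Longrightarrow> t \<in> S \<Longrightarrow> m s t = enat k \<Longrightarrow>
      B (\<alpha> s) (\<alpha> t) = - cos (pi / real k)"
    and infinite_bond: "\<And>s t. s \<in> S \<Longrightarrow> t \<in> S \<Longrightarrow> m s t = \<infinity> \<Longrightarrow> B (\<alpha> s) (\<alpha> t) \<le> - 1"
    and positively_independent: "\<And>F k. finite F \<Longrightarrow> F \<subseteq> S \<Longrightarrow> (\<forall>s\<in>F. 0 \<le> (k s :: real)) \<Longrightarrow>
      (\<Sum>s\<in>F. k s *\<^sub>R \<alpha> s) = 0 \<Longrightarrow> \<forall>s\<in>F. k s = 0"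

definition reflection :: "('v::real_vector \<Rightarrow> 'v \<Rightarrow> real) \<Rightarrow> 'v \<Rightarrow> 'v \<Rightarrow> 'v" where
  "reflection B a v = v - (2 * B v a) *\<^sub>R a"

text \<open>The orbit \<open>W \<Pi>\<close>, with an element of \<open>W\<close> given by a word \<open>s\<^sub>1 \<dots> s\<^sub>n\<close> over the generators, which
  acts as the composite of the reflections of its letters; see \<open>roots_eq_orbit\<close> below.\<close>

definition roots :: "'a set \<Rightarrow> ('v::real_vector \<Rightarrow> 'v \<Rightarrow> real) \<Rightarrow> ('a \<Rightarrow> 'v) \<Rightarrow> 'v set" where
  "roots S B \<alpha> = {foldr (\<lambda>s. reflection B (\<alpha> s)) ws (\<alpha> t) | ws t. ws \<in> lists S \<and> t \<in> S}"

definition positive_roots ::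
    "'a set \<Rightarrow> ('v::real_vector \<Rightarrow> 'v \<Rightarrow> real) \<Rightarrow> ('a \<Rightarrow> 'v) \<Rightarrow> 'v set" where
  "positive_roots S B \<alpha> =
     {v \<in> roots S B \<alpha>. \<exists>F k. finite F \<and> F \<subseteq> S \<and> (\<forall>s\<in>F. 0 \<le> (k s :: real)) \<and>
        v = (\<Sum>s\<in>F. k s *\<^sub>R \<alpha> s)}"

lemma (in coxeter_system) gen_square: "s \<in> S \<Longrightarrow> s \<otimes> s = \<one>"
proof -
  assume s: "s \<in> S"
  have "m s s = enat 1"
    using coxeter_matrix s by (simp add: coxeter_matrix_def one_enat_def)
  with s have "insert_relator S m ([] @ []) ([] @ concat (replicate 1 [s, s]) @ [])"
    by (intro insert_relator.intros) auto
  then have "equivclp (insert_relator S m) [] [s, s]"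
    by (auto simp: equivclp_def symclp_def)
  then have "word_prod W [] = word_prod W [s, s]"
    using presentation[of "[]" "[s, s]"] s by simp
  then show ?thesis
    using s gens_subset by (auto simp: word_prod_def)
qed

lemma (in coxeter_system) word_prod_append:
  assumes "u \<in> lists S" "v \<in> lists S"
  shows "word_prod W (u @ v) = word_prod W u \<otimes> word_prod W v"
    and "word_prod W u \<in> carrier W"
proof -
  have closed: "word_prod W w \<in> carrier W" if "w \<in> lists S" for w
    using that by induction (use gens_subset in \<open>auto simp: word_prod_def\<close>)
  then show "word_prod W u \<in> carrier W" using assms by simp
  show "word_prod W (u @ v) = word_prod W u \<otimes> word_prod W v"
    using assms(1)
  proof induction
    case Nil
    then show ?case using closed[OF assms(2)] by (simp add: word_prod_def)
  next
    case (Cons a l)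
    have "a \<in> carrier W" using Cons gens_subset by auto
    then show ?case
      using Cons closed[OF assms(2)] closed[of l] by (simp add: word_prod_def m_assoc)
  qed
qed

lemma (in coxeter_system) word_exists:
  assumes "w \<in> carrier W"
  shows "\<exists>ws\<in>lists S. word_prod W ws = w"
proof -
  have "w \<in> generate W S" using assms generated by simp
  then show ?thesis
  proof induction
    case one
    then show ?case by (intro bexI[of _ "[]"]) (auto simp: word_prod_def)
  next
    case (incl h)
    then show ?case using gens_subset
      by (intro bexI[of _ "[h]"]) (auto simp: word_prod_def)
  next
    case (inv h)
    then have "inv h = h" using gen_square[of h] gens_subset inv_equality[of h h] by auto
    then show ?case using inv gens_subset
      by (intro bexI[of _ "[h]"]) (auto simp: word_prod_def)
  next
    case (eng h1 h2)
    then obtain u v where "u \<in> lists S" "v \<in> lists S" "word_prod W u = h1" "word_prod W v = h2"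
      by blast
    then show ?case using word_prod_append[of u v]
      by (intro bexI[of _ "u @ v"]) auto
  qed
qed

lemma (in coxeter_system) roots_eq_orbit:
  fixes B :: "'v::real_vector \<Rightarrow> 'v \<Rightarrow> real"
  assumes act: "group_action W UNIV \<rho>"
    and gen: "\<And>s. s \<in> S \<Longrightarrow> \<rho> s = reflection B (\<alpha> s)"
  shows "roots S B \<alpha> = {\<rho> w (\<alpha> t) | w t. w \<in> carrier W \<and> t \<in> S}"
proof -
  interpret group_action W UNIV \<rho> by (rule act)
  have eq: "\<rho> (word_prod W ws) v = foldr (\<lambda>s. reflection B (\<alpha> s)) ws v" if "ws \<in> lists S" for ws v
    using that
  proof induction
    case Nil
    then show ?case using id_eq_one by (auto simp: word_prod_def fun_eq_iff restrict_def)
  next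
    case (Cons a l)
    have "\<rho> (a \<otimes> word_prod W l) v = \<rho> a (\<rho> (word_prod W l) v)"
      using composition_rule[of v a "word_prod W l"] Cons gens_subset word_prod_append(2)[of l l]
      by auto
    then show ?case using Cons gen by (simp add: word_prod_def)
  qed
  show ?thesis
  proof (intro Set.set_eqI iffI)
    fix x assume "x \<in> roots S B \<alpha>"
    then obtain ws t where wt: "ws \<in> lists S" "t \<in> S"
      "x = foldr (\<lambda>s. reflection B (\<alpha> s)) ws (\<alpha> t)" unfolding roots_def by blast
    have "x = \<rho> (word_prod W ws) (\<alpha> t)" by (simp only: eq[OF wt(1)] wt(3))
    then show "x \<in> {\<rho> w (\<alpha> t) | w t. w \<in> carrier W \<and> t \<in> S}"
      using word_prod_append(2)[OF wt(1) wt(1)] wt(2) by blast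
  next
    fix x assume "x \<in> {\<rho> w (\<alpha> t) | w t. w \<in> carrier W \<and> t \<in> S}"
    then obtain w t where w: "w \<in> carrier W" "t \<in> S" "x = \<rho> w (\<alpha> t)" by blast
    obtain ws where ws: "ws \<in> lists S" "word_prod W ws = w" using word_exists[OF w(1)] by blast
    have "x = foldr (\<lambda>s. reflection B (\<alpha> s)) ws (\<alpha> t)"
      by (simp only: w(3) ws(2)[symmetric] eq[OF ws(1)])
    then show "x \<in> roots S B \<alpha>" using ws(1) w(2) unfolding roots_def by blast
  qed
qed

section \<open>Reflection orders and scatteredness\<close>

text \<open>Total orders are represented by their strict part \<open>(\<prec>)\<close>, as a set of pairs.\<close>

definition reflection_order ::
    "'a set \<Rightarrow> ('v::real_vector \<Rightarrow> 'v \<Rightarrow> real) \<Rightarrow> ('a \<Rightarrow> 'v) \<Rightarrow> 'v rel \<Rightarrow> bool" where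
  "reflection_order S B \<alpha> r \<longleftrightarrow>
     r \<subseteq> positive_roots S B \<alpha> \<times> positive_roots S B \<alpha> \<and>
     strict_linear_order_on (positive_roots S B \<alpha>) r \<and>
     (\<forall>x y (a::real) (b::real). (x, y) \<in> r \<longrightarrow> 0 < a \<longrightarrow> 0 < b \<longrightarrow>
        a *\<^sub>R x + b *\<^sub>R y \<in> positive_roots S B \<alpha> \<longrightarrow>
        (x, a *\<^sub>R x + b *\<^sub>R y) \<in> r \<and> (a *\<^sub>R x + b *\<^sub>R y, y) \<in> r)"

definition dense_order_on :: "'v set \<Rightarrow> 'v rel \<Rightarrow> bool" where
  "dense_order_on D r \<longleftrightarrow>
     (\<exists>x\<in>D. \<exists>y\<in>D. x \<noteq> y) \<and>
     (\<forall>x\<in>D. \<forall>y\<in>D. (x, y) \<in> r \<longrightarrow> (\<exists>z\<in>D. (x, z) \<in> r \<and> (z, y) \<in> r))"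

definition scattered_on :: "'v set \<Rightarrow> 'v rel \<Rightarrow> bool" where
  "scattered_on A r \<longleftrightarrow> \<not> (\<exists>D\<subseteq>A. dense_order_on D r)"

section \<open>Affine Weyl groups\<close>

text \<open>For finite \<open>S\<close>, the space of the standard reflection representation is the space of
  coordinate families \<open>(x\<^sub>s)\<close>, \<open>s \<in> S\<close>, represented by functions where only the values on \<open>S\<close>
  count.\<close>

definition standard_coeff :: "('a \<Rightarrow> 'a \<Rightarrow> enat) \<Rightarrow> 'a \<Rightarrow> 'a \<Rightarrow> real" where
  "standard_coeff m s t = (case m s t of enat k \<Rightarrow> - cos (pi / real k) | \<infinity> \<Rightarrow> - 1)"

definition standard_form ::
    "'a set \<Rightarrow> ('a \<Rightarrow> 'a \<Rightarrow> enat) \<Rightarrow> ('a \<Rightarrow> real) \<Rightarrow> ('a \<Rightarrow> real) \<Rightarrow> real" where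
  "standard_form S m x y = (\<Sum>s\<in>S. \<Sum>t\<in>S. x s * y t * standard_coeff m s t)"

text \<open>Meant for infinite irreducible Coxeter systems only.\<close>

definition affine_weyl :: "'a set \<Rightarrow> ('a \<Rightarrow> 'a \<Rightarrow> enat) \<Rightarrow> bool" where
  "affine_weyl S m \<longleftrightarrow> finite S \<and>
     (\<forall>x. 0 \<le> standard_form S m x x) \<and>
     \<not> (\<forall>x. (\<exists>s\<in>S. x s \<noteq> 0) \<longrightarrow> 0 < standard_form S m x x)"

end

theory Submission
  imports Defs "HOL-Analysis.Finite_Function_Topology"
begin

text \<open>
  The proof works with the root system in coordinates: the simple roots are the coordinate vectors
  and the form has the Gram matrix of the given root basis. The reflection orders of both systems
  correspond to each other (\<open>all_scattered_iff\<close>). The point is that a linear relation between three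
  positive roots of \<open>V\<close> also holds in coordinates, although the simple roots of \<open>V\<close> may be linearly
  dependent. This follows from the identity \<open>s\<^sub>x s\<^sub>y s\<^sub>z = s\<^sub>z s\<^sub>y s\<^sub>x\<close> for reflections in coplanar roots,
  because \<open>W\<close> acts faithfully on both sides (\<open>relation_lifts\<close>).

  Affine systems. Let \<open>z\<close> lie between \<open>x\<close> and \<open>y\<close> in a reflection order, the three roots being coplanar.
  Then \<open>z\<close> is a positive combination of \<open>x\<close> and \<open>y\<close>, so the reflection in \<open>z\<close>, which sends \<open>z\<close> to \<open>- z\<close>,
  makes one of them negative. It does so to finitely many positive roots only, so in a set of
  coplanar roots every root has finitely many predecessors or finitely many successors, and such a
  set is scattered (\<open>coplanar_roots_scattered\<close>). It remains to cover the positive roots of an affine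
  system by finitely many planes. In rank two this is trivial. Otherwise the form is positive
  semidefinite with a one-dimensional radical, and a root is determined modulo the radical by its
  pairings with the simple roots. These take finitely many values, because two roots with
  \<open>|B x y| < 1\<close> are conjugate into a finite standard parabolic subsystem (\<open>psd_finite_root_values\<close>).
  The same argument shows that a positive definite system of finite rank is finite.

  Other systems. A linear functional \<open>\<phi>\<close> orders the positive roots by the slopes \<open>\<phi> x / height x\<close>, and
  with ties broken suitably this is a reflection order (\<open>slope_reflection_order\<close>). So it suffices to
  find \<open>\<phi>\<close> for which some set of slopes is densely ordered. In infinite rank the slopes of
  the simple roots can be prescribed, for instance as an enumeration of the rationals. In finite rank
  the form is indefinite and the rank is at least three. Then the limit roots, the limits of roots
  scaled to height one, form a perfect set (\<open>limit_roots_perfect\<close>), which is uncountable, so one of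
  the coordinates takes uncountably many values on it. These values are limits of slopes for that
  coordinate, and a set of reals with uncountable closure contains a densely ordered subset
  (\<open>uncountable_closure_contains_dense_order\<close>).

  The common basis is that every root is positive or negative, with the sign of \<open>w \<alpha>\<^sub>s\<close> read off from
  the lengths of \<open>w\<close> and \<open>w s\<close> (\<open>reduced_snoc_positive\<close>), and that in finite rank there are finitely many
  positive roots of bounded height (\<open>finite_roots_of_bounded_height\<close>).
\<close>

section \<open>Reflections and words\<close>

context root_basis
begin

lemmas B_simps = bilinear_ladd[OF bilinear] bilinear_radd[OF bilinear]
  bilinear_lmul[OF bilinear] bilinear_rmul[OF bilinear]
  bilinear_lneg[OF bilinear] bilinear_rneg[OF bilinear]
  bilinear_lzero[OF bilinear] bilinear_rzero[OF bilinear]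
  bilinear_lsub[OF bilinear] bilinear_rsub[OF bilinear]

lemma B_sum_left: "B (sum f A) y = (\<Sum>i\<in>A. B (f i) y)"
proof -
  have "linear (\<lambda>x. B x y)" using bilinear by (simp add: bilinear_def)
  from linear_sum[OF this, of f A] show ?thesis by simp
qed

lemma reflection_add: "reflection B a (x + y) = reflection B a x + reflection B a y"
  by (simp add: reflection_def B_simps algebra_simps)

lemma reflection_scale: "reflection B a (r *\<^sub>R x) = r *\<^sub>R reflection B a x"
  by (simp add: reflection_def B_simps algebra_simps)

lemma reflection_invariant:
  assumes "B a a = 1"
  shows "B (reflection B a x) (reflection B a y) = B x y"
  using assms symmetric[of a y] by (simp add: reflection_def B_simps algebra_simps)

lemma reflection_involution: "B a a = 1 \<Longrightarrow> reflection B a (reflection B a x) = x"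
  by (simp add: reflection_def B_simps algebra_simps)

lemma reflection_self: "B a a = 1 \<Longrightarrow> reflection B a a = - a"
  by (simp add: reflection_def algebra_simps scaleR_2)

definition act :: "'a list \<Rightarrow> 'v \<Rightarrow> 'v" where
  "act ws = foldr (\<lambda>s. reflection B (\<alpha> s)) ws"

lemma act_Nil [simp]: "act [] x = x"
  and act_Cons: "act (s # ws) x = reflection B (\<alpha> s) (act ws x)"
  and act_append: "act (u @ v) x = act u (act v x)"
  by (simp_all add: act_def)

lemma act_add: "act w (x + y) = act w x + act w y"
  by (induction w) (simp_all add: act_Cons reflection_add)

lemma act_scale: "act w (r *\<^sub>R x) = r *\<^sub>R act w x"
  by (induction w) (simp_all add: act_Cons reflection_scale)

lemma act_linear: "linear (act w)"
  by (intro linearI act_add act_scale)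

lemmas act_minus = linear_neg[OF act_linear] linear_diff[OF act_linear]

end

text \<open>Chebyshev polynomials of the second kind, shifted by one. They are the coefficients of the roots
  of a rank-two system, namely \<open>sin (n \<theta>) / sin \<theta>\<close> at \<open>c = cos \<theta>\<close>.\<close>

fun cheb :: "real \<Rightarrow> nat \<Rightarrow> real" where
  "cheb c 0 = 0"
| "cheb c (Suc 0) = 1"
| "cheb c (Suc (Suc n)) = 2 * c * cheb c (Suc n) - cheb c n"

lemma cheb_cos: "cheb (cos \<theta>) n * sin \<theta> = sin (real n * \<theta>)"
proof (induction n rule: less_induct)
  case (less n)
  consider "n = 0" | "n = 1" | k where "n = Suc (Suc k)"
    by (metis One_nat_def not0_implies_Suc)
  then show ?case
  proof cases
    case 3
    have "cheb (cos \<theta>) n * sin \<theta> = 2 * cos \<theta> * sin (real (Suc k) * \<theta>) - sin (real k * \<theta>)"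
      using less[of "Suc k"] less[of k] 3 by (simp add: algebra_simps del: of_nat_Suc)
    also have "real (Suc k) * \<theta> = real k * \<theta> + \<theta>" by (simp add: algebra_simps)
    also have "2 * cos \<theta> * sin (real k * \<theta> + \<theta>) - sin (real k * \<theta>) = sin (real k * \<theta> + \<theta> + \<theta>)"
    proof -
      have "sin (real k * \<theta>) = sin ((real k * \<theta> + \<theta>) - \<theta>)" by simp
      then show ?thesis by (simp only: sin_add[of "real k * \<theta> + \<theta>" \<theta>] sin_diff) simp
    qed
    also have "real k * \<theta> + \<theta> + \<theta> = real n * \<theta>" using 3 by (simp add: algebra_simps)
    finally show ?thesis .
  qed auto
qed

lemma cheb_mono_nonneg: "1 \<le> c \<Longrightarrow> 0 \<le> cheb c n \<and> cheb c n \<le> cheb c (Suc n)"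
proof (induction n)
  case (Suc n)
  then have "cheb c (Suc n) \<ge> 0" by simp
  then have "1 * cheb c (Suc n) \<le> c * cheb c (Suc n)" using Suc.prems by (intro mult_right_mono)
  then have "cheb c (Suc n) + cheb c n \<le> 2 * c * cheb c (Suc n)" using Suc by linarith
  then show ?case using Suc by simp
qed simp

lemma cheb_cos_nonneg:
  assumes "2 \<le> k" "n \<le> k"
  shows "0 \<le> cheb (cos (pi / real k)) n"
proof -
  have "0 < sin (pi / real k)" using assms by (intro sin_gt_zero) (auto simp: field_simps)
  moreover have "0 \<le> sin (real n * (pi / real k))"
    using assms by (intro sin_ge_zero) (auto simp: field_simps)
  ultimately show ?thesis using cheb_cos[of "pi / real k" n]
    by (metis mult_neg_pos not_le)
qed

text \<open>The letters are counted from the right, so that the word ends in \<open>t\<close> whatever its length is.\<close>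

fun alternating :: "'a \<Rightarrow> 'a \<Rightarrow> nat \<Rightarrow> 'a list" where
  "alternating s t 0 = []"
| "alternating s t (Suc n) = (if even n then t else s) # alternating s t n"

lemma length_alternating [simp]: "length (alternating s t n) = n"
  by (induction n) auto

lemma alternating_in_lists: "s \<in> S \<Longrightarrow> t \<in> S \<Longrightarrow> alternating s t n \<in> lists S"
  by (induction n) auto

lemma alternating_snoc: "alternating s t (Suc n) = alternating t s n @ [t]"
  by (induction n) auto

lemma alternating_suffix: "j \<le> n \<Longrightarrow> \<exists>p. alternating s t n = p @ alternating s t j"
proof (induction n)
  case (Suc n)
  show ?case
  proof (cases "j = Suc n")
    case False
    then obtain p where "alternating s t n = p @ alternating s t j" using Suc by auto
    then show ?thesis by (intro exI[of _ "(if even n then t else s) # p"]) simp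
  qed (auto intro: exI[of _ "[]"])
qed auto

lemma concat_replicate_alternating:
  "concat (replicate k [s, t]) = alternating s t (2 * k)"
  by (induction k) auto

context root_basis
begin

text \<open>Each further letter changes only the coefficient of its own simple root, from \<open>q\<close> to
  \<open>2 c p - q\<close> if \<open>p\<close> is the other coefficient; this is the recursion of \<open>cheb\<close>.\<close>

lemma act_alternating:
  assumes "B (\<alpha> s) (\<alpha> s) = 1" "B (\<alpha> t) (\<alpha> t) = 1"
  defines "c \<equiv> - B (\<alpha> s) (\<alpha> t)"
  shows "act (alternating s t n) (\<alpha> s) =
    cheb c (Suc n) *\<^sub>R \<alpha> (if even n then s else t) + cheb c n *\<^sub>R \<alpha> (if even n then t else s)"
proof (induction n)
  case (Suc n)
  have "B (\<alpha> t) (\<alpha> s) = - c" "B (\<alpha> s) (\<alpha> t) = - c" using symmetric[of "\<alpha> t"] c_def by auto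
  then show ?case using assms(1,2)
    by (auto simp: act_Cons Suc reflection_def B_simps algebra_simps scaleR_2
        simp flip: scaleR_add_left)
qed simp

end

section \<open>Reduced words\<close>

context coxeter_system
begin

lemma word_prod_closed: "u \<in> lists S \<Longrightarrow> word_prod W u \<in> carrier W"
  using word_prod_append(2)[of u "[]"] by simp

lemma rev_in_lists [simp]: "rev u \<in> lists S \<longleftrightarrow> u \<in> lists S"
  by (simp add: in_lists_conv_set)

lemma word_prod_Nil: "word_prod W [] = \<one>"
  by (simp add: word_prod_def)

lemma word_prod_cong_append:
  assumes "u \<in> lists S" "u' \<in> lists S" "v \<in> lists S" "v' \<in> lists S"
    and "word_prod W u = word_prod W u'" "word_prod W v = word_prod W v'"
  shows "word_prod W (u @ v) = word_prod W (u' @ v')"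
  using assms by (simp add: word_prod_append)

lemma word_prod_square: "s \<in> S \<Longrightarrow> word_prod W [s, s] = \<one>"
  using gen_square[of s] gens_subset by (auto simp: word_prod_def)

lemma word_prod_rev:
  assumes "u \<in> lists S"
  shows "word_prod W (rev u @ u) = \<one>"
  using assms
proof (induction u)
  case (Cons s u)
  have "word_prod W (rev u @ [s, s] @ u) = word_prod W (rev u @ [] @ u)"
    using Cons by (intro word_prod_cong_append) (auto simp: word_prod_square word_prod_Nil)
  then show ?case using Cons by simp
qed (simp add: word_prod_Nil)

lemma word_prod_rev_inv:
  assumes "u \<in> lists S"
  shows "word_prod W (rev u) = inv (word_prod W u)"
proof (rule inv_equality[symmetric])
  show "word_prod W (rev u) \<otimes> word_prod W u = \<one>"
    using word_prod_rev[OF assms] word_prod_append(1)[of "rev u" u] assms by simp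
qed (use assms in \<open>simp_all add: word_prod_closed\<close>)

text \<open>What relators preserve on words is well defined on \<open>W\<close>. This is used for the parity of the
  length and for the action on \<open>V\<close>.\<close>

lemma relation_symmetric_invariant:
  assumes "u \<in> lists S" "v \<in> lists S" "word_prod W u = word_prod W v"
    and "\<And>x y. insert_relator S m x y \<Longrightarrow> f x = f y"
  shows "f u = f v"
proof -
  have "(symclp (insert_relator S m))\<^sup>*\<^sup>* u v"
    using presentation[OF assms(1,2)] assms(3) by (simp add: equivclp_def)
  then show ?thesis
    by induction (auto elim!: symclpE dest: assms(4))
qed

lemma word_prod_parity:
  assumes "u \<in> lists S" "v \<in> lists S" "word_prod W u = word_prod W v"
  shows "even (length u) = even (length v)"
proof (rule relation_symmetric_invariant[OF assms])
  fix x y assume "insert_relator S m x y"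
  then show "even (length x) = even (length y)"
    by cases (simp add: length_concat sum_list_replicate)
qed

definition reduced :: "'a list \<Rightarrow> bool" where
  "reduced u \<longleftrightarrow> u \<in> lists S \<and>
     (\<forall>v\<in>lists S. word_prod W v = word_prod W u \<longrightarrow> length u \<le> length v)"

lemma reducedD:
  assumes "reduced u"
  shows "u \<in> lists S" "v \<in> lists S \<Longrightarrow> word_prod W v = word_prod W u \<Longrightarrow> length u \<le> length v"
  using assms by (auto simp: reduced_def)

lemma reduced_exists:
  assumes "u \<in> lists S"
  obtains v where "reduced v" "word_prod W v = word_prod W u" "length v \<le> length u"
proof -
  define P where "P v \<longleftrightarrow> v \<in> lists S \<and> word_prod W v = word_prod W u" for v
  have "P u" using assms by (simp add: P_def)
  then obtain v where v: "P v" "\<And>w. P w \<Longrightarrow> length v \<le> length w"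
    using ex_has_least_nat[of P u length] by blast
  show ?thesis
    using v(1) v(2)[OF \<open>P u\<close>] v(2) unfolding P_def
    by (intro that[of v]) (auto simp: reduced_def P_def)
qed

lemma reduced_appendD:
  assumes "reduced (u @ v)"
  shows "reduced u" "reduced v"
proof -
  have uv: "u \<in> lists S" "v \<in> lists S" using assms by (auto simp: reduced_def)
  show "reduced u" unfolding reduced_def
  proof (intro conjI ballI impI uv)
    fix w assume w: "w \<in> lists S" "word_prod W w = word_prod W u"
    then have "word_prod W (w @ v) = word_prod W (u @ v)"
      using uv by (intro word_prod_cong_append) auto
    then have "length (u @ v) \<le> length (w @ v)" using w uv by (intro reducedD(2)[OF assms]) auto
    then show "length u \<le> length w" by simp
  qed
  show "reduced v" unfolding reduced_def
  proof (intro conjI ballI impI uv)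
    fix w assume w: "w \<in> lists S" "word_prod W w = word_prod W v"
    then have "word_prod W (u @ w) = word_prod W (u @ v)"
      using uv by (intro word_prod_cong_append) auto
    then have "length (u @ v) \<le> length (u @ w)" using w uv by (intro reducedD(2)[OF assms]) auto
    then show "length v \<le> length w" by simp
  qed
qed

lemma reduced_cong:
  assumes "reduced u" "v \<in> lists S" "word_prod W v = word_prod W u" "length v \<le> length u"
  shows "reduced v"
  using assms unfolding reduced_def by force

lemma not_reduced_square: "\<not> reduced (u @ [s, s] @ v)"
proof
  assume "reduced (u @ [s, s] @ v)"
  then have r: "reduced [s, s]" using reduced_appendD by blast
  then have "s \<in> S" by (simp add: reduced_def)
  then have "word_prod W [] = word_prod W [s, s]" by (simp add: word_prod_square word_prod_Nil)
  then show False using r by (auto simp: reduced_def)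
qed

text \<open>By parity the lengths of \<open>u\<close> and \<open>u s\<close> differ, so the latter is shorter by exactly one.\<close>

lemma not_reduced_snoc:
  assumes u: "reduced u" and s: "s \<in> S" and n: "\<not> reduced (u @ [s])"
  obtains v where "reduced v" "reduced (v @ [s])" "word_prod W (v @ [s]) = word_prod W u"
    "Suc (length v) = length u"
proof -
  have uS: "u \<in> lists S" using u by (simp add: reduced_def)
  obtain v where v: "reduced v" "word_prod W v = word_prod W (u @ [s])" "length v \<le> length (u @ [s])"
    using reduced_exists[of "u @ [s]"] uS s by auto
  have vS: "v \<in> lists S" using v by (simp add: reduced_def)
  have "length v \<noteq> length (u @ [s])" using reduced_cong[OF v(1), of "u @ [s]"] v n uS s by auto
  moreover have "even (length v) = even (length (u @ [s]))"
    using v vS uS s by (intro word_prod_parity) auto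
  ultimately have "length v \<noteq> length u" "length v < length (u @ [s])" using v(3) by auto
  then have l: "Suc (length v) \<le> length u" by simp
  have "word_prod W (v @ [s]) = word_prod W ((u @ [s]) @ [s])"
    using v vS uS s by (intro word_prod_cong_append) auto
  also have "\<dots> = word_prod W (u @ [s, s])" by simp
  also have "\<dots> = word_prod W (u @ [])"
    using uS s by (intro word_prod_cong_append) (auto simp: word_prod_square word_prod_Nil)
  finally have e: "word_prod W (v @ [s]) = word_prod W u" by simp
  have "length u \<le> length (v @ [s])" using e vS s by (intro reducedD(2)[OF u]) auto
  then have "Suc (length v) = length u" using l by simp
  moreover have "reduced (v @ [s])" using reduced_cong[OF u, of "v @ [s]"] vS s e l by auto
  ultimately show ?thesis using that v(1) e by blast
qed

text \<open>In the relation \<open>(s t)\<^sup>k = 1\<close> a factor of length \<open>k + 1\<close> equals the inverse of the rest, which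
  has length \<open>k - 1\<close>.\<close>

lemma not_reduced_long_alternating:
  assumes st: "s \<in> S" "t \<in> S" and k: "m s t = enat k" "0 < k" "k < n"
  shows "\<not> reduced (alternating s t n)"
proof
  assume red: "reduced (alternating s t n)"
  obtain p where "alternating s t n = p @ alternating s t (Suc k)"
    using alternating_suffix[of "Suc k" n s t] k by auto
  with red have red': "reduced (alternating s t (Suc k))" by (metis reduced_appendD(2))
  obtain q where q: "alternating s t (2 * k) = q @ alternating s t (Suc k)"
    using alternating_suffix[of "Suc k" "2 * k" s t] k by auto
  have qS: "q \<in> lists S" using alternating_in_lists[OF st, of "2 * k"] q by simp
  have lq: "length q < Suc k" using arg_cong[OF q, of length] k by simp
  have "insert_relator S m ([] @ []) ([] @ concat (replicate k [s, t]) @ [])"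
    using st k by (intro insert_relator.intros) auto
  then have "equivclp (insert_relator S m) [] (alternating s t (2 * k))"
    by (auto simp: equivclp_def symclp_def concat_replicate_alternating)
  then have "word_prod W [] = word_prod W (alternating s t (2 * k))"
    using presentation[of "[]" "alternating s t (2 * k)"] st by (simp add: alternating_in_lists)
  then have "word_prod W q \<otimes> word_prod W (alternating s t (Suc k)) = \<one>"
    using word_prod_append(1)[OF qS alternating_in_lists[OF st, of "Suc k"]] q by (simp add: word_prod_Nil)
  then have "word_prod W (rev q) = word_prod W (alternating s t (Suc k))"
    using word_prod_rev_inv[OF qS] word_prod_closed[OF qS]
      word_prod_closed[OF alternating_in_lists[OF st, of "Suc k"]]
    by (metis inv_equality inv_inv)
  then have "length (alternating s t (Suc k)) \<le> length (rev q)"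
    using reducedD(2)[OF red', of "rev q"] qS by simp
  then show False using lq by (simp del: alternating.simps)
qed

lemma reduced_dihedral_word:
  assumes "s \<noteq> t" "u \<in> lists {s, t}" "reduced (u @ [s])"
  shows "u @ [s] = alternating t s (Suc (length u))"
  using assms(2,3)
proof (induction u)
  case (Cons x u)
  have "reduced (u @ [s])" using Cons.prems reduced_appendD(2)[of "[x]" "u @ [s]"] by simp
  then have e: "u @ [s] = alternating t s (Suc (length u))" using Cons by simp
  have "x \<noteq> (if even (length u) then s else t)"
  proof
    assume "x = (if even (length u) then s else t)"
    then have "(x # u) @ [s] = [] @ [x, x] @ alternating t s (length u)" using e by simp
    with Cons.prems show False using not_reduced_square by metis
  qed
  moreover have "x = s \<or> x = t" using Cons.hyps by simp
  ultimately have "x = (if even (Suc (length u)) then s else t)" using assms(1) by auto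
  then show ?case using e by simp
qed simp

end

section \<open>Positive and negative roots\<close>

locale coxeter_rep = coxeter_system W S m + root_basis S m B \<alpha>
  for W :: "('a, 'b) monoid_scheme" (structure) and S :: "'a set" and m :: "'a \<Rightarrow> 'a \<Rightarrow> enat"
    and B :: "'v::real_vector \<Rightarrow> 'v \<Rightarrow> real" and \<alpha> :: "'a \<Rightarrow> 'v"
begin

lemma B_simple: "s \<in> S \<Longrightarrow> B (\<alpha> s) (\<alpha> s) = 1"
  using finite_bond[of s s 1] coxeter_matrix by (auto simp: coxeter_matrix_def one_enat_def)

lemma finite_bond_ge_2:
  assumes "s \<in> S" "t \<in> S" "s \<noteq> t" "m s t = enat k"
  shows "2 \<le> k"
proof -
  have "2 \<le> m s t" using coxeter_matrix assms(1-3) by (simp add: coxeter_matrix_def)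
  then have "enat 2 \<le> enat k" using assms(4) numeral_eq_enat[of "num.Bit0 num.One"] by simp
  then show ?thesis by simp
qed

lemma B_simple_distinct_le_0:
  assumes "s \<in> S" "t \<in> S" "s \<noteq> t"
  shows "B (\<alpha> s) (\<alpha> t) \<le> 0"
proof (cases "m s t")
  case (enat k)
  then have "2 \<le> k" using finite_bond_ge_2 assms by blast
  then have "0 \<le> pi / real k" "pi / real k \<le> pi / 2" by (auto simp: field_simps)
  then have "0 \<le> cos (pi / real k)" by (intro cos_ge_zero) linarith+
  then show ?thesis using finite_bond[OF assms(1,2) enat] by simp
next
  case infinity
  then show ?thesis using infinite_bond[OF assms(1,2)] by simp
qed

lemma act_invariant: "u \<in> lists S \<Longrightarrow> B (act u x) (act u y) = B x y"
  by (induction u) (auto simp: act_Cons reflection_invariant B_simple)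

lemma act_rev: "u \<in> lists S \<Longrightarrow> act u (act (rev u) x) = x"
  by (induction u arbitrary: x) (auto simp: act_Cons act_append reflection_involution B_simple)

lemma act_rev': "u \<in> lists S \<Longrightarrow> act (rev u) (act u x) = x"
  using act_rev[of "rev u" x] by simp

text \<open>For \<open>s \<noteq> t\<close> the product of the two reflections is a rotation by \<open>2 \<pi> / k\<close> of the plane of
  \<open>\<alpha>\<^sub>s\<close> and \<open>\<alpha>\<^sub>t\<close>, on which the form is positive definite, and the identity on the orthogonal
  complement of this plane.\<close>

lemma relator_acts_trivially:
  assumes st: "s \<in> S" "t \<in> S" and k: "m s t = enat k"
  shows "act (concat (replicate k [s, t])) x = x"
proof (cases "s = t")
  case True
  have "act (concat (replicate n [s, s])) x = x" for n
    by (induction n) (auto simp: act_append act_Cons reflection_involution B_simple st)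
  then show ?thesis using True by simp
next
  case False
  let ?\<theta> = "pi / real k"
  let ?w = "alternating s t (2 * k)"
  have k2: "2 \<le> k" using finite_bond_ge_2 st False k by blast
  define c where "c = cos ?\<theta>"
  have sin: "0 < sin ?\<theta>" using k2 by (intro sin_gt_zero) (auto simp: field_simps)
  have B_st: "B (\<alpha> s) (\<alpha> t) = - c" "B (\<alpha> t) (\<alpha> s) = - c"
    using finite_bond[OF st k] symmetric[of "\<alpha> t"] by (auto simp: c_def)
  have cheb: "cheb c (2 * k) = 0" "cheb c (2 * k + 1) = 1" "cheb c (2 * k - 1) = - 1"
  proof -
    have "cheb c (2 * k) * sin ?\<theta> = 0" using cheb_cos[of ?\<theta> "2 * k"] k2 by (simp add: c_def)
    then show 0: "cheb c (2 * k) = 0" using sin by simp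
    have "real (2 * k + 1) * ?\<theta> = ?\<theta> + 2 * pi" using k2 by (simp add: field_simps)
    then have "cheb c (2 * k + 1) * sin ?\<theta> = 1 * sin ?\<theta>"
      using cheb_cos[of ?\<theta> "2 * k + 1"] by (simp only: c_def) simp
    then show 1: "cheb c (2 * k + 1) = 1" using sin by simp
    have "2 * k + 1 = Suc (Suc (2 * k - 1))" using k2 by simp
    then have "cheb c (2 * k + 1) = 2 * c * cheb c (Suc (2 * k - 1)) - cheb c (2 * k - 1)"
      by (simp only: cheb.simps(3))
    moreover have "Suc (2 * k - 1) = 2 * k" using k2 by simp
    ultimately show "cheb c (2 * k - 1) = - 1" using 0 1 by simp
  qed
  have s: "act ?w (\<alpha> s) = \<alpha> s"
    using act_alternating[of s t "2 * k"] cheb st by (simp add: B_simple B_st)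
  have t: "act ?w (\<alpha> t) = \<alpha> t"
  proof -
    have "?w = alternating t s (2 * k - 1) @ [t]"
      using alternating_snoc[of s t "2 * k - 1"] k2 by (simp del: alternating.simps)
    then have "act ?w (\<alpha> t) = act (alternating t s (2 * k - 1)) (- \<alpha> t)"
      by (simp add: act_append act_Cons reflection_self B_simple st)
    also have "\<dots> = - act (alternating t s (2 * k - 1)) (\<alpha> t)" by (simp add: act_minus)
    also have "act (alternating t s (2 * k - 1)) (\<alpha> t) = - \<alpha> t"
      using act_alternating[of t s "2 * k - 1"] cheb st k2 by (simp add: B_simple B_st)
    finally show ?thesis by simp
  qed
  define p q where "p = B x (\<alpha> s)" and "q = B x (\<alpha> t)"
  define a b where "a = (p + c * q) / (1 - c\<^sup>2)" and "b = (q + c * p) / (1 - c\<^sup>2)"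
  define z where "z = x - a *\<^sub>R \<alpha> s - b *\<^sub>R \<alpha> t"
  have "1 - c\<^sup>2 \<noteq> 0" using sin by (simp add: c_def cos_squared_eq)
  then have ab: "a - b * c = p" "b - a * c = q"
  proof -
    have D: "a * (1 - c\<^sup>2) = p + c * q" "b * (1 - c\<^sup>2) = q + c * p"
      using \<open>1 - c\<^sup>2 \<noteq> 0\<close> by (simp_all add: a_def b_def)
    have "(a - b * c) * (1 - c\<^sup>2) = p * (1 - c\<^sup>2)" "(b - a * c) * (1 - c\<^sup>2) = q * (1 - c\<^sup>2)"
      using D by algebra+
    then show "a - b * c = p" "b - a * c = q" using \<open>1 - c\<^sup>2 \<noteq> 0\<close> by simp_all
  qed
  have zs: "B z (\<alpha> s) = 0" "B z (\<alpha> t) = 0"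
    using ab st by (simp_all add: z_def B_simps B_simple B_st p_def q_def)
  have "act (alternating s t n) z = z" for n
    by (induction n) (simp_all add: act_Cons reflection_def zs)
  then have "act ?w (z + a *\<^sub>R \<alpha> s + b *\<^sub>R \<alpha> t) = z + a *\<^sub>R \<alpha> s + b *\<^sub>R \<alpha> t"
    by (simp add: act_add act_scale s t)
  then show ?thesis by (simp add: z_def concat_replicate_alternating)
qed

lemma act_cong:
  assumes "u \<in> lists S" "v \<in> lists S" "word_prod W u = word_prod W v"
  shows "act u = act v"
proof (rule relation_symmetric_invariant[OF assms])
  fix x y assume "insert_relator S m x y"
  then show "act x = act y"
    by cases (simp add: fun_eq_iff act_append relator_acts_trivially)
qed

definition cone :: "'v set" where
  "cone = {\<Sum>s\<in>F. k s *\<^sub>R \<alpha> s | F (k :: 'a \<Rightarrow> real). finite F \<and> F \<subseteq> S \<and> (\<forall>s\<in>F. 0 \<le> k s)}"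

lemma coneI: "finite F \<Longrightarrow> F \<subseteq> S \<Longrightarrow> (\<And>s. s \<in> F \<Longrightarrow> 0 \<le> k s) \<Longrightarrow> (\<Sum>s\<in>F. k s *\<^sub>R \<alpha> s) \<in> cone"
  unfolding cone_def by blast

lemma coneE:
  assumes "x \<in> cone"
  obtains F k where "finite F" "F \<subseteq> S" "\<And>s. 0 \<le> k s" "\<And>s. s \<notin> F \<Longrightarrow> k s = 0"
    "x = (\<Sum>s\<in>F. k s *\<^sub>R \<alpha> s)"
proof -
  obtain F and k :: "'a \<Rightarrow> real" where F: "finite F" "F \<subseteq> S" "\<forall>s\<in>F. 0 \<le> k s" "x = (\<Sum>s\<in>F. k s *\<^sub>R \<alpha> s)"
    using assms unfolding cone_def by blast
  show ?thesis
    by (rule that[of F "\<lambda>s. if s \<in> F then k s else 0"]) (use F in auto)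
qed

lemma simple_in_cone: "s \<in> S \<Longrightarrow> \<alpha> s \<in> cone"
  using coneI[of "{s}" "\<lambda>_. 1"] by simp

lemma cone_scale: "x \<in> cone \<Longrightarrow> 0 \<le> r \<Longrightarrow> r *\<^sub>R x \<in> cone"
  by (erule coneE) (auto simp: scaleR_sum_right intro!: coneI)

lemma cone_common_supportE:
  assumes "x \<in> cone" "y \<in> cone"
  obtains F k l where "finite F" "F \<subseteq> S" "\<And>s. 0 \<le> k s" "\<And>s. 0 \<le> l s"
    "x = (\<Sum>s\<in>F. k s *\<^sub>R \<alpha> s)" "y = (\<Sum>s\<in>F. l s *\<^sub>R \<alpha> s)"
proof -
  from assms(1) obtain F k where x: "finite F" "F \<subseteq> S" "\<And>s. 0 \<le> k s" "\<And>s. s \<notin> F \<Longrightarrow> k s = 0"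
    "x = (\<Sum>s\<in>F. k s *\<^sub>R \<alpha> s)" by (rule coneE) blast
  from assms(2) obtain G l where y: "finite G" "G \<subseteq> S" "\<And>s. 0 \<le> l s" "\<And>s. s \<notin> G \<Longrightarrow> l s = 0"
    "y = (\<Sum>s\<in>G. l s *\<^sub>R \<alpha> s)" by (rule coneE) blast
  show ?thesis
  proof (rule that[of "F \<union> G" k l])
    show "x = (\<Sum>s\<in>F \<union> G. k s *\<^sub>R \<alpha> s)" "y = (\<Sum>s\<in>F \<union> G. l s *\<^sub>R \<alpha> s)"
      unfolding x(5) y(5) by (rule sum.mono_neutral_left; use x y in auto)+
  qed (use x y in auto)
qed

lemma cone_add:
  assumes "x \<in> cone" "y \<in> cone"
  shows "x + y \<in> cone"
proof -
  from assms obtain F k l where xy: "finite F" "F \<subseteq> S" "\<And>s. 0 \<le> k s" "\<And>s. 0 \<le> l s"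
    "x = (\<Sum>s\<in>F. k s *\<^sub>R \<alpha> s)" "y = (\<Sum>s\<in>F. l s *\<^sub>R \<alpha> s)" by (rule cone_common_supportE) blast
  have "x + y = (\<Sum>s\<in>F. (k s + l s) *\<^sub>R \<alpha> s)" by (simp add: xy scaleR_add_left sum.distrib)
  also have "\<dots> \<in> cone" by (rule coneI) (use xy in auto)
  finally show ?thesis .
qed

lemma cone_salient:
  assumes "x \<in> cone" "- x \<in> cone"
  shows "x = 0"
proof -
  from assms obtain F k l where xy: "finite F" "F \<subseteq> S" "\<And>s. 0 \<le> k s" "\<And>s. 0 \<le> l s"
    "x = (\<Sum>s\<in>F. k s *\<^sub>R \<alpha> s)" "- x = (\<Sum>s\<in>F. l s *\<^sub>R \<alpha> s)" by (rule cone_common_supportE) blast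
  have "(\<Sum>s\<in>F. (k s + l s) *\<^sub>R \<alpha> s) = x + - x"
    by (simp only: scaleR_add_left sum.distrib xy(5)[symmetric] xy(6)[symmetric])
  then have "\<forall>s\<in>F. k s + l s = 0" using xy(1-4) by (intro positively_independent) auto
  then have "\<forall>s\<in>F. k s = 0" using xy(3,4) by (smt (verit))
  then show ?thesis using xy(5) by simp
qed

text \<open>If \<open>t\<close> is the last letter of \<open>u\<close>, split off from \<open>u\<close> on the right the longest possible factor \<open>d\<close>
  in \<open>s\<close> and \<open>t\<close>. The rest keeps \<open>\<alpha>\<^sub>s\<close> and \<open>\<alpha>\<^sub>t\<close> positive by induction, and \<open>d\<close> takes \<open>\<alpha>\<^sub>s\<close> to a
  nonnegative combination of both by the rank-two formula: \<open>d s\<close> is reduced, so it has at most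
  \<open>m s t\<close> letters.\<close>

theorem reduced_snoc_positive:
  assumes "reduced (u @ [s])"
  shows "act u (\<alpha> s) \<in> cone"
  using assms
proof (induction "length u" arbitrary: u s rule: less_induct)
  case less
  have us: "u \<in> lists S" "s \<in> S" using less.prems by (auto simp: reduced_def)
  show ?case
  proof (cases u rule: rev_cases)
    case Nil
    then show ?thesis using us by (simp add: simple_in_cone)
  next
    case (snoc u0 t)
    have t: "t \<in> S" "u0 \<in> lists S" using us snoc by auto
    have "s \<noteq> t" using less.prems snoc not_reduced_square[of u0 t "[]"] by auto
    have red_u: "reduced u" using less.prems reduced_appendD(1) by blast
    define P where "P v \<longleftrightarrow> v \<in> lists S \<and> (\<exists>d\<in>lists {s, t}. word_prod W (v @ d) = word_prod W u
       \<and> length v + length d = length u)" for v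
    have "P u0" using t snoc unfolding P_def by (auto intro!: bexI[of _ "[t]"])
    then obtain v where Pv: "P v" and min: "\<And>w. P w \<Longrightarrow> length v \<le> length w"
      using ex_has_least_nat[of P u0 length] by blast
    obtain d where d: "d \<in> lists {s, t}" "word_prod W (v @ d) = word_prod W u"
      "length v + length d = length u" and v: "v \<in> lists S"
      using Pv unfolding P_def by blast
    have dS: "d \<in> lists S" using d(1) us t by (auto simp: in_lists_conv_set)
    have red: "reduced (v @ d)" using reduced_cong[OF red_u, of "v @ d"] d v dS by auto
    have lv: "length v < length u" using min[OF \<open>P u0\<close>] snoc by simp
    have red_v: "reduced v" using red reduced_appendD(1) by blast
    \<comment> \<open>\<open>v\<close> is the shortest element of its left coset of \<open>\<langle>s, t\<rangle>\<close>, so both letters lengthen it.\<close>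
    have "reduced (v @ [r])" if r: "r \<in> {s, t}" for r
    proof (rule ccontr)
      assume nr: "\<not> reduced (v @ [r])"
      have rS: "r \<in> S" using r us t by auto
      obtain v' where v': "reduced v'" "word_prod W (v' @ [r]) = word_prod W v"
        "Suc (length v') = length v"
        using not_reduced_snoc[OF red_v rS nr] by blast
      have v'S: "v' \<in> lists S" using v' by (simp add: reduced_def)
      have "word_prod W ((v' @ [r]) @ d) = word_prod W (v @ d)"
        using v' v v'S rS dS by (intro word_prod_cong_append) auto
      then have "P v'" unfolding P_def using v' v'S r d by (auto intro!: bexI[of _ "r # d"])
      then show False using min[of v'] v'(3) by simp
    qed
    then have cone: "act v (\<alpha> s) \<in> cone" "act v (\<alpha> t) \<in> cone" using less.hyps lv by auto
    define n where "n = length d"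
    have "word_prod W ((v @ d) @ [s]) = word_prod W (u @ [s])"
      using d v dS us by (intro word_prod_cong_append) auto
    then have "reduced (v @ d @ [s])" using reduced_cong[OF less.prems, of "v @ d @ [s]"] d v dS us by auto
    then have red_d: "reduced (d @ [s])" using reduced_appendD(2) by blast
    then have ds: "d @ [s] = alternating t s (Suc n)"
      using reduced_dihedral_word[OF \<open>s \<noteq> t\<close> d(1)] by (simp add: n_def)
    then have dn: "d = alternating s t n" using alternating_snoc[of t s n] by (metis butlast_snoc)
    define c where "c = - B (\<alpha> s) (\<alpha> t)"
    have nonneg: "0 \<le> cheb c (Suc n) \<and> 0 \<le> cheb c n"
    proof (cases "m s t")
      case (enat k)
      then have k2: "2 \<le> k" using finite_bond_ge_2 us t \<open>s \<noteq> t\<close> by blast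
      have "m t s = enat k" using enat coxeter_matrix us t by (auto simp: coxeter_matrix_def)
      then have "\<not> k < Suc n"
        using not_reduced_long_alternating[of t s k "Suc n"] red_d ds us t k2 by auto
      then have "Suc n \<le> k" by simp
      moreover have "c = cos (pi / real k)" using finite_bond[OF us(2) t(1) enat] by (simp add: c_def)
      ultimately show ?thesis using cheb_cos_nonneg[OF k2] by simp
    next
      case infinity
      then have "1 \<le> c" using infinite_bond[OF us(2) t(1)] by (simp add: c_def)
      then show ?thesis using cheb_mono_nonneg[of c "Suc n"] cheb_mono_nonneg[of c n] by blast
    qed
    have "act u (\<alpha> s) = act (v @ d) (\<alpha> s)" using act_cong[of u "v @ d"] d v dS us by simp
    also have "\<dots> = act v (act (alternating s t n) (\<alpha> s))" by (simp add: act_append flip: dn)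
    also have "act (alternating s t n) (\<alpha> s) =
      cheb c (Suc n) *\<^sub>R \<alpha> (if even n then s else t) + cheb c n *\<^sub>R \<alpha> (if even n then t else s)"
      unfolding c_def using us t by (intro act_alternating) (simp_all add: B_simple)
    finally show ?thesis
      using cone nonneg by (auto simp: act_add act_scale intro!: cone_add cone_scale)
  qed
qed

corollary act_simple_sign:
  assumes "u \<in> lists S" "s \<in> S"
  shows "act u (\<alpha> s) \<in> cone \<or> - act u (\<alpha> s) \<in> cone"
proof -
  obtain v where v: "reduced v" "word_prod W v = word_prod W u"
    using reduced_exists[OF assms(1)] by blast
  then have vS: "v \<in> lists S" by (simp add: reduced_def)
  then have uv: "act u = act v" using act_cong[OF assms(1) vS] v(2) by simp
  show ?thesis
  proof (cases "reduced (v @ [s])")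
    case True
    then show ?thesis using reduced_snoc_positive uv by simp
  next
    case False
    then obtain v' where v': "reduced (v' @ [s])" "word_prod W (v' @ [s]) = word_prod W v"
      using not_reduced_snoc[OF v(1) assms(2) False] by blast
    then have "act v = act (v' @ [s])" using vS by (intro act_cong) (auto simp: reduced_def)
    then have "act v (\<alpha> s) = - act v' (\<alpha> s)"
      by (simp add: act_append act_Cons reflection_self B_simple assms act_minus)
    then show ?thesis using reduced_snoc_positive[OF v'(1)] uv by simp
  qed
qed

text \<open>A nontrivial reduced word makes the simple root of its last letter negative.\<close>

corollary act_preserves_cone_imp_trivial:
  assumes "u \<in> lists S" "\<And>s. s \<in> S \<Longrightarrow> act u (\<alpha> s) \<in> cone"
  shows "word_prod W u = \<one>"
proof -
  obtain v where v: "reduced v" "word_prod W v = word_prod W u"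
    using reduced_exists[OF assms(1)] by blast
  then have vS: "v \<in> lists S" by (simp add: reduced_def)
  then have uv: "act u = act v" using act_cong[OF assms(1) vS] v(2) by simp
  show ?thesis
  proof (cases v rule: rev_cases)
    case Nil
    then show ?thesis using v by (simp add: word_prod_Nil)
  next
    case (snoc v0 t)
    have t: "t \<in> S" "v0 \<in> lists S" using vS snoc by auto
    have "act v (\<alpha> t) = - act v0 (\<alpha> t)"
      using snoc by (simp add: act_append act_Cons reflection_self B_simple t act_minus)
    moreover have "act v0 (\<alpha> t) \<in> cone" using reduced_snoc_positive v snoc by blast
    ultimately have "act v0 (\<alpha> t) = 0" using cone_salient assms(2)[OF t(1)] uv by simp
    then have "B (\<alpha> t) (\<alpha> t) = 0"
      using act_invariant[OF t(2), of "\<alpha> t" "\<alpha> t"] by (simp add: B_simps)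
    then show ?thesis using B_simple t by simp
  qed
qed

end

section \<open>Scattered orders\<close>

lemma dense_interval_infinite:
  assumes dense: "dense_order_on D r" and r: "trans r" "irrefl r"
    and xy: "x \<in> D" "y \<in> D" "(x, y) \<in> r"
  shows "infinite {z \<in> D. (x, z) \<in> r \<and> (z, y) \<in> r}"
proof
  define I where "I y = {z \<in> D. (x, z) \<in> r \<and> (z, y) \<in> r}" for y
  assume "finite {z \<in> D. (x, z) \<in> r \<and> (z, y) \<in> r}"
  then have "finite (I y)" by (simp add: I_def)
  then show False using xy(2,3)
  proof (induction "card (I y)" arbitrary: y rule: less_induct)
    case less
    obtain z where z: "z \<in> D" "(x, z) \<in> r" "(z, y) \<in> r"
      using dense xy(1) less.prems unfolding dense_order_on_def by blast
    have "I z \<subset> I y"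
    proof
      show "I z \<subseteq> I y" using z r(1) by (auto simp: I_def dest: transD)
      show "I z \<noteq> I y" using z r(2) by (auto simp: I_def irrefl_def)
    qed
    then show False using less z by (meson finite_subset psubset_card_mono psubset_imp_subset)
  qed
qed

text \<open>Add the sets one at a time. Either removing \<open>C\<close> from \<open>D\<close> leaves a dense order, or some
  interval of \<open>D\<close> lies entirely in \<open>C\<close>.\<close>

lemma dense_order_on_finite_Union:
  assumes r: "trans r" "irrefl r" and lin: "total_on A r"
    and fin: "finite \<C>" and D: "dense_order_on D r" "D \<subseteq> A" "D \<subseteq> \<Union>\<C>"
  obtains C D' where "C \<in> \<C>" "D' \<subseteq> D" "D' \<subseteq> C" "dense_order_on D' r"
proof -
  have "\<exists>C\<in>\<C>. \<exists>D'\<subseteq>D \<inter> C. dense_order_on D' r"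
    using fin D
  proof (induction \<C> arbitrary: D rule: finite_induct)
    case empty
    then show ?case by (auto simp: dense_order_on_def)
  next
    case (insert C \<C>)
    show ?case
    proof (cases "\<forall>x\<in>D. \<forall>y\<in>D. (x, y) \<in> r \<longrightarrow> (\<exists>z\<in>D - C. (x, z) \<in> r \<and> (z, y) \<in> r)")
      case True
      obtain x y where xy: "x \<in> D" "y \<in> D" "(x, y) \<in> r"
        using insert.prems lin unfolding dense_order_on_def total_on_def by blast
      obtain z where z: "z \<in> D - C" "(x, z) \<in> r" "(z, y) \<in> r" using True xy by blast
      obtain w where w: "w \<in> D - C" "(x, w) \<in> r" "(w, z) \<in> r" using True xy z by blast
      have "w \<noteq> z" using w r(2) by (auto simp: irrefl_def)
      then have "dense_order_on (D - C) r"
        using z w True unfolding dense_order_on_def by blast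
      moreover have "D - C \<subseteq> \<Union>\<C>" "D - C \<subseteq> A" using insert.prems by auto
      ultimately obtain C' D' where "C' \<in> \<C>" "D' \<subseteq> (D - C) \<inter> C'" "dense_order_on D' r"
        using insert.IH by blast
      then show ?thesis by blast
    next
      case False
      then obtain x y where xy: "x \<in> D" "y \<in> D" "(x, y) \<in> r"
        "\<And>z. z \<in> D \<Longrightarrow> (x, z) \<in> r \<Longrightarrow> (z, y) \<in> r \<Longrightarrow> z \<in> C" by blast
      define I where "I = {z \<in> D. (x, z) \<in> r \<and> (z, y) \<in> r}"
      have dense: "\<exists>z\<in>D. (u, z) \<in> r \<and> (z, v) \<in> r" if "u \<in> D" "v \<in> D" "(u, v) \<in> r" for u v
        using insert.prems(1) that unfolding dense_order_on_def by blast
      obtain z where z: "z \<in> D" "(x, z) \<in> r" "(z, y) \<in> r" using dense xy by blast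
      obtain w where w: "w \<in> D" "(x, w) \<in> r" "(w, z) \<in> r" using dense xy z by blast
      have "w \<in> I" "z \<in> I" "w \<noteq> z"
        using z w r transD[OF r(1) w(3) z(3)] by (auto simp: I_def irrefl_def)
      moreover have "\<exists>z\<in>I. (u, z) \<in> r \<and> (z, v) \<in> r" if uv: "u \<in> I" "v \<in> I" "(u, v) \<in> r" for u v
      proof -
        obtain z where "z \<in> D" "(u, z) \<in> r" "(z, v) \<in> r" using dense uv by (auto simp: I_def)
        then show ?thesis using uv by (auto simp: I_def intro: transD[OF r(1)])
      qed
      ultimately have "dense_order_on I r" unfolding dense_order_on_def by blast
      moreover have "I \<subseteq> D \<inter> C" using xy by (auto simp: I_def)
      ultimately show ?thesis by blast
    qed
  qed
  then show ?thesis using that by blast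
qed

section \<open>Roots and coplanar roots\<close>

context coxeter_rep
begin

abbreviation "\<Phi> \<equiv> roots S B \<alpha>"
abbreviation "Pos \<equiv> positive_roots S B \<alpha>"

lemma Pos_eq: "Pos = \<Phi> \<inter> cone"
  by (auto simp: positive_roots_def cone_def)

lemma roots_eq: "\<Phi> = {act w (\<alpha> t) | w t. w \<in> lists S \<and> t \<in> S}"
  by (simp add: roots_def act_def)

lemma rootE:
  assumes "x \<in> \<Phi>"
  obtains w t where "w \<in> lists S" "t \<in> S" "x = act w (\<alpha> t)"
  using assms unfolding roots_eq by blast

lemma simple_root: "s \<in> S \<Longrightarrow> \<alpha> s \<in> \<Phi>"
  unfolding roots_eq by (auto intro!: exI[of _ "[]"])

lemma simple_Pos: "s \<in> S \<Longrightarrow> \<alpha> s \<in> Pos"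
  by (simp add: Pos_eq simple_root simple_in_cone)

lemma root_norm: "x \<in> \<Phi> \<Longrightarrow> B x x = 1"
  by (erule rootE) (simp add: act_invariant B_simple)

lemma Pos_root: "x \<in> Pos \<Longrightarrow> x \<in> \<Phi>" and Pos_cone: "x \<in> Pos \<Longrightarrow> x \<in> cone"
  and Pos_norm: "x \<in> Pos \<Longrightarrow> B x x = 1"
  by (auto simp: Pos_eq root_norm)

lemma root_nonzero: "x \<in> \<Phi> \<Longrightarrow> x \<noteq> 0"
  using root_norm[of x] by (auto simp: B_simps)

lemma act_root: "w \<in> lists S \<Longrightarrow> x \<in> \<Phi> \<Longrightarrow> act w x \<in> \<Phi>"
  by (erule rootE) (auto simp: roots_eq act_append intro!: exI[of _ "w @ u" for u])

lemma root_sign: "x \<in> \<Phi> \<Longrightarrow> x \<in> cone \<or> - x \<in> cone"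
  by (erule rootE) (simp add: act_simple_sign)

text \<open>The reflection in \<open>w \<alpha>\<^sub>t\<close> is \<open>w t w\<inverse>\<close>.\<close>

lemma reflection_word:
  assumes "x \<in> \<Phi>"
  obtains w where "w \<in> lists S" "act w = reflection B x"
proof -
  obtain u t where u: "u \<in> lists S" "t \<in> S" "x = act u (\<alpha> t)" using rootE[OF assms] .
  have "act (u @ [t] @ rev u) y = reflection B x y" for y
  proof -
    have "B (act (rev u) y) (\<alpha> t) = B (act u (act (rev u) y)) (act u (\<alpha> t))"
      using u by (simp add: act_invariant)
    also have "\<dots> = B y x" using u by (simp add: act_rev)
    finally show ?thesis
      by (simp add: act_append act_Cons reflection_def act_minus act_scale act_rev u)
  qed
  then show ?thesis using that[of "u @ [t] @ rev u"] u by auto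
qed

lemma reflection_root: "x \<in> \<Phi> \<Longrightarrow> y \<in> \<Phi> \<Longrightarrow> reflection B x y \<in> \<Phi>"
  by (metis reflection_word act_root)

lemma minus_root: "x \<in> \<Phi> \<Longrightarrow> - x \<in> \<Phi>"
  using reflection_root[of x x] by (simp add: reflection_self root_norm)

lemma root_Pos_cases: "x \<in> \<Phi> \<Longrightarrow> x \<in> Pos \<or> - x \<in> Pos"
  using root_sign[of x] minus_root[of x] by (auto simp: Pos_eq)

lemma Pos_not_minus: "x \<in> Pos \<Longrightarrow> - x \<notin> cone"
  using cone_salient[of x] root_nonzero[of x] by (auto simp: Pos_eq)

lemma Pos_proportional:
  assumes "x \<in> Pos" "y \<in> Pos" "x = r *\<^sub>R y"
  shows "x = y"
proof -
  have "r * r = 1" using Pos_norm[OF assms(1)] Pos_norm[OF assms(2)] by (simp add: assms(3) B_simps)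
  then have "r = 1 \<or> r = - 1" by (simp add: square_eq_1_iff)
  then show ?thesis using assms Pos_not_minus[OF assms(2)] Pos_cone[OF assms(1)] by auto
qed

lemma Pos_independent:
  assumes "x \<in> Pos" "y \<in> Pos" "x \<noteq> y" "a *\<^sub>R x + b *\<^sub>R y = 0"
  shows "a = 0" "b = 0"
proof -
  have *: "a = 0" if "x \<in> Pos" "y \<in> Pos" "x \<noteq> y" "a *\<^sub>R x + b *\<^sub>R y = 0" for a b x y
  proof (rule ccontr)
    assume a: "a \<noteq> 0"
    have "a *\<^sub>R x = (- b) *\<^sub>R y" using that(4) by (simp add: eq_neg_iff_add_eq_0)
    then have "(1 / a) *\<^sub>R (a *\<^sub>R x) = (1 / a) *\<^sub>R ((- b) *\<^sub>R y)" by simp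
    then have "x = (- b / a) *\<^sub>R y" using a by simp
    from Pos_proportional[OF that(1,2) this] show False using that(3) by simp
  qed
  show "a = 0" using * assms by blast
  show "b = 0" using *[of y x b a] assms by (auto simp: add.commute)
qed

text \<open>Of three coplanar positive roots, one is a positive combination of the other two because the
  positive cone contains no line; the reflection order decides that it is the middle one.\<close>

lemma reflection_order_between_combination:
  assumes r: "reflection_order S B \<alpha> r"
    and xzy: "(x, z) \<in> r" "(z, y) \<in> r"
    and dep: "a *\<^sub>R x + b *\<^sub>R y + c *\<^sub>R z = 0" "a \<noteq> 0 \<or> b \<noteq> 0 \<or> c \<noteq> 0"
  obtains p q where "0 < p" "0 < q" "z = p *\<^sub>R x + q *\<^sub>R y"
proof -
  have tr: "trans r" "irrefl r" and sub: "r \<subseteq> Pos \<times> Pos"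
    and conv: "\<And>x y a b. (x, y) \<in> r \<Longrightarrow> 0 < a \<Longrightarrow> 0 < b \<Longrightarrow> a *\<^sub>R x + b *\<^sub>R y \<in> Pos \<Longrightarrow>
      (x, a *\<^sub>R x + b *\<^sub>R y) \<in> r \<and> (a *\<^sub>R x + b *\<^sub>R y, y) \<in> r"
    using r by (auto simp: reflection_order_def strict_linear_order_on_def)
  have asym: "(v, u) \<notin> r" if "(u, v) \<in> r" for u v
    using that tr by (meson irreflD transD)
  have pos: "x \<in> Pos" "y \<in> Pos" "z \<in> Pos" using xzy sub by auto
  have xy: "(x, y) \<in> r" using xzy tr by (meson transD)
  have neq: "x \<noteq> y" "x \<noteq> z" "y \<noteq> z" using xzy xy tr by (auto simp: irrefl_def)
  have "c \<noteq> 0" using dep Pos_independent[OF pos(1,2) neq(1), of a b] by auto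
  define p q where "p = - a / c" and "q = - b / c"
  have "c *\<^sub>R z = (- a) *\<^sub>R x + (- b) *\<^sub>R y" using dep(1)
    by (simp add: add_eq_0_iff algebra_simps)
  then have "(1 / c) *\<^sub>R (c *\<^sub>R z) = (1 / c) *\<^sub>R ((- a) *\<^sub>R x + (- b) *\<^sub>R y)" by simp
  then have z: "z = p *\<^sub>R x + q *\<^sub>R y" using \<open>c \<noteq> 0\<close> by (simp add: p_def q_def scaleR_diff_right)
  have "p \<noteq> 0"
  proof
    assume "p = 0"
    have "z = q *\<^sub>R y" using z unfolding \<open>p = 0\<close> by (simp only: scaleR_zero_left add_0)
    from Pos_proportional[OF pos(3,2) this] show False using neq by simp
  qed
  have "q \<noteq> 0"
  proof
    assume "q = 0"
    have "z = p *\<^sub>R x" using z unfolding \<open>q = 0\<close> by (simp only: scaleR_zero_left add_0_right)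
    from Pos_proportional[OF pos(3,1) this] show False using neq by simp
  qed
  have "\<not> (p < 0 \<and> q < 0)"
  proof
    assume pq: "p < 0 \<and> q < 0"
    have "(- p) *\<^sub>R x + (- q) *\<^sub>R y \<in> cone"
      using pq pos by (intro cone_add cone_scale Pos_cone) auto
    moreover have "(- p) *\<^sub>R x + (- q) *\<^sub>R y = - z" unfolding z by simp
    ultimately show False using Pos_not_minus[OF pos(3)] by simp
  qed
  moreover have "\<not> (p > 0 \<and> q < 0)"
  proof
    assume pq: "p > 0 \<and> q < 0"
    have "(1 / p) *\<^sub>R z + (- q / p) *\<^sub>R y = x" using pq
      by (simp add: z scaleR_add_right)
    then have "(z, x) \<in> r" using conv[OF xzy(2), of "1 / p" "- q / p"] pq pos
      by (simp add: divide_neg_pos)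
    then show False using asym xzy by blast
  qed
  moreover have "\<not> (p < 0 \<and> q > 0)"
  proof
    assume pq: "p < 0 \<and> q > 0"
    have "(- p / q) *\<^sub>R x + (1 / q) *\<^sub>R z = y" using pq
      by (simp add: z scaleR_add_right)
    then have "(y, z) \<in> r" using conv[OF xzy(1), of "- p / q" "1 / q"] pq pos
      by (simp add: divide_neg_pos)
    then show False using asym xzy by blast
  qed
  ultimately have "0 < p" "0 < q" using \<open>p \<noteq> 0\<close> \<open>q \<noteq> 0\<close> by linarith+
  then show ?thesis using z by (rule that)
qed

end

section \<open>Coordinates and inversions\<close>

abbreviation supp :: "('a \<Rightarrow>\<^sub>0 'b::zero) \<Rightarrow> 'a set" where
  "supp \<equiv> Poly_Mapping.keys"

abbreviation coord :: "('a \<Rightarrow>\<^sub>0 'b::zero) \<Rightarrow> 'a \<Rightarrow> 'b" where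
  "coord \<equiv> Poly_Mapping.lookup"

abbreviation simple :: "'a \<Rightarrow> 'a \<Rightarrow>\<^sub>0 real" where
  "simple s \<equiv> Poly_Mapping.single s 1"

lemma lookup_scaleR [simp]: "coord (r *\<^sub>R x) s = r *\<^sub>R coord x s"
proof -
  have "{i. r *\<^sub>R coord x i \<noteq> 0} \<subseteq> {i. coord x i \<noteq> 0}" by auto
  then have "finite {i. r *\<^sub>R coord x i \<noteq> 0}" by (rule finite_subset) simp
  then show ?thesis by (simp add: scaleR_poly_mapping_def)
qed

lemma lookup_sum_left: "coord (\<Sum>i\<in>F. f i) s = (\<Sum>i\<in>F. coord (f i) s)"
  by (induction F rule: infinite_finite_induct) (auto simp: lookup_add)

lemma poly_mapping_expand:
  fixes x :: "'a \<Rightarrow>\<^sub>0 real"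
  assumes "finite F" "supp x \<subseteq> F"
  shows "x = (\<Sum>s\<in>F. coord x s *\<^sub>R simple s)"
proof (rule poly_mapping_eqI)
  fix t
  have "(\<Sum>s\<in>F. coord x s * coord (simple s) t)
      = (\<Sum>s\<in>F. if s = t then coord x t else 0)"
    by (intro sum.cong) (auto simp: lookup_single when_def)
  also have "\<dots> = coord x t"
    using assms by (auto simp: in_keys_iff)
  finally show "coord x t = coord
      (\<Sum>s\<in>F. coord x s *\<^sub>R simple s) t"
    by (simp add: lookup_sum_left)
qed

text \<open>The case in which the simple roots are the coordinate vectors. Positivity of a root can then be
  tested on a single coordinate.\<close>

locale coordinate_rep = coxeter_rep W S m B simple
  for W :: "('a, 'b) monoid_scheme" (structure) and S :: "'a set" and m :: "'a \<Rightarrow> 'a \<Rightarrow> enat"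
    and B :: "('a \<Rightarrow>\<^sub>0 real) \<Rightarrow> ('a \<Rightarrow>\<^sub>0 real) \<Rightarrow> real"
begin

lemma cone_iff: "x \<in> cone \<longleftrightarrow> supp x \<subseteq> S \<and> (\<forall>s. 0 \<le> coord x s)"
proof
  assume "x \<in> cone"
  then obtain F k where x: "finite F" "F \<subseteq> S" "\<And>s. 0 \<le> k s" "\<And>s. s \<notin> F \<Longrightarrow> k s = 0"
    "x = (\<Sum>s\<in>F. k s *\<^sub>R simple s)" by (rule coneE) blast
  have "coord x t = (\<Sum>s\<in>F. if s = t then k t else 0)" for t
    unfolding x(5) lookup_sum_left by (intro sum.cong) (auto simp: lookup_single when_def)
  then have k: "coord x t = k t" for t using x(1,4) by simp
  have "t \<in> S" if "k t \<noteq> 0" for t using that x(2,4) by blast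
  then show "supp x \<subseteq> S \<and> (\<forall>s. 0 \<le> coord x s)"
    using x(3) by (auto simp: in_keys_iff k)
next
  assume x: "supp x \<subseteq> S \<and> (\<forall>s. 0 \<le> coord x s)"
  then have "(\<Sum>s\<in>supp x. coord x s *\<^sub>R simple s) \<in> cone" by (intro coneI) auto
  then show "x \<in> cone" by (simp flip: poly_mapping_expand)
qed

lemma B_expand_left:
  assumes "finite F" "supp x \<subseteq> F"
  shows "B x y = (\<Sum>s\<in>F. coord x s * B (simple s) y)"
proof -
  have "B x y = B (\<Sum>s\<in>F. coord x s *\<^sub>R simple s) y"
    using poly_mapping_expand[OF assms] by simp
  then show ?thesis by (simp add: B_sum_left B_simps)
qed

lemma Pos_coord: "x \<in> Pos \<Longrightarrow> 0 \<le> coord x s"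
  using Pos_cone cone_iff by blast

lemma root_keys: "x \<in> \<Phi> \<Longrightarrow> supp x \<subseteq> S"
  using root_sign[of x] by (auto simp: cone_iff)

lemma root_PosI:
  assumes "x \<in> \<Phi>" "0 < coord x s"
  shows "x \<in> Pos"
proof -
  have "\<not> 0 \<le> coord (- x) s" using assms(2) by simp
  then have "- x \<notin> cone" unfolding cone_iff by blast
  then show ?thesis using root_sign[OF assms(1)] assms(1) by (simp add: Pos_eq)
qed

text \<open>The reflection changes only the coordinate at \<open>s\<close>, and a positive root other than \<open>\<alpha>\<^sub>s\<close> has a
  positive coordinate elsewhere.\<close>

lemma simple_reflection_Pos:
  assumes s: "s \<in> S" and x: "x \<in> Pos" "x \<noteq> simple s"
  shows "reflection B (simple s) x \<in> Pos"
proof -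
  have "\<exists>t. t \<noteq> s \<and> 0 < coord x t"
  proof (rule ccontr)
    assume "\<not> (\<exists>t. t \<noteq> s \<and> 0 < coord x t)"
    then have "coord x t = 0" if "t \<noteq> s" for t using Pos_coord[OF x(1), of t] that by force
    then have "x = coord x s *\<^sub>R simple s"
      by (intro poly_mapping_eqI) (auto simp: lookup_single when_def)
    then show False using Pos_proportional[OF x(1) simple_Pos[OF s]] x(2) by blast
  qed
  then obtain t where t: "t \<noteq> s" "0 < coord x t" by blast
  then have "0 < coord (reflection B (simple s) x) t"
    by (simp add: reflection_def lookup_minus lookup_single)
  then show ?thesis
    using root_PosI reflection_root[OF simple_root[OF s] Pos_root[OF x(1)]] by blast
qed

text \<open>By the previous lemma each letter of the word adds at most one inversion.\<close>

lemma finite_inversions: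
  assumes "w \<in> lists S"
  shows "finite {x \<in> Pos. act w x \<notin> Pos}"
  using assms
proof (induction w)
  case (Cons s w)
  have inj: "inj_on (act w) Pos"
    using Cons.hyps by (intro inj_on_inverseI[where g = "act (rev w)"]) (simp add: act_rev')
  have "{x \<in> Pos. act (s # w) x \<notin> Pos} \<subseteq> {x \<in> Pos. act w x \<notin> Pos} \<union> (act w -` {simple s} \<inter> Pos)"
    using simple_reflection_Pos Cons by (auto simp: act_Cons)
  moreover have "finite (act w -` {simple s} \<inter> Pos)"
    using inj by (intro finite_vimage_IntI) auto
  ultimately show ?case using Cons by (meson finite_UnI finite_subset)
qed simp

lemma finite_reflection_inversions:
  assumes "z \<in> Pos"
  shows "finite {x \<in> Pos. reflection B z x \<notin> Pos}"
proof -
  obtain w where "w \<in> lists S" "act w = reflection B z"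
    using reflection_word[OF Pos_root[OF assms]] .
  then show ?thesis using finite_inversions[of w] by simp
qed

text \<open>If \<open>z\<close> lies between the coplanar roots \<open>x\<close> and \<open>y\<close> in a reflection order, then
  \<open>s\<^sub>z\<close> inverts \<open>x\<close> or \<open>y\<close>, because it maps \<open>z\<close>, a positive combination of both, to \<open>- z\<close>. As \<open>s\<^sub>z\<close> has
  finitely many inversions, only finitely many roots of the plane precede \<open>z\<close>, or only finitely
  many succeed it.\<close>

lemma coplanar_roots_scattered:
  assumes r: "reflection_order S B simple r"
    and C: "C \<subseteq> Pos"
    and coplanar: "\<And>x y z. x \<in> C \<Longrightarrow> y \<in> C \<Longrightarrow> z \<in> C \<Longrightarrow> x \<noteq> y \<Longrightarrow> y \<noteq> z \<Longrightarrow> x \<noteq> z \<Longrightarrow>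
      \<exists>a b c. (a \<noteq> 0 \<or> b \<noteq> 0 \<or> c \<noteq> 0) \<and> a *\<^sub>R x + b *\<^sub>R y + c *\<^sub>R z = 0"
    and D: "D \<subseteq> C"
  shows "\<not> dense_order_on D r"
proof
  assume dense: "dense_order_on D r"
  have tr: "trans r" "irrefl r" and lin: "total_on Pos r"
    using r by (auto simp: reflection_order_def strict_linear_order_on_def)
  obtain x y where xy: "x \<in> D" "y \<in> D" "(x, y) \<in> r"
    using dense lin C D unfolding dense_order_on_def total_on_def by blast
  obtain z where z: "z \<in> D" "(x, z) \<in> r" "(z, y) \<in> r"
    using dense xy unfolding dense_order_on_def by blast
  define N where "N = {x \<in> Pos. reflection B z x \<notin> Pos}"
  have N: "finite N" unfolding N_def using z C D by (intro finite_reflection_inversions) auto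
  have "infinite {u \<in> D. (x, u) \<in> r \<and> (u, z) \<in> r}" "infinite {u \<in> D. (z, u) \<in> r \<and> (u, y) \<in> r}"
    using dense_interval_infinite[OF dense tr] xy z by auto
  then have "\<not> {u \<in> D. (x, u) \<in> r \<and> (u, z) \<in> r} \<subseteq> N" "\<not> {u \<in> D. (z, u) \<in> r \<and> (u, y) \<in> r} \<subseteq> N"
    using N finite_subset by blast+
  then obtain u v where uv: "u \<in> D" "(u, z) \<in> r" "u \<notin> N" "v \<in> D" "(z, v) \<in> r" "v \<notin> N"
    by blast
  have neq: "u \<noteq> z" "z \<noteq> v" "u \<noteq> v" using uv tr by (auto simp: irrefl_def dest: transD)
  obtain a b c where abc: "a \<noteq> 0 \<or> b \<noteq> 0 \<or> c \<noteq> 0" "a *\<^sub>R u + b *\<^sub>R v + c *\<^sub>R z = 0"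
    using coplanar[of u v z] uv z neq D by blast
  obtain p q where pq: "0 < p" "0 < q" "z = p *\<^sub>R u + q *\<^sub>R v"
    using reflection_order_between_combination[OF r uv(2,5) abc(2,1)] .
  have "z \<in> Pos" "u \<in> Pos" "v \<in> Pos" using uv z C D by auto
  then have "reflection B z u \<in> cone" "reflection B z v \<in> cone"
    using uv by (auto simp: N_def Pos_cone)
  then have "p *\<^sub>R reflection B z u + q *\<^sub>R reflection B z v \<in> cone"
    using pq by (intro cone_add cone_scale) auto
  also have "p *\<^sub>R reflection B z u + q *\<^sub>R reflection B z v = reflection B z (p *\<^sub>R u + q *\<^sub>R v)"
    by (simp only: reflection_add reflection_scale)
  also have "\<dots> = - z" unfolding pq(3)[symmetric] using \<open>z \<in> Pos\<close> by (simp add: reflection_self Pos_norm)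
  finally show False using Pos_not_minus[OF \<open>z \<in> Pos\<close>] by blast
qed

section \<open>The radical\<close>

definition radical :: "('a \<Rightarrow>\<^sub>0 real) set" where
  "radical = {x. supp x \<subseteq> S \<and> (\<forall>s\<in>S. B x (simple s) = 0)}"

lemma radicalD:
  assumes x: "x \<in> radical" and y: "supp y \<subseteq> S"
  shows "B x y = 0" "B y x = 0"
proof -
  have "B y x = (\<Sum>s\<in>supp y. coord y s * B (simple s) x)"
    by (rule B_expand_left) auto
  also have "\<dots> = 0"
    using x y by (intro sum.neutral) (auto simp: radical_def symmetric[of _ x])
  finally show "B y x = 0" .
  then show "B x y = 0" by (simp add: symmetric)
qed

lemma radical_scale: "x \<in> radical \<Longrightarrow> r *\<^sub>R x \<in> radical"
  by (auto simp: radical_def B_simps in_keys_iff subset_eq)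

lemma radical_diff: "x \<in> radical \<Longrightarrow> y \<in> radical \<Longrightarrow> x - y \<in> radical"
  by (auto simp: radical_def B_simps in_keys_iff subset_eq lookup_minus)

lemma bond_form_less_0:
  assumes "s \<in> S" "t \<in> S" "3 \<le> m s t"
  shows "B (simple s) (simple t) < 0"
proof (cases "m s t")
  case (enat k)
  then have "enat 3 \<le> enat k" using assms(3) numeral_eq_enat[of "num.Bit1 num.One"] by simp
  then have k: "3 \<le> k" by simp
  then have "0 < pi / real k" "pi / real k < pi / 2" by (auto simp: field_simps)
  then have "0 < cos (pi / real k)" by (intro cos_gt_zero) auto
  then show ?thesis using finite_bond[OF assms(1,2) enat] by simp
next
  case infinity
  then show ?thesis using infinite_bond[OF assms(1,2)] by simp
qed

lemma irreducible_closed_set: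
  assumes irr: "irreducible_coxeter S m" and s: "s \<in> S" "P s"
    and closed: "\<And>s t. s \<in> S \<Longrightarrow> t \<in> S \<Longrightarrow> P s \<Longrightarrow> 3 \<le> m s t \<Longrightarrow> P t"
    and t: "t \<in> S"
  shows "P t"
proof -
  have "(s, t) \<in> {(x, y). x \<in> S \<and> y \<in> S \<and> 3 \<le> m x y}\<^sup>*"
    using irr s t by (auto simp: irreducible_coxeter_def)
  then show ?thesis
    by induction (use s closed in auto)
qed

text \<open>Perron-Frobenius argument: in \<open>B x \<alpha>\<^sub>t = 0\<close> all terms are nonpositive if \<open>t\<close> is outside the
  support of \<open>x\<close>, so no bond leaves the support.\<close>

lemma nonneg_radical_full_support:
  assumes irr: "irreducible_coxeter S m"
    and x: "x \<in> radical" "x \<in> cone" "x \<noteq> 0" and s: "s \<in> S"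
  shows "0 < coord x s"
proof -
  obtain t where t: "coord x t \<noteq> 0" using x(3) poly_mapping_eqI[of x 0] by force
  then have t: "t \<in> S" "0 < coord x t"
    using x(2) unfolding cone_iff by (auto simp: in_keys_iff subset_eq order_less_le)
  show ?thesis
  proof (rule irreducible_closed_set[where P = "\<lambda>s. 0 < coord x s", OF irr t _ s])
    fix s t assume st: "s \<in> S" "t \<in> S" "0 < coord x s" "3 \<le> m s t"
    show "0 < coord x t"
    proof (rule ccontr)
      assume "\<not> 0 < coord x t"
      then have 0: "coord x t = 0" using x(2) by (auto simp: cone_iff order_less_le)
      have "0 = B x (simple t)" using x(1) st by (simp add: radical_def)
      also have "\<dots> = (\<Sum>s\<in>supp x. coord x s * B (simple s) (simple t))"
        by (rule B_expand_left) auto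
      also have "\<dots> < 0"
      proof -
        have le: "coord x u * B (simple u) (simple t) \<le> 0" if "u \<in> supp x" for u
        proof -
          have "u \<in> S" "u \<noteq> t" using that x(2) 0 by (auto simp: cone_iff in_keys_iff)
          then show ?thesis using B_simple_distinct_le_0[of u t] st x(2)
            by (auto simp: cone_iff intro: mult_nonneg_nonpos)
        qed
        have "0 < (\<Sum>s\<in>supp x. - (coord x s * B (simple s) (simple t)))"
          using st bond_form_less_0[OF st(1,2,4)] le
          by (intro sum_pos2[of _ s]) (auto simp: in_keys_iff mult_pos_neg)
        then show ?thesis by (simp add: sum_negf)
      qed
      finally show False by simp
    qed
  qed
qed

text \<open>Among the multiples of \<open>d\<close> take the smallest one that dominates \<open>k\<close> in every coordinate. The difference is
  nonnegative and vanishes somewhere, so it vanishes by the previous lemma.\<close>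

lemma nonneg_radical_spans:
  assumes irr: "irreducible_coxeter S m"
    and d: "d \<in> radical" "d \<in> cone" "d \<noteq> 0" and k: "k \<in> radical"
  obtains c where "k = c *\<^sub>R d"
proof -
  have pos: "0 < coord d s" if "s \<in> S" for s using nonneg_radical_full_support[OF irr d that] .
  have "coord d s \<noteq> 0" if "s \<in> S" for s using pos[OF that] by simp
  then have "S \<subseteq> supp d" by (simp add: in_keys_iff subset_eq)
  then have fin: "finite S" by (rule finite_subset) simp
  have "S \<noteq> {}" using irr by (simp add: irreducible_coxeter_def)
  define c where "c = Max ((\<lambda>s. coord k s / coord d s) ` S)"
  have "c \<in> (\<lambda>s. coord k s / coord d s) ` S"
    unfolding c_def using fin \<open>S \<noteq> {}\<close> by (intro Max_in) auto
  then obtain s where s: "s \<in> S" "c = coord k s / coord d s" by blast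
  have c: "coord k t / coord d t \<le> c" if "t \<in> S" for t
    unfolding c_def using fin that by (intro Max_ge) auto
  define x where "x = c *\<^sub>R d - k"
  have x: "x \<in> radical" unfolding x_def by (intro radical_diff radical_scale d k)
  moreover have "x \<in> cone"
  proof -
    have keys: "supp x \<subseteq> S" using x by (simp add: radical_def)
    have "0 \<le> coord x t" for t
    proof (cases "t \<in> S")
      case True
      then show ?thesis using c[OF True] pos[OF True] by (simp add: x_def lookup_minus field_simps)
    next
      case False
      then have "coord x t = 0" using keys by (auto simp: in_keys_iff)
      then show ?thesis by simp
    qed
    then show ?thesis using keys by (simp add: cone_iff)
  qed
  moreover have "coord x s = 0" using s pos[OF s(1)] by (simp add: x_def lookup_minus)
  ultimately have "x = 0" using nonneg_radical_full_support[OF irr _ _ _ s(1), of x] by fastforce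
  then show ?thesis using that[of c] by (simp add: x_def)
qed

end

section \<open>Convergence of coordinates\<close>

lemma abs_lookup_diff_le_dist:
  fixes x y :: "'a \<Rightarrow>\<^sub>0 real"
  shows "\<bar>coord x s - coord y s\<bar> \<le> dist x y"
proof (cases "s \<in> supp x \<union> supp y")
  case True
  have "dist (coord x s) (coord y s) \<le> dist x y"
    unfolding dist_poly_mapping_def using True by (intro member_le_sum) auto
  then show ?thesis by (simp add: dist_real_def)
next
  case False
  then show ?thesis by (simp add: in_keys_iff)
qed

lemma tendsto_lookup [tendsto_intros]:
  fixes f :: "'b \<Rightarrow> 'a \<Rightarrow>\<^sub>0 real"
  assumes "(f \<longlongrightarrow> l) F"
  shows "((\<lambda>i. coord (f i) s) \<longlongrightarrow> coord l s) F"
proof (rule tendstoI)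
  fix e :: real assume "0 < e"
  with assms have "\<forall>\<^sub>F i in F. dist (f i) l < e" by (rule tendstoD)
  then show "\<forall>\<^sub>F i in F. dist (coord (f i) s) (coord l s) < e"
    by eventually_elim (simp add: dist_real_def le_less_trans[OF abs_lookup_diff_le_dist])
qed

text \<open>The box is the image of a product of compact intervals, in the product topology on functions,
  under a continuous map.\<close>

lemma compact_coordinate_box:
  fixes S :: "'a set"
  assumes "finite S"
  shows "compact {x :: 'a \<Rightarrow>\<^sub>0 real. supp x \<subseteq> S \<and>
    (\<forall>s. 0 \<le> coord x s \<and> coord x s \<le> M)}" (is "compact ?box")
proof (cases "0 \<le> M")
  case True
  define I where "I s = (if s \<in> S then {0..M} else {0})" for s
  define V where "V f = (\<Sum>s\<in>S. f s *\<^sub>R simple s)" for f :: "'a \<Rightarrow> real"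
  have "compactin (product_topology (\<lambda>_. euclideanreal) UNIV) (PiE UNIV I)"
    by (simp add: compactin_PiE I_def)
  then have "compact (PiE UNIV I)" by (simp add: euclidean_product_topology)
  moreover have "continuous_on (PiE UNIV I) V"
    unfolding V_def by (intro continuous_intros continuous_on_subset[OF continuous_on_product_coordinates]) auto
  ultimately have "compact (V ` PiE UNIV I)" by (rule compact_continuous_image[rotated])
  also have "V ` PiE UNIV I = ?box"
  proof
    have V: "coord (V f) t = (if t \<in> S then f t else 0)" for f t
    proof -
      have "coord (V f) t = (\<Sum>s\<in>S. if s = t then f t else 0)"
        unfolding V_def lookup_sum_left by (intro sum.cong) (auto simp: lookup_single when_def)
      then show ?thesis using assms by simp
    qed
    show "V ` PiE UNIV I \<subseteq> ?box"
    proof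
      fix x assume "x \<in> V ` PiE UNIV I"
      then obtain f where x: "x = V f" and f: "\<And>s. f s \<in> I s" by auto
      have "0 \<le> f s \<and> f s \<le> M" if "s \<in> S" for s using f[of s] that by (simp add: I_def)
      then show "x \<in> ?box" using True by (auto simp: x V in_keys_iff split: if_splits)
    qed
    show "?box \<subseteq> V ` PiE UNIV I"
    proof
      fix x assume x: "x \<in> ?box"
      have "coord x s \<in> I s" for s
        using x by (auto simp: I_def in_keys_iff subset_eq)
      moreover have "x = V (coord x)"
        unfolding V_def using x assms by (intro poly_mapping_expand) auto
      ultimately show "x \<in> V ` PiE UNIV I" by (intro image_eqI) auto
    qed
  qed
  finally show ?thesis .
next
  case False
  then have empty: "?box = {}" using order_trans[of 0 _ M] by blast
  show ?thesis unfolding empty by simp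
qed

context coordinate_rep
begin

lemma B_expand:
  assumes "finite S" "supp x \<subseteq> S" "supp y \<subseteq> S"
  shows "B x y = (\<Sum>s\<in>S. \<Sum>t\<in>S. coord x s * coord y t * B (simple s) (simple t))"
proof -
  have "B x y = (\<Sum>s\<in>S. coord x s * B y (simple s))"
    using B_expand_left[OF assms(1,2)] by (simp add: symmetric[of y])
  also have "\<dots> = (\<Sum>s\<in>S. coord x s * (\<Sum>t\<in>S. coord y t * B (simple t) (simple s)))"
    using B_expand_left[OF assms(1,3)] by simp
  also have "\<dots> = (\<Sum>s\<in>S. \<Sum>t\<in>S. coord x s * coord y t * B (simple s) (simple t))"
    by (simp add: sum_distrib_left mult.assoc symmetric[of "simple _" "simple _"])
  finally show ?thesis .
qed

lemma tendsto_B: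
  assumes "finite S" "(f \<longlongrightarrow> k) F" "(g \<longlongrightarrow> l) F"
    and "\<And>i. supp (f i) \<subseteq> S" "\<And>i. supp (g i) \<subseteq> S"
    and "supp k \<subseteq> S" "supp l \<subseteq> S"
  shows "((\<lambda>i. B (f i) (g i)) \<longlongrightarrow> B k l) F"
  using assms by (simp add: B_expand tendsto_intros)

definition weighted_sum :: "('a \<Rightarrow> real) \<Rightarrow> ('a \<Rightarrow>\<^sub>0 real) \<Rightarrow> real" where
  "weighted_sum q x = (\<Sum>s\<in>supp x. q s * coord x s)"

lemma weighted_sum_eq:
  "finite F \<Longrightarrow> supp x \<subseteq> F \<Longrightarrow> weighted_sum q x = (\<Sum>s\<in>F. q s * coord x s)"
  unfolding weighted_sum_def by (intro sum.mono_neutral_left) (auto simp: in_keys_iff)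

lemma linear_weighted_sum: "linear (weighted_sum q)"
proof (rule linearI)
  fix x y :: "'a \<Rightarrow>\<^sub>0 real" and r :: real
  let ?F = "supp x \<union> supp y"
  have "supp (x + y) \<subseteq> ?F" by (rule Poly_Mapping.keys_add)
  then show "weighted_sum q (x + y) = weighted_sum q x + weighted_sum q y"
    by (simp add: weighted_sum_eq[of ?F] lookup_add distrib_left sum.distrib)
  have "supp (r *\<^sub>R x) \<subseteq> supp x" by (auto simp: in_keys_iff)
  then show "weighted_sum q (r *\<^sub>R x) = r *\<^sub>R weighted_sum q x"
    by (simp add: weighted_sum_eq[of "supp x"] sum_distrib_left mult_ac)
qed

definition height :: "('a \<Rightarrow>\<^sub>0 real) \<Rightarrow> real" where
  "height = weighted_sum (\<lambda>_. 1)"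

lemma linear_height: "linear height"
  by (simp add: height_def linear_weighted_sum)

lemmas height_simps = linear_add[OF linear_height] linear_diff[OF linear_height]
  linear_cmul[OF linear_height, simplified] linear_neg[OF linear_height] linear_0[OF linear_height]

lemma height_simple [simp]: "height (simple s) = 1"
  by (simp add: height_def weighted_sum_def)

lemma coord_le_height:
  assumes "x \<in> cone"
  shows "coord x s \<le> height x"
proof (cases "s \<in> supp x")
  case True
  have "coord x s \<le> (\<Sum>s\<in>supp x. coord x s)"
    using assms True by (intro member_le_sum) (auto simp: cone_iff)
  then show ?thesis by (simp add: height_def weighted_sum_def)
next
  case False
  then show ?thesis using assms
    by (auto simp: height_def weighted_sum_def cone_iff in_keys_iff intro: sum_nonneg)
qed

lemma height_pos:
  assumes "x \<in> cone" "x \<noteq> 0"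
  shows "0 < height x"
proof -
  obtain s where "coord x s \<noteq> 0" using assms(2) poly_mapping_eqI[of x 0] by force
  then have "0 < coord x s" using assms(1) by (simp add: cone_iff order_less_le)
  then show ?thesis using coord_le_height[OF assms(1), of s] by simp
qed

lemma height_Pos: "x \<in> Pos \<Longrightarrow> 0 < height x"
  by (intro height_pos Pos_cone root_nonzero Pos_root)

text \<open>Two distinct positive roots \<open>\<gamma>, \<gamma>'\<close> cannot be too close to each other: otherwise
  \<open>s\<^sub>\<gamma> s\<^sub>\<gamma>'\<close> would be close to the identity, hence keep all simple roots positive, hence be trivial.
  So the positive roots of bounded height, being in a compact set, are finite in number.\<close>

lemma finite_roots_of_bounded_height:
  assumes fin: "finite S"
  shows "finite {x \<in> Pos. height x \<le> M}"
proof (rule ccontr)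
  assume "infinite {x \<in> Pos. height x \<le> M}"
  then obtain f :: "nat \<Rightarrow> 'a \<Rightarrow>\<^sub>0 real" where f: "inj f" "range f \<subseteq> {x \<in> Pos. height x \<le> M}"
    using infinite_countable_subset by blast
  define K where "K = {x. supp x \<subseteq> S \<and> (\<forall>s. 0 \<le> coord x s \<and> coord x s \<le> M)}"
  have "compact K" unfolding K_def by (rule compact_coordinate_box[OF fin])
  moreover have fK: "f n \<in> K" for n
  proof -
    have "f n \<in> Pos" "height (f n) \<le> M" using f by auto
    then show ?thesis unfolding K_def
      using coord_le_height[OF Pos_cone[of "f n"]] Pos_coord[of "f n"] root_keys[OF Pos_root[of "f n"]]
      by (auto intro: order_trans)
  qed
  ultimately obtain l \<sigma> where l: "l \<in> K" "strict_mono \<sigma>" "(f \<circ> \<sigma>) \<longlonglongrightarrow> l"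
    using seq_compactE[of K f] compact_imp_seq_compact by blast
  define g where "g n = f (\<sigma> n)" for n
  have g: "g \<longlonglongrightarrow> l" using l(3) by (simp add: g_def[abs_def] o_def)
  then have g': "(\<lambda>n. g (Suc n)) \<longlonglongrightarrow> l" by (rule LIMSEQ_Suc)
  have gPos: "g n \<in> Pos" for n using f by (auto simp: g_def)
  have keys: "supp (g n) \<subseteq> S" "supp l \<subseteq> S" for n
    using fK l by (auto simp: K_def g_def)
  note lim = tendsto_B[OF fin]
  have "(\<lambda>n. B (g n) (g n)) \<longlonglongrightarrow> B l l" by (rule lim) (use g keys in auto)
  then have ll: "B l l = 1" using gPos by (simp add: Pos_norm LIMSEQ_const_iff)
  define R where "R n x = reflection B (g n) (reflection B (g (Suc n)) x)" for n x
  have "\<forall>\<^sub>F n in sequentially. 0 < coord (R n (simple s)) s" if s: "s \<in> S" for s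
  proof -
    have R: "R n (simple s) = simple s - (2 * B (simple s) (g (Suc n))) *\<^sub>R g (Suc n)
      - (2 * (B (simple s) (g n) - 2 * B (simple s) (g (Suc n)) * B (g (Suc n)) (g n))) *\<^sub>R g n" for n
      by (simp add: R_def reflection_def B_simps algebra_simps)
    have "(\<lambda>n. R n (simple s)) \<longlonglongrightarrow> simple s - (2 * B (simple s) l) *\<^sub>R l
      - (2 * (B (simple s) l - 2 * B (simple s) l * B l l)) *\<^sub>R l"
      unfolding R by (intro tendsto_intros lim g g') (use keys s in auto)
    also have "simple s - (2 * B (simple s) l) *\<^sub>R l
      - (2 * (B (simple s) l - 2 * B (simple s) l * B l l)) *\<^sub>R l = simple s"
      by (simp add: ll algebra_simps)
    finally have "(\<lambda>n. coord (R n (simple s)) s) \<longlonglongrightarrow> coord (simple s) s" by (rule tendsto_lookup)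
    then show ?thesis by (rule order_tendstoD) simp
  qed
  then have "\<forall>\<^sub>F n in sequentially. \<forall>s\<in>S. 0 < coord (R n (simple s)) s"
    using fin by (simp add: eventually_ball_finite)
  then obtain n where n: "\<And>s. s \<in> S \<Longrightarrow> 0 < coord (R n (simple s)) s"
    using eventually_happens' sequentially_bot by blast
  obtain u where u: "u \<in> lists S" "act u = reflection B (g n)"
    using reflection_word[OF Pos_root[OF gPos]] .
  obtain v where v: "v \<in> lists S" "act v = reflection B (g (Suc n))"
    using reflection_word[OF Pos_root[OF gPos]] .
  have uv: "act (u @ v) = R n" by (simp add: fun_eq_iff act_append u v R_def)
  have "act (u @ v) (simple s) \<in> cone" if s: "s \<in> S" for s
  proof -
    have "act (u @ v) (simple s) \<in> \<Phi>" using u v s by (intro act_root simple_root) auto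
    then show ?thesis using root_PosI[of "act (u @ v) (simple s)" s] n[OF s] uv Pos_cone by simp
  qed
  then have "word_prod W (u @ v) = word_prod W []"
    using act_preserves_cone_imp_trivial[of "u @ v"] u v by (simp add: word_prod_Nil)
  then have "act (u @ v) = act []" using u v by (intro act_cong) auto
  then have "R n (g (Suc n)) = g (Suc n)" using uv by simp
  then have "reflection B (g n) (- g (Suc n)) = g (Suc n)"
    by (simp add: R_def reflection_self Pos_norm gPos)
  then have "2 *\<^sub>R g (Suc n) = (2 * B (g (Suc n)) (g n)) *\<^sub>R g n"
    by (simp add: reflection_def B_simps scaleR_2) (metis add_diff_cancel_right' diff_add_cancel)
  then have "(1 / 2) *\<^sub>R 2 *\<^sub>R g (Suc n) = (1 / 2) *\<^sub>R (2 * B (g (Suc n)) (g n)) *\<^sub>R g n" by simp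
  then have "g (Suc n) = B (g (Suc n)) (g n) *\<^sub>R g n" by simp
  then have "g (Suc n) = g n" using Pos_proportional[OF gPos gPos] by blast
  then have "\<sigma> (Suc n) = \<sigma> n" using f(1) by (simp add: g_def inj_eq)
  then show False using strict_monoD[OF l(2), of n "Suc n"] by simp
qed

text \<open>An element of \<open>W\<close> is determined by the roots to which it takes the simple roots.\<close>

lemma finite_Pos_imp_finite_group:
  assumes "finite S" "finite Pos"
  shows "finite (carrier W)"
proof -
  have "x \<in> Pos \<union> uminus ` Pos" if "x \<in> \<Phi>" for x
    using root_Pos_cases[OF that] image_eqI[of x uminus "- x" Pos] by simp blast
  then have "\<Phi> \<subseteq> Pos \<union> uminus ` Pos" by blast
  then have "finite \<Phi>"
    by (rule finite_subset[OF _ finite_UnI[OF assms(2) finite_imageI[OF assms(2)]]])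
  have "\<forall>w\<in>carrier W. \<exists>u. u \<in> lists S \<and> word_prod W u = w" using word_exists by blast
  then obtain wd where wd: "\<And>w. w \<in> carrier W \<Longrightarrow> wd w \<in> lists S \<and> word_prod W (wd w) = w"
    by (rule bchoice[THEN exE]) blast
  define F where "F w = restrict (\<lambda>s. act (wd w) (simple s)) S" for w
  have "inj_on F (carrier W)"
  proof (rule inj_onI)
    fix x y assume x: "x \<in> carrier W" and y: "y \<in> carrier W" and eq: "F x = F y"
    have "act (rev (wd x) @ wd y) (simple s) \<in> cone" if "s \<in> S" for s
    proof -
      have "act (wd y) (simple s) = act (wd x) (simple s)"
        using fun_cong[OF eq, of s] that by (simp add: F_def)
      then show ?thesis using wd[OF x] that by (simp add: act_append act_rev' simple_in_cone)
    qed
    then have "word_prod W (rev (wd x) @ wd y) = \<one>"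
      using wd[OF x] wd[OF y] by (intro act_preserves_cone_imp_trivial) auto
    then have "inv x \<otimes> y = \<one>" using wd[OF x] wd[OF y] by (simp add: word_prod_append word_prod_rev_inv)
    then have "inv y = inv x" using x y by (intro inv_equality) auto
    then show "x = y" using x y by (metis inv_inv)
  qed
  moreover have "act (wd w) (simple s) \<in> \<Phi>" if "w \<in> carrier W" "s \<in> S" for w s
    using act_root[OF conjunct1[OF wd] simple_root] that by blast
  then have "F ` carrier W \<subseteq> PiE S (\<lambda>_. \<Phi>)" by (auto simp: F_def)
  moreover have "finite (PiE S (\<lambda>_. \<Phi>))" using assms(1) \<open>finite \<Phi>\<close> by (intro finite_PiE) auto
  ultimately show ?thesis by (metis finite_imageD finite_subset)
qed

end

section \<open>Positive semidefinite forms\<close>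

context coordinate_rep
begin

lemma linear_reflection: "linear (reflection B a)"
  by (intro linearI reflection_add reflection_scale)

text \<open>Reflecting in a simple root on which \<open>f\<close> is negative permutes the other positive roots, so it
  lowers by one the number of positive roots on which the functional is negative.\<close>

lemma exists_dominant:
  fixes f :: "('a \<Rightarrow>\<^sub>0 real) \<Rightarrow> real"
  assumes "linear f" "finite {x \<in> Pos. f x < 0}"
  shows "\<exists>w\<in>lists S. \<forall>s\<in>S. 0 \<le> f (act w (simple s))"
  using assms
proof (induction "card {x \<in> Pos. f x < 0}" arbitrary: f rule: less_induct)
  case less
  show ?case
  proof (cases "\<forall>s\<in>S. 0 \<le> f (simple s)")
    case True
    then show ?thesis by (intro bexI[of _ "[]"]) auto
  next
    case False
    then obtain s where s: "s \<in> S" "f (simple s) < 0" by auto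
    define g where "g = f \<circ> reflection B (simple s)"
    have g: "linear g" unfolding g_def using linear_reflection less.prems(1) by (rule linear_compose)
    let ?N = "{x \<in> Pos. f x < 0}" and ?M = "{x \<in> Pos. g x < 0}"
    have ss: "reflection B (simple s) (simple s) = - simple s"
      using s by (simp add: reflection_self B_simple)
    have gs: "0 < g (simple s)"
      using s linear_neg[OF less.prems(1), of "simple s"] by (simp add: g_def ss)
    have inv: "reflection B (simple s) (reflection B (simple s) x) = x" for x
      using s by (simp add: reflection_involution B_simple)
    have inj: "inj_on (reflection B (simple s)) ?M" by (intro inj_on_inverseI[where g = "reflection B (simple s)"]) (simp add: inv)
    have sub: "reflection B (simple s) ` ?M \<subseteq> ?N - {simple s}"
    proof
      fix y assume "y \<in> reflection B (simple s) ` ?M"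
      then obtain x where x: "x \<in> Pos" "g x < 0" "y = reflection B (simple s) x" by blast
      have "x \<noteq> simple s" using x(2) gs by auto
      then have "y \<in> Pos" using simple_reflection_Pos[OF s(1) x(1)] x(3) by simp
      moreover have "f y < 0" using x by (simp add: g_def)
      moreover have "y \<noteq> simple s"
      proof
        assume "y = simple s"
        then have "x = - simple s" using inv[of x] x(3) ss by simp
        then show False using Pos_not_minus[OF simple_Pos[OF s(1)]] Pos_cone[OF x(1)] by simp
      qed
      ultimately show "y \<in> ?N - {simple s}" by blast
    qed
    have finM: "finite ?M"
      by (rule finite_imageD[OF _ inj]) (rule finite_subset[OF sub], use less.prems(2) in simp)
    have "card ?M = card (reflection B (simple s) ` ?M)" by (rule card_image[OF inj, symmetric])
    also have "\<dots> \<le> card (?N - {simple s})" using sub less.prems(2) by (intro card_mono) auto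
    also have "\<dots> < card ?N"
      using less.prems(2) s simple_Pos[OF s(1)] by (intro card_Diff1_less) auto
    finally obtain w where w: "w \<in> lists S" "\<forall>s\<in>S. 0 \<le> g (act w (simple s))"
      using less.hyps[of g] g finM by blast
    then show ?thesis using s by (intro bexI[of _ "s # w"]) (auto simp: act_Cons g_def)
  qed
qed

text \<open>The roots on which a functional that is positive on almost all positive roots vanishes are
  conjugate into a finite standard parabolic subsystem.\<close>

lemma zero_roots_conjugate_finite_parabolic:
  fixes f :: "('a \<Rightarrow>\<^sub>0 real) \<Rightarrow> real"
  assumes lin: "linear f" and fin: "finite {x \<in> Pos. f x \<le> 0}"
  obtains w J where "w \<in> lists S" "J \<subseteq> S" "finite {z \<in> Pos. supp z \<subseteq> J}"
    "\<And>x. x \<in> Pos \<Longrightarrow> f x = 0 \<Longrightarrow>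
      \<exists>z\<in>Pos. supp z \<subseteq> J \<and> (act w x = z \<or> act w x = - z)"
proof -
  have "finite {x \<in> Pos. f x < 0}" by (rule finite_subset[OF _ fin]) auto
  then obtain w where w: "w \<in> lists S" "\<And>s. s \<in> S \<Longrightarrow> 0 \<le> f (act w (simple s))"
    using exists_dominant[OF lin] by blast
  define J where "J = {s \<in> S. f (act w (simple s)) = 0}"
  have expand: "f (act w z) = (\<Sum>s\<in>supp z. coord z s * f (act w (simple s)))" for z
  proof -
    have l: "linear (\<lambda>z. f (act w z))" using linear_compose[OF act_linear lin, of w] by (simp add: o_def)
    have "f (act w z) = f (act w (\<Sum>s\<in>supp z. coord z s *\<^sub>R simple s))"
      using poly_mapping_expand[of "supp z" z] by simp
    then show ?thesis by (simp add: linear_sum[OF l] linear_cmul[OF l])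
  qed
  have "finite {z \<in> Pos. supp z \<subseteq> J}"
  proof -
    have sub: "{z \<in> Pos. supp z \<subseteq> J} \<subseteq>
        {z \<in> Pos. act w z \<notin> Pos} \<union> (act w -` {x \<in> Pos. f x \<le> 0} \<inter> UNIV)"
    proof
      fix z assume z: "z \<in> {z \<in> Pos. supp z \<subseteq> J}"
      then have "f (act w z) = 0"
        by (subst expand, intro sum.neutral) (auto simp: J_def)
      then show "z \<in> {z \<in> Pos. act w z \<notin> Pos} \<union> (act w -` {x \<in> Pos. f x \<le> 0} \<inter> UNIV)"
        using z by auto
    qed
    have "inj (act w)"
      by (rule inj_on_inverseI[where g = "act (rev w)"]) (simp add: act_rev' w)
    then have "finite (act w -` {x \<in> Pos. f x \<le> 0} \<inter> UNIV)" by (rule finite_vimage_IntI[OF fin])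
    then show ?thesis by (rule finite_subset[OF sub finite_UnI[OF finite_inversions[OF w(1)]]])
  qed
  moreover have "\<exists>z\<in>Pos. supp z \<subseteq> J \<and> (act (rev w) x = z \<or> act (rev w) x = - z)"
    if x: "x \<in> Pos" "f x = 0" for x
  proof -
    have "act (rev w) x \<in> \<Phi>" using w x by (intro act_root Pos_root) auto
    from root_Pos_cases[OF this]
    obtain z where z: "z \<in> Pos" "act (rev w) x = z \<or> act (rev w) x = - z"
    proof
      assume "- act (rev w) x \<in> Pos"
      then show ?thesis using that[of "- act (rev w) x"] by simp
    qed (use that in simp)
    have "act w (act (rev w) x) = x" by (rule act_rev[OF w(1)])
    then have "act w z = x \<or> act w z = - x" using z(2) act_minus(1)[of w z] by auto
    then have "f (act w z) = 0" using x(2) linear_neg[OF lin, of x] by auto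
    then have sum0: "(\<Sum>s\<in>supp z. coord z s * f (act w (simple s))) = 0"
      by (simp only: expand[of z])
    have zS: "supp z \<subseteq> S" using z(1) by (intro root_keys Pos_root)
    have "\<forall>s\<in>supp z. coord z s * f (act w (simple s)) = 0"
      using sum0 zS w(2) Pos_coord[OF z(1)]
      by (subst (asm) sum_nonneg_eq_0_iff) auto
    then have "supp z \<subseteq> J" using zS by (auto simp: J_def in_keys_iff)
    then show ?thesis using z by blast
  qed
  moreover have "J \<subseteq> S" by (auto simp: J_def)
  ultimately show ?thesis using that[of "rev w" J] w(1) by simp
qed

definition psd :: bool where
  "psd \<longleftrightarrow> (\<forall>x. supp x \<subseteq> S \<longrightarrow> 0 \<le> B x x)"

lemma keys_combination:
  fixes x y :: "'a \<Rightarrow>\<^sub>0 real"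
  assumes "supp x \<subseteq> S" "supp y \<subseteq> S"
  shows "supp (a *\<^sub>R x + b *\<^sub>R y) \<subseteq> S"
  using assms by (auto simp: in_keys_iff lookup_add subset_eq) 

lemma psd_form_le:
  assumes psd and "supp x \<subseteq> S" "supp y \<subseteq> S"
  shows "B x y \<le> (B x x + B y y) / 2"
proof -
  have "0 \<le> B (1 *\<^sub>R x + (- 1) *\<^sub>R y) (1 *\<^sub>R x + (- 1) *\<^sub>R y)"
    using assms keys_combination[of x y 1 "- 1"] unfolding psd_def by blast
  then show ?thesis using symmetric[of y x] by (simp add: B_simps algebra_simps)
qed

text \<open>If \<open>b = B x \<alpha>\<^sub>s\<close> were nonzero, then \<open>x - b \<alpha>\<^sub>s\<close> would have the negative square \<open>- b\<^sup>2\<close>.\<close>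

lemma psd_null_radical:
  assumes psd and x: "supp x \<subseteq> S" "B x x = 0"
  shows "x \<in> radical"
proof -
  have "B x (simple s) = 0" if s: "s \<in> S" for s
  proof -
    define b where "b = B x (simple s)"
    have "0 \<le> B (1 *\<^sub>R x + (- b) *\<^sub>R simple s) (1 *\<^sub>R x + (- b) *\<^sub>R simple s)"
      using assms s keys_combination[of x "simple s" 1 "- b"] unfolding psd_def by auto
    also have "\<dots> = - (b * b)"
      using x(2) symmetric[of "simple s" x] s by (simp add: B_simps B_simple b_def algebra_simps)
    finally have "b * b \<le> 0" by simp
    then have "b * b = 0" using zero_le_square[of b] by linarith
    then show ?thesis by (simp add: b_def)
  qed
  then show ?thesis using x by (simp add: radical_def)
qed

text \<open>If \<open>|B x y| < 1\<close>, subtract from the height the functional \<open>B u\<close>, \<open>u\<close> in the plane of \<open>x\<close> and \<open>y\<close>,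
  so as to vanish on both roots. The difference is positive on all but finitely many positive roots,
  hence \<open>B x y\<close> is up to sign a value of \<open>B\<close> on one of the finitely many finite standard parabolic
  subsystems.\<close>

lemma psd_finite_root_values:
  assumes fin: "finite S" and psd: psd
  shows "finite {B x y | x y. x \<in> Pos \<and> y \<in> Pos}"
proof -
  define P where "P J = {z \<in> Pos. supp z \<subseteq> J}" for J
  define V where "V = (\<Union>J\<in>{J. J \<subseteq> S \<and> finite (P J)}. (\<lambda>(a, b). B a b) ` (P J \<times> P J))"
  have "finite V" unfolding V_def using fin by (intro finite_UN_I) auto
  moreover have "{B x y | x y. x \<in> Pos \<and> y \<in> Pos} \<subseteq> {1, - 1} \<union> V \<union> uminus ` V"
  proof
    fix c assume "c \<in> {B x y | x y. x \<in> Pos \<and> y \<in> Pos}"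
    then obtain x y where xy: "x \<in> Pos" "y \<in> Pos" "c = B x y" by blast
    have keys: "supp z \<subseteq> S" if "z \<in> Pos" for z using that by (intro root_keys Pos_root)
    show "c \<in> {1, - 1} \<union> V \<union> uminus ` V"
    proof (cases "c = 1 \<or> c = - 1")
      case False
      have "c \<noteq> 1" "c \<noteq> - 1" using False by auto
      then have c: "1 - c\<^sup>2 \<noteq> 0" by (simp add: power2_eq_1_iff)
      define a where "a = (height x - c * height y) / (1 - c\<^sup>2)"
      define b where "b = (height y - c * height x) / (1 - c\<^sup>2)"
      have ab: "a + b * c = height x" "a * c + b = height y"
      proof -
        have D: "a * (1 - c\<^sup>2) = height x - c * height y" "b * (1 - c\<^sup>2) = height y - c * height x"
          using c by (simp_all add: a_def b_def)
        have "(a + b * c) * (1 - c\<^sup>2) = height x * (1 - c\<^sup>2)"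
          "(a * c + b) * (1 - c\<^sup>2) = height y * (1 - c\<^sup>2)"
          using D by algebra+
        then show "a + b * c = height x" "a * c + b = height y" using c by simp_all
      qed
      define u where "u = a *\<^sub>R x + b *\<^sub>R y"
      have u: "supp u \<subseteq> S" unfolding u_def by (intro keys_combination keys xy)
      define f where "f z = height z - B u z" for z
      have "linear f" by (intro linearI) (simp_all add: f_def height_simps B_simps algebra_simps)
      moreover have "{z \<in> Pos. f z \<le> 0} \<subseteq> {z \<in> Pos. height z \<le> (B u u + 1) / 2}"
      proof
        fix z assume z: "z \<in> {z \<in> Pos. f z \<le> 0}"
        then have "B u z \<le> (B u u + B z z) / 2" using psd_form_le[OF psd u keys] by blast
        then show "z \<in> {z \<in> Pos. height z \<le> (B u u + 1) / 2}" using z by (auto simp: f_def Pos_norm)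
      qed
      then have "finite {z \<in> Pos. f z \<le> 0}"
        using finite_roots_of_bounded_height[OF fin] by (rule finite_subset)
      ultimately obtain w J where w: "w \<in> lists S" and J: "J \<subseteq> S"
        "finite {z \<in> Pos. supp z \<subseteq> J}"
        "\<And>x. x \<in> Pos \<Longrightarrow> f x = 0 \<Longrightarrow>
          \<exists>z\<in>Pos. supp z \<subseteq> J \<and> (act w x = z \<or> act w x = - z)"
        by (rule zero_roots_conjugate_finite_parabolic) (rule that; assumption)
      have "f x = 0" using ab(1) xy symmetric[of y x] by (simp add: f_def u_def B_simps Pos_norm)
      then obtain p where p: "p \<in> Pos" "supp p \<subseteq> J" "act w x = p \<or> act w x = - p"
        using J(3)[OF xy(1)] by blast
      have "f y = 0" using ab(2) xy by (simp add: f_def u_def B_simps Pos_norm)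
      then obtain q where q: "q \<in> Pos" "supp q \<subseteq> J" "act w y = q \<or> act w y = - q"
        using J(3)[OF xy(2)] by blast
      have "c = B (act w x) (act w y)" using xy w by (simp add: act_invariant)
      then have "c = B p q \<or> c = - B p q" using p(3) q(3) by (auto simp: B_simps)
      moreover have "B p q \<in> V" unfolding V_def
      proof (rule UN_I)
        show "J \<in> {J. J \<subseteq> S \<and> finite (P J)}" using J by (simp add: P_def)
        show "B p q \<in> (\<lambda>(a, b). B a b) ` (P J \<times> P J)" using p q
          by (intro image_eqI[of _ _ "(p, q)"]) (auto simp: P_def)
      qed
      ultimately show ?thesis by auto
    qed auto
  qed
  moreover have "finite ({1, - 1} \<union> V \<union> uminus ` V)" using \<open>finite V\<close> by simp
  ultimately show ?thesis using finite_subset[of "{B x y | x y. x \<in> Pos \<and> y \<in> Pos}"] by (simp only:)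
qed

text \<open>The pairings with the simple roots, which determine a root up to the radical, take only finitely
  many values on positive roots.\<close>

lemma psd_finite_classes:
  assumes fin: "finite S" and psd: psd
  obtains \<C> where "finite \<C>" "Pos = \<Union>\<C>" "\<And>C x y. C \<in> \<C> \<Longrightarrow> x \<in> C \<Longrightarrow> y \<in> C \<Longrightarrow> x - y \<in> radical"
proof -
  define \<kappa> where "\<kappa> x = restrict (\<lambda>s. B x (simple s)) S" for x
  define \<C> where "\<C> = (\<lambda>v. {x \<in> Pos. \<kappa> x = v}) ` \<kappa> ` Pos"
  let ?V = "{B x y | x y. x \<in> Pos \<and> y \<in> Pos}"
  have "B x (simple s) \<in> ?V" if "x \<in> Pos" "s \<in> S" for x s using that simple_Pos by blast
  then have "\<kappa> ` Pos \<subseteq> PiE S (\<lambda>_. ?V)" by (auto simp: \<kappa>_def)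
  moreover have "finite (PiE S (\<lambda>_. ?V))"
    using fin psd_finite_root_values[OF fin psd] by (intro finite_PiE) auto
  ultimately have "finite (\<kappa> ` Pos)" by (rule finite_subset)
  then have "finite \<C>" by (simp add: \<C>_def)
  moreover have "Pos = \<Union>\<C>" by (auto simp: \<C>_def)
  moreover have "x - y \<in> radical" if "C \<in> \<C>" "x \<in> C" "y \<in> C" for C x y
  proof -
    have xy: "x \<in> Pos" "y \<in> Pos" "\<kappa> x = \<kappa> y" using that by (auto simp: \<C>_def)
    have "B (x - y) (simple s) = 0" if "s \<in> S" for s
      using fun_cong[OF xy(3), of s] that by (simp add: \<kappa>_def B_simps)
    moreover have "supp (1 *\<^sub>R x + (- 1) *\<^sub>R y) \<subseteq> S"
      using xy by (intro keys_combination root_keys Pos_root)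
    ultimately show ?thesis by (simp add: radical_def)
  qed
  ultimately show ?thesis by (rule that)
qed

end

section \<open>Affine systems\<close>

context coordinate_rep
begin

lemma coeff_finite_bond:
  assumes "s \<in> S" "t \<in> S" "m s t \<noteq> \<infinity>"
  shows "standard_coeff m s t = B (simple s) (simple t)"
  using assms finite_bond by (cases "m s t") (auto simp: standard_coeff_def)

lemma B_le_coeff:
  assumes "s \<in> S" "t \<in> S"
  shows "B (simple s) (simple t) \<le> standard_coeff m s t"
proof (cases "m s t")
  case (enat k)
  then show ?thesis using coeff_finite_bond assms by simp
next
  case infinity
  then show ?thesis using infinite_bond[OF assms] by (simp add: standard_coeff_def)
qed

lemma coeff_diagonal: "s \<in> S \<Longrightarrow> standard_coeff m s s = 1"
  using coxeter_matrix by (simp add: coxeter_matrix_def standard_coeff_def one_enat_def)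

lemma coeff_symmetric: "s \<in> S \<Longrightarrow> t \<in> S \<Longrightarrow> standard_coeff m s t = standard_coeff m t s"
  using coxeter_matrix by (simp add: coxeter_matrix_def standard_coeff_def)

lemma coeff_distinct_le_0:
  assumes "s \<in> S" "t \<in> S" "s \<noteq> t"
  shows "standard_coeff m s t \<le> 0"
proof (cases "m s t")
  case (enat k)
  then show ?thesis using coeff_finite_bond B_simple_distinct_le_0 assms by simp
next
  case infinity
  then show ?thesis by (simp add: standard_coeff_def)
qed

lemma coeff_bond_less_0:
  assumes "s \<in> S" "t \<in> S" "3 \<le> m s t"
  shows "standard_coeff m s t < 0"
proof (cases "m s t")
  case (enat k)
  then show ?thesis using coeff_finite_bond bond_form_less_0 assms by simp
next
  case infinity
  then show ?thesis by (simp add: standard_coeff_def)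
qed

lemma standard_form_on_support:
  assumes "finite S" "A \<subseteq> S" "\<And>s. s \<in> S - A \<Longrightarrow> x s = 0"
  shows "standard_form S m x x = (\<Sum>s\<in>A. \<Sum>t\<in>A. x s * x t * standard_coeff m s t)"
proof -
  have "standard_form S m x x = (\<Sum>s\<in>A. \<Sum>t\<in>S. x s * x t * standard_coeff m s t)"
    unfolding standard_form_def using assms by (intro sum.mono_neutral_right) auto
  also have "\<dots> = (\<Sum>s\<in>A. \<Sum>t\<in>A. x s * x t * standard_coeff m s t)"
    using assms by (intro sum.cong refl sum.mono_neutral_right) auto
  finally show ?thesis .
qed

text \<open>The off-diagonal coefficients are nonpositive.\<close>

lemma standard_form_abs_le:
  "standard_form S m (\<lambda>s. \<bar>x s\<bar>) (\<lambda>s. \<bar>x s\<bar>) \<le> standard_form S m x x"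
  unfolding standard_form_def
proof (intro sum_mono)
  fix s t assume st: "s \<in> S" "t \<in> S"
  show "\<bar>x s\<bar> * \<bar>x t\<bar> * standard_coeff m s t \<le> x s * x t * standard_coeff m s t"
  proof (cases "s = t")
    case False
    have "x s * x t \<le> \<bar>x s\<bar> * \<bar>x t\<bar>" by (simp flip: abs_mult)
    then show ?thesis using coeff_distinct_le_0[OF st False] by (rule mult_right_mono_neg)
  qed auto
qed

definition vec :: "('a \<Rightarrow> real) \<Rightarrow> 'a \<Rightarrow>\<^sub>0 real" where
  "vec f = (\<Sum>s\<in>S. f s *\<^sub>R simple s)"

lemma coord_vec: "finite S \<Longrightarrow> coord (vec f) t = (if t \<in> S then f t else 0)"
proof -
  assume fin: "finite S"
  have "coord (vec f) t = (\<Sum>s\<in>S. if s = t then f t else 0)"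
    unfolding vec_def lookup_sum_left by (intro sum.cong) (auto simp: lookup_single when_def)
  then show ?thesis using fin by simp
qed

lemma keys_vec: "finite S \<Longrightarrow> supp (vec f) \<subseteq> S"
  by (auto simp: in_keys_iff coord_vec split: if_splits)

lemma B_vec:
  assumes "finite S"
  shows "B (vec f) (vec g) = (\<Sum>s\<in>S. \<Sum>t\<in>S. f s * g t * B (simple s) (simple t))"
  using B_expand[OF assms keys_vec[OF assms] keys_vec[OF assms], of f g] assms
  by (simp add: coord_vec)

lemma B_vec_le_standard_form:
  assumes "finite S" "\<And>s. 0 \<le> f s"
  shows "B (vec f) (vec f) \<le> standard_form S m f f"
  unfolding B_vec[OF assms(1)] standard_form_def
  using assms B_le_coeff by (intro sum_mono mult_left_mono) auto

lemma B_eq_standard_form: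
  assumes "finite S" "\<And>s t. s \<in> S \<Longrightarrow> t \<in> S \<Longrightarrow> m s t \<noteq> \<infinity>" "supp x \<subseteq> S"
  shows "B x x = standard_form S m (coord x) (coord x)"
  unfolding B_expand[OF assms(1,3,3)] standard_form_def
  using assms(2) coeff_finite_bond by (intro sum.cong) auto

lemma infinite_bond_isotropic:
  assumes fin: "finite S" and st: "s \<in> S" "t \<in> S" "m s t = \<infinity>"
  shows "s \<noteq> t" "standard_form S m (\<lambda>v. if v = s \<or> v = t then 1 else 0)
      (\<lambda>v. if v = s \<or> v = t then 1 else 0) = 0"
proof -
  show neq: "s \<noteq> t" using st coxeter_matrix by (auto simp: coxeter_matrix_def)
  have "standard_coeff m s t = - 1" "standard_coeff m t s = - 1"
    using st coeff_symmetric[of s t] by (auto simp: standard_coeff_def)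
  then show "standard_form S m (\<lambda>v. if v = s \<or> v = t then 1 else 0)
      (\<lambda>v. if v = s \<or> v = t then 1 else 0) = 0"
    using st neq coeff_diagonal by (subst standard_form_on_support[OF fin, of "{s, t}"]) auto
qed

text \<open>If \<open>m s t = \<infinity>\<close>, then \<open>\<alpha>\<^sub>s + \<alpha>\<^sub>t\<close> is isotropic, hence in the radical of a positive semidefinite
  form, so no other generator is linked to \<open>s\<close> or \<open>t\<close>.\<close>

lemma psd_infinite_bond_rank_two:
  assumes irr: "irreducible_coxeter S m" and fin: "finite S"
    and psd: "\<And>x. 0 \<le> standard_form S m x x"
    and st: "s \<in> S" "t \<in> S" "m s t = \<infinity>"
  shows "S \<subseteq> {s, t}"
proof -
  have neq: "s \<noteq> t" using infinite_bond_isotropic(1)[OF fin st] .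
  have st1: "standard_coeff m s t = - 1" "standard_coeff m t s = - 1"
    using st coeff_symmetric[of s t] by (auto simp: standard_coeff_def)
  have no_link: "standard_coeff m s u = 0 \<and> standard_coeff m t u = 0"
    if u: "u \<in> S" "u \<noteq> s" "u \<noteq> t" for u
  proof -
    define b where "b = standard_coeff m s u + standard_coeff m t u"
    define x where "x v = (if v = s \<or> v = t then 1 else if v = u then - b else 0)" for v
    have "standard_form S m x x = (\<Sum>v\<in>{s,t,u}. \<Sum>w\<in>{s,t,u}. x v * x w * standard_coeff m v w)"
      using st u by (intro standard_form_on_support[OF fin]) (auto simp: x_def)
    also have "\<dots> = - (b * b)"
      using st u neq st1 coeff_diagonal coeff_symmetric[of u s] coeff_symmetric[of u t]
      by (simp add: x_def b_def algebra_simps)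
    finally have "b * b \<le> 0" using psd[of x] by simp
    then have "b * b = 0" using zero_le_square[of b] by linarith
    then have "b = 0" by simp
    moreover have "standard_coeff m s u \<le> 0" "standard_coeff m t u \<le> 0"
      using coeff_distinct_le_0[OF st(1) u(1)] coeff_distinct_le_0[OF st(2) u(1)] u by auto
    ultimately show ?thesis by (simp add: b_def)
  qed
  have "v \<in> {s, t}" if v: "v \<in> S" for v
  proof (rule irreducible_closed_set[where P = "\<lambda>v. v \<in> {s, t}", OF irr st(1) _ _ v])
    fix p q assume pq: "p \<in> S" "q \<in> S" "p \<in> {s, t}" "3 \<le> m p q"
    show "q \<in> {s, t}"
    proof (rule ccontr)
      assume "q \<notin> {s, t}"
      then have "standard_coeff m p q = 0" using no_link[of q] pq by auto
      then show False using coeff_bond_less_0[OF pq(1,2,4)] by simp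
    qed
  qed simp
  then show ?thesis by blast
qed

text \<open>Three vectors in a two-dimensional space satisfy a linear relation with their determinants as
  coefficients.\<close>

lemma rank_two_scattered:
  assumes S: "S \<subseteq> {s, t}" and r: "reflection_order S B simple r" and D: "D \<subseteq> Pos"
  shows "\<not> dense_order_on D r"
proof (rule coplanar_roots_scattered[OF r subset_refl _ D])
  fix x y z assume xyz: "x \<in> Pos" "y \<in> Pos" "z \<in> Pos" "x \<noteq> y"
  define det where "det x y = coord x s * coord y t - coord x t * coord y s" for x y :: "'a \<Rightarrow>\<^sub>0 real"
  have outside: "coord v i = 0" if "v \<in> Pos" "i \<notin> {s, t}" for v i
    using root_keys[OF Pos_root[OF that(1)]] S that(2) by (auto simp: in_keys_iff)
  have "det x y \<noteq> 0"
  proof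
    assume d: "det x y = 0"
    have zero: "coord x u = 0" if u: "u \<in> {s, t}" for u
    proof -
      have "coord y u *\<^sub>R x + (- coord x u) *\<^sub>R y = 0"
      proof (rule poly_mapping_eqI)
        fix i show "coord (coord y u *\<^sub>R x + (- coord x u) *\<^sub>R y) i = coord 0 i"
          using d u outside[OF xyz(1), of i] outside[OF xyz(2), of i]
          by (cases "i = s"; cases "i = t") (auto simp: lookup_add lookup_minus det_def algebra_simps)
      qed
      from Pos_independent[OF xyz(1,2,4) this] show ?thesis by simp
    qed
    have "x = 0" by (rule poly_mapping_eqI) (use zero outside[OF xyz(1)] in auto)
    then show False using root_nonzero[OF Pos_root[OF xyz(1)]] by simp
  qed
  moreover have "det y z *\<^sub>R x + det z x *\<^sub>R y + det x y *\<^sub>R z = 0"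
  proof (rule poly_mapping_eqI)
    fix i show "coord (det y z *\<^sub>R x + det z x *\<^sub>R y + det x y *\<^sub>R z) i = coord 0 i"
      using outside[OF xyz(1), of i] outside[OF xyz(2), of i] outside[OF xyz(3), of i]
      by (cases "i = s"; cases "i = t") (simp_all add: lookup_add lookup_minus det_def algebra_simps)
  qed
  ultimately show "\<exists>a b c. (a \<noteq> 0 \<or> b \<noteq> 0 \<or> c \<noteq> 0) \<and> a *\<^sub>R x + b *\<^sub>R y + c *\<^sub>R z = 0" by blast
qed

text \<open>In higher rank the positive roots fall into finitely many classes modulo the radical. The
  radical being a line, each class is coplanar.\<close>

theorem affine_scattered:
  assumes irr: "irreducible_coxeter S m" and aff: "affine_weyl S m"
    and r: "reflection_order S B simple r"
  shows "scattered_on Pos r"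
proof -
  have fin: "finite S" and psd_std: "\<And>x. 0 \<le> standard_form S m x x"
    using aff by (auto simp: affine_weyl_def)
  obtain x0 where "\<exists>s\<in>S. x0 s \<noteq> 0" "\<not> 0 < standard_form S m x0 x0"
    using aff unfolding affine_weyl_def by blast
  then have x0: "\<exists>s\<in>S. x0 s \<noteq> 0" "standard_form S m x0 x0 = 0" using psd_std[of x0] by auto
  have "\<not> dense_order_on D r" if D: "D \<subseteq> Pos" for D
  proof (cases "\<exists>s\<in>S. \<exists>t\<in>S. m s t = \<infinity>")
    case True
    then show ?thesis
      using psd_infinite_bond_rank_two[OF irr fin psd_std] rank_two_scattered[OF _ r D] by blast
  next
    case False
    have B_std: "B x x = standard_form S m (coord x) (coord x)" if "supp x \<subseteq> S" for x
    proof (rule B_eq_standard_form[OF fin _ that])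
      fix s t assume st: "s \<in> S" "t \<in> S"
      show "m s t \<noteq> \<infinity>"
      proof
        assume "m s t = \<infinity>"
        then have "\<exists>s\<in>S. \<exists>t\<in>S. m s t = \<infinity>" by (intro bexI[OF _ st(1)] bexI[OF _ st(2)])
        with False show False ..
      qed
    qed
    then have psd: psd using psd_std by (simp add: psd_def)
    define d where "d = vec (\<lambda>s. \<bar>x0 s\<bar>)"
    have keys_d: "supp d \<subseteq> S" unfolding d_def by (rule keys_vec[OF fin])
    have "B d d \<le> standard_form S m (\<lambda>s. \<bar>x0 s\<bar>) (\<lambda>s. \<bar>x0 s\<bar>)"
      unfolding d_def by (rule B_vec_le_standard_form[OF fin]) simp
    also have "\<dots> \<le> 0" using standard_form_abs_le[of x0] x0(2) by simp
    finally have "B d d = 0" using psd keys_d unfolding psd_def by (simp add: order_antisym)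
    then have d_rad: "d \<in> radical" using psd_null_radical[OF psd keys_d] by blast
    have d_cone: "d \<in> cone" using keys_d fin by (simp add: cone_iff d_def coord_vec)
    have "d \<noteq> 0"
    proof
      assume "d = 0"
      then have "coord d s = 0" for s by simp
      then have "\<bar>x0 s\<bar> = 0" if "s \<in> S" for s
        using that coord_vec[OF fin, of "\<lambda>s. \<bar>x0 s\<bar>" s] by (simp add: d_def)
      then show False using x0(1) by auto
    qed
    note span = nonneg_radical_spans[OF irr d_rad d_cone \<open>d \<noteq> 0\<close>]
    obtain \<C> where \<C>: "finite \<C>" "Pos = \<Union>\<C>"
      "\<And>C x y. C \<in> \<C> \<Longrightarrow> x \<in> C \<Longrightarrow> y \<in> C \<Longrightarrow> x - y \<in> radical"
      by (rule psd_finite_classes[OF fin psd]) (rule that; assumption)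
    show ?thesis
    proof
      assume dense: "dense_order_on D r"
      have ord: "trans r" "irrefl r" "total_on Pos r"
        using r by (auto simp: reflection_order_def strict_linear_order_on_def)
      obtain C D' where C: "C \<in> \<C>" "D' \<subseteq> D" "D' \<subseteq> C" "dense_order_on D' r"
        using dense_order_on_finite_Union[OF ord \<C>(1) dense D] D \<C>(2) by blast
      have "\<not> dense_order_on D' r"
      proof (rule coplanar_roots_scattered[OF r _ _ C(3)])
        show "C \<subseteq> Pos" using C(1) \<C>(2) by blast
        fix x y z assume xyz: "x \<in> C" "y \<in> C" "z \<in> C" "x \<noteq> y" "y \<noteq> z" "x \<noteq> z"
        obtain a where a: "x - z = a *\<^sub>R d" using span[OF \<C>(3)[OF C(1) xyz(1,3)]] .
        obtain b where b: "y - z = b *\<^sub>R d" using span[OF \<C>(3)[OF C(1) xyz(2,3)]] .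
        have "b \<noteq> 0" using b xyz by auto
        have "b *\<^sub>R (x - z) - a *\<^sub>R (y - z) = 0" unfolding a b by simp
        then have "b *\<^sub>R x + (- a) *\<^sub>R y + (a - b) *\<^sub>R z = 0" by (simp add: algebra_simps)
        then show "\<exists>a b c. (a \<noteq> 0 \<or> b \<noteq> 0 \<or> c \<noteq> 0) \<and> a *\<^sub>R x + b *\<^sub>R y + c *\<^sub>R z = 0"
          using \<open>b \<noteq> 0\<close> by blast
      qed
      then show False using C(4) by blast
    qed
  qed
  then show ?thesis unfolding scattered_on_def by blast
qed

text \<open>The radical is zero, so the finitely many classes modulo the radical are single roots.\<close>

lemma positive_definite_imp_finite:
  assumes fin: "finite S"
    and pos: "\<And>x. (\<exists>s\<in>S. x s \<noteq> 0) \<Longrightarrow> 0 < standard_form S m x x"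
  shows "finite (carrier W)"
proof (rule finite_Pos_imp_finite_group[OF fin])
  have no_inf: "m s t \<noteq> \<infinity>" if "s \<in> S" "t \<in> S" for s t
  proof
    assume "m s t = \<infinity>"
    then have "standard_form S m (\<lambda>v. if v = s \<or> v = t then 1 else 0)
      (\<lambda>v. if v = s \<or> v = t then 1 else 0) = 0" using infinite_bond_isotropic[OF fin] that by blast
    moreover have "\<exists>v\<in>S. (if v = s \<or> v = t then 1 else 0 :: real) \<noteq> 0"
      using that(1) by (intro bexI[of _ s]) auto
    ultimately show False using pos[of "\<lambda>v. if v = s \<or> v = t then 1 else 0"] by simp
  qed
  have B_pos: "0 < B x x" if "supp x \<subseteq> S" "x \<noteq> 0" for x
  proof -
    have "\<exists>s\<in>S. coord x s \<noteq> 0"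
    proof (rule ccontr)
      assume "\<not> (\<exists>s\<in>S. coord x s \<noteq> 0)"
      then have "coord x s = coord 0 s" for s using that(1) by (cases "s \<in> S") (auto simp: in_keys_iff)
      then show False using that(2) poly_mapping_eqI by blast
    qed
    then show ?thesis using pos B_eq_standard_form[OF fin no_inf that(1)] by simp
  qed
  have psd: psd unfolding psd_def
  proof (intro allI impI)
    fix x :: "'a \<Rightarrow>\<^sub>0 real" assume "supp x \<subseteq> S"
    then show "0 \<le> B x x" using B_pos[of x] by (cases "x = 0") (auto simp: B_simps)
  qed
  obtain \<C> where \<C>: "finite \<C>" "Pos = \<Union>\<C>"
    "\<And>C x y. C \<in> \<C> \<Longrightarrow> x \<in> C \<Longrightarrow> y \<in> C \<Longrightarrow> x - y \<in> radical"
    by (rule psd_finite_classes[OF fin psd]) (rule that; assumption)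
  have rad0: "x = 0" if "x \<in> radical" for x
  proof (rule ccontr)
    assume "x \<noteq> 0"
    have "supp x \<subseteq> S" using that by (simp add: radical_def)
    then show False using B_pos[OF _ \<open>x \<noteq> 0\<close>] radicalD(1)[OF that, of x] by simp
  qed
  have "finite C" if C: "C \<in> \<C>" for C
  proof (cases "C = {}")
    case False
    then obtain x where x: "x \<in> C" by blast
    have "y = x" if "y \<in> C" for y using rad0[OF \<C>(3)[OF C that x]] by simp
    then have "C \<subseteq> {x}" by blast
    then show ?thesis by (rule finite_subset) simp
  qed simp
  then show "finite Pos" unfolding \<C>(2) using \<C>(1) by (rule finite_Union[rotated])
qed

text \<open>Taking absolute values does not increase the standard form, and on nonnegative vectors \<open>B\<close> is at
  most the standard form, from which it differs only at infinite bonds.\<close>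

lemma indefinite_vector:
  assumes "finite S" "standard_form S m x x < 0"
  obtains z where "z \<in> cone" "B z z < 0"
proof
  show "vec (\<lambda>s. \<bar>x s\<bar>) \<in> cone"
    using keys_vec[OF assms(1)] by (simp add: cone_iff coord_vec[OF assms(1)])
  show "B (vec (\<lambda>s. \<bar>x s\<bar>)) (vec (\<lambda>s. \<bar>x s\<bar>)) < 0"
    using B_vec_le_standard_form[OF assms(1), of "\<lambda>s. \<bar>x s\<bar>"] standard_form_abs_le[of x] assms(2) by simp
qed

end

section \<open>Slope orders\<close>

text \<open>A total order on a space of finitely supported functions that is compatible with addition and
  with positive scaling, given by its positive elements: order the coordinates linearly and read
  off the sign of the first nonzero one.\<close>

lemma total_vector_order_exists:
  obtains L :: "('a \<Rightarrow>\<^sub>0 real) set"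
  where "0 \<notin> L" "\<And>x. x \<noteq> 0 \<Longrightarrow> x \<in> L \<or> - x \<in> L"
    "\<And>x y. x \<in> L \<Longrightarrow> y \<in> L \<Longrightarrow> x + y \<in> L"
    "\<And>x c. x \<in> L \<Longrightarrow> 0 < c \<Longrightarrow> c *\<^sub>R x \<in> L"
proof -
  obtain R :: "'a rel" where "well_order_on UNIV R" using well_order_on by blast
  then have total: "\<And>s t. s \<noteq> t \<Longrightarrow> (s, t) \<in> R \<or> (t, s) \<in> R"
    and anti: "\<And>s t. (s, t) \<in> R \<Longrightarrow> (t, s) \<in> R \<Longrightarrow> s = t"
    and trans: "\<And>s t u. (s, t) \<in> R \<Longrightarrow> (t, u) \<in> R \<Longrightarrow> (s, u) \<in> R"
    and wf: "wf (R - Id)"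
    by (auto simp: well_order_on_def linear_order_on_def partial_order_on_def preorder_on_def
        total_on_def antisym_def trans_def)
  define first where "first x s \<longleftrightarrow> (\<forall>t. (t, s) \<in> R \<longrightarrow> t \<noteq> s \<longrightarrow> coord x t = 0)"
    for x :: "'a \<Rightarrow>\<^sub>0 real" and s
  define L where "L = {x. \<exists>s. 0 < coord x s \<and> first x s}"
  show ?thesis
  proof (rule that[of L])
    show "0 \<notin> L" by (simp add: L_def)
  next
    fix x :: "'a \<Rightarrow>\<^sub>0 real" assume "x \<noteq> 0"
    then obtain s0 where "s0 \<in> supp x" by (metis ex_in_conv keys_eq_empty)
    then obtain s where s: "s \<in> supp x"
      "\<And>t. (t, s) \<in> R - Id \<Longrightarrow> t \<notin> supp x"
      using wfE_min[OF wf, of s0 "supp x"] by blast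
    then have "first x s" "first (- x) s" by (auto simp: first_def in_keys_iff)
    moreover have "0 < coord x s \<or> 0 < coord (- x) s"
      using s(1) by (auto simp: in_keys_iff)
    ultimately show "x \<in> L \<or> - x \<in> L" by (auto simp: L_def)
  next
    fix x y assume "x \<in> L" "y \<in> L"
    then obtain s t where s: "0 < coord x s" "first x s"
      and t: "0 < coord y t" "first y t" by (auto simp: L_def)
    consider "s = t" | "s \<noteq> t" "(s, t) \<in> R" | "s \<noteq> t" "(t, s) \<in> R" using total by blast
    then show "x + y \<in> L"
    proof cases
      case 1
      have "0 < coord (x + y) s" using s t 1 by (simp add: lookup_add)
      moreover have "first (x + y) s" using s t 1 by (simp add: lookup_add first_def)
      ultimately show ?thesis by (auto simp: L_def)
    next
      case 2
      have "coord y s = 0" using t(2) 2 by (simp add: first_def)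
      then have "0 < coord (x + y) s" using s by (simp add: lookup_add)
      moreover have "coord y u = 0" if "(u, s) \<in> R" "u \<noteq> s" for u
      proof -
        have "(u, t) \<in> R" "u \<noteq> t" using trans[OF that(1) 2(2)] anti[OF 2(2)] that 2 by auto
        then show ?thesis using t(2) by (simp add: first_def)
      qed
      then have "first (x + y) s" using s by (simp add: lookup_add first_def)
      ultimately show ?thesis by (auto simp: L_def)
    next
      case 3
      have "coord x t = 0" using s(2) 3 by (simp add: first_def)
      then have "0 < coord (x + y) t" using t by (simp add: lookup_add)
      moreover have "coord x u = 0" if "(u, t) \<in> R" "u \<noteq> t" for u
      proof -
        have "(u, s) \<in> R" "u \<noteq> s" using trans[OF that(1) 3(2)] anti[OF 3(2)] that 3 by auto
        then show ?thesis using s(2) by (simp add: first_def)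
      qed
      then have "first (x + y) t" using t by (simp add: lookup_add first_def)
      ultimately show ?thesis by (auto simp: L_def)
    qed
  next
    fix x :: "'a \<Rightarrow>\<^sub>0 real" and c :: real assume "x \<in> L" "0 < c"
    then obtain s where "0 < coord x s" "first x s" by (auto simp: L_def)
    then have "0 < coord (c *\<^sub>R x) s \<and> first (c *\<^sub>R x) s"
      using \<open>0 < c\<close> by (simp add: first_def)
    then show "c *\<^sub>R x \<in> L" unfolding L_def by blast
  qed
qed

context coordinate_rep
begin

text \<open>Comparing positive roots by the values of a linear functional at their multiples of height
  one gives a reflection order, because the normalization of \<open>a x + b y\<close> lies on the segment
  between those of \<open>x\<close> and \<open>y\<close>. Ties are broken by a total order of the vector space.\<close>

lemma slope_reflection_order:
  assumes \<phi>: "linear \<phi>"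
  obtains r where "reflection_order S B simple r"
    "\<And>x y. x \<in> Pos \<Longrightarrow> y \<in> Pos \<Longrightarrow> \<phi> x / height x < \<phi> y / height y \<Longrightarrow> (x, y) \<in> r"
proof -
  obtain L :: "('a \<Rightarrow>\<^sub>0 real) set" where L: "0 \<notin> L" "\<And>x. x \<noteq> 0 \<Longrightarrow> x \<in> L \<or> - x \<in> L"
    "\<And>x y. x \<in> L \<Longrightarrow> y \<in> L \<Longrightarrow> x + y \<in> L"
    "\<And>x c. x \<in> L \<Longrightarrow> 0 < c \<Longrightarrow> c *\<^sub>R x \<in> L"
    by (rule total_vector_order_exists) (rule that; assumption)
  define P where "P = {x. 0 < \<phi> x \<or> \<phi> x = 0 \<and> x \<in> L}"
  note lin = linear_add[OF \<phi>] linear_cmul[OF \<phi>] linear_0[OF \<phi>] linear_neg[OF \<phi>] linear_diff[OF \<phi>]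
  have P0: "0 \<notin> P" using L(1) by (simp add: P_def lin)
  have P_total: "x \<in> P \<or> - x \<in> P" if "x \<noteq> 0" for x using L(2)[OF that] by (auto simp: P_def lin)
  have P_add: "x + y \<in> P" if "x \<in> P" "y \<in> P" for x y using that L(3)[of x y] by (auto simp: P_def lin)
  have P_scale: "c *\<^sub>R x \<in> P" if "x \<in> P" "0 < c" for x c
    using that L(4)[of x c] by (auto simp: P_def lin)
  define n where "n x = (1 / height x) *\<^sub>R x" for x
  define r where "r = {(x, y). x \<in> Pos \<and> y \<in> Pos \<and> n y - n x \<in> P}"
  have n_inj: "x = y" if "x \<in> Pos" "y \<in> Pos" "n x = n y" for x y
  proof -
    have "x = height x *\<^sub>R n x" using height_Pos[OF that(1)] by (simp add: n_def)
    also have "\<dots> = (height x / height y) *\<^sub>R y" by (simp add: that(3)) (simp add: n_def)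
    finally show ?thesis by (rule Pos_proportional[OF that(1,2)])
  qed
  have "reflection_order S B simple r"
    unfolding reflection_order_def strict_linear_order_on_def
  proof (intro conjI allI impI)
    show "r \<subseteq> Pos \<times> Pos" by (auto simp: r_def)
    show "trans r"
    proof (rule transI)
      fix x y z assume "(x, y) \<in> r" "(y, z) \<in> r"
      then have "n z - n y \<in> P" "n y - n x \<in> P" and xz: "x \<in> Pos" "z \<in> Pos" by (auto simp: r_def)
      then have "(n z - n y) + (n y - n x) \<in> P" by (intro P_add)
      then show "(x, z) \<in> r" using xz by (simp add: r_def)
    qed
    show "irrefl r" using P0 by (auto simp: irrefl_def r_def)
    show "total_on Pos r"
    proof (rule total_onI)
      fix x y assume xy: "x \<in> Pos" "y \<in> Pos" "x \<noteq> y"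
      then have "n y - n x \<noteq> 0" using n_inj[of x y] by auto
      then show "(x, y) \<in> r \<or> (y, x) \<in> r" using P_total[of "n y - n x"] xy by (auto simp: r_def)
    qed
  next
    fix x y a b assume "(x, y) \<in> r" and ab: "0 < a" "0 < b" and z: "a *\<^sub>R x + b *\<^sub>R y \<in> Pos"
    then have xy: "x \<in> Pos" "y \<in> Pos" "n y - n x \<in> P" by (auto simp: r_def)
    let ?z = "a *\<^sub>R x + b *\<^sub>R y"
    have h: "0 < height x" "0 < height y" using height_Pos xy by auto
    define p q where "p = a * height x / height ?z" and "q = b * height y / height ?z"
    have hz: "height ?z = a * height x + b * height y" by (simp add: height_simps)
    then have hz0: "0 < height ?z" using ab h by (simp add: add_pos_pos)
    then have pq: "0 < p" "0 < q" "p + q = 1"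
      using ab h hz by (simp_all add: p_def q_def flip: add_divide_distrib)
    have nz: "n ?z = p *\<^sub>R n x + q *\<^sub>R n y"
      using h by (simp add: n_def p_def q_def scaleR_add_right)
    have p1: "p = 1 - q" using pq(3) by simp
    have "n ?z - n x = q *\<^sub>R (n y - n x)" unfolding nz p1 by (simp add: algebra_simps)
    moreover have q1: "q = 1 - p" using pq(3) by simp
    have "n y - n ?z = p *\<^sub>R (n y - n x)" unfolding nz q1 by (simp add: algebra_simps)
    ultimately show "(x, ?z) \<in> r" "(?z, y) \<in> r"
      using xy z pq P_scale[OF xy(3)] by (auto simp: r_def)
  qed
  moreover have "(x, y) \<in> r" if "x \<in> Pos" "y \<in> Pos" "\<phi> x / height x < \<phi> y / height y" for x y
    using that by (simp add: r_def P_def n_def lin)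
  ultimately show ?thesis by (rule that)
qed

lemma dense_slopes_imp_not_scattered:
  assumes \<phi>: "linear \<phi>" and Q: "Q \<subseteq> (\<lambda>x. \<phi> x / height x) ` Pos"
    and two: "u \<in> Q" "v \<in> Q" "u < v"
    and dense: "\<And>u v. u \<in> Q \<Longrightarrow> v \<in> Q \<Longrightarrow> u < v \<Longrightarrow> \<exists>w\<in>Q. u < w \<and> w < v"
  shows "\<exists>r. reflection_order S B simple r \<and> \<not> scattered_on Pos r"
proof -
  obtain r where r: "reflection_order S B simple r"
    "\<And>x y. x \<in> Pos \<Longrightarrow> y \<in> Pos \<Longrightarrow> \<phi> x / height x < \<phi> y / height y \<Longrightarrow> (x, y) \<in> r"
    by (rule slope_reflection_order[OF \<phi>]) (rule that; assumption)
  define sl where "sl x = \<phi> x / height x" for x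
  have "\<forall>q\<in>Q. \<exists>x. x \<in> Pos \<and> sl x = q" using Q by (auto simp: sl_def)
  then obtain g where g: "\<And>q. q \<in> Q \<Longrightarrow> g q \<in> Pos \<and> sl (g q) = q"
    by (rule bchoice[THEN exE]) blast
  have asym: "\<not> ((x, y) \<in> r \<and> (y, x) \<in> r)" for x y
    using r(1) unfolding reflection_order_def strict_linear_order_on_def by (meson irreflD transD)
  have gr: "(g p, g q) \<in> r" if "p \<in> Q" "q \<in> Q" "p < q" for p q
    using r(2)[of "g p" "g q"] g[OF that(1)] g[OF that(2)] that(3) by (simp add: sl_def)
  have "dense_order_on (g ` Q) r" unfolding dense_order_on_def
  proof (intro conjI ballI impI)
    have "g u \<noteq> g v" using g[OF two(1)] g[OF two(2)] two(3) by auto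
    then show "\<exists>x\<in>g ` Q. \<exists>y\<in>g ` Q. x \<noteq> y" using two by blast
  next
    fix x y assume "x \<in> g ` Q" "y \<in> g ` Q" and xy: "(x, y) \<in> r"
    then obtain p q where p: "p \<in> Q" "x = g p" and q: "q \<in> Q" "y = g q" by auto
    have "p < q"
    proof (rule ccontr)
      assume "\<not> p < q"
      then consider "p = q" | "q < p" by linarith
      then show False
        using xy p q gr[OF q(1) p(1)] asym[of x y] by cases auto
    qed
    then obtain w where "w \<in> Q" "p < w" "w < q" using dense p q by blast
    then show "\<exists>z\<in>g ` Q. (x, z) \<in> r \<and> (z, y) \<in> r" using gr p q by blast
  qed
  moreover have "g ` Q \<subseteq> Pos" using g by auto
  ultimately show ?thesis using r(1) unfolding scattered_on_def by blast
qed

text \<open>The simple roots have height one, so their slopes are the values of the functional and can be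
  chosen to run through the rationals.\<close>

theorem infinite_rank_not_scattered:
  assumes "infinite S"
  shows "\<exists>r. reflection_order S B simple r \<and> \<not> scattered_on Pos r"
proof -
  obtain f :: "nat \<Rightarrow> 'a" where f: "inj f" "range f \<subseteq> S"
    using infinite_countable_subset[OF assms] by blast
  define q :: "'a \<Rightarrow> real" where "q s = of_rat (from_nat (inv_into UNIV f s))" for s
  have q: "q (f (to_nat c)) = of_rat c" for c :: rat using f(1) by (simp add: q_def)
  show ?thesis
  proof (rule dense_slopes_imp_not_scattered[OF linear_weighted_sum, of "range of_rat" q "of_rat 0" "of_rat 1"])
    show "range real_of_rat \<subseteq> (\<lambda>x. weighted_sum q x / height x) ` Pos"
    proof
      fix c assume "c \<in> range real_of_rat"
      then obtain d where d: "c = real_of_rat d" by blast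
      have "weighted_sum q (simple (f (to_nat d))) / height (simple (f (to_nat d))) = c"
        by (simp add: weighted_sum_def d q)
      then show "c \<in> (\<lambda>x. weighted_sum q x / height x) ` Pos"
        using simple_Pos[of "f (to_nat d)"] f(2) by (intro image_eqI[of _ _ "simple (f (to_nat d))"]) auto
    qed
    fix u v :: real assume "u \<in> range of_rat" "v \<in> range of_rat" "u < v"
    then obtain a b where "u = of_rat a" "v = of_rat b" "a < b" by (auto simp: of_rat_less)
    moreover obtain c where "a < c" "c < b" using dense[OF \<open>a < b\<close>] by blast
    ultimately show "\<exists>w\<in>range of_rat. u < w \<and> w < v"
      by (intro bexI[of _ "of_rat c"]) (auto simp: of_rat_less)
  qed auto
qed

end

section \<open>Dense suborders of sets of reals\<close>

text \<open>A countable dense subset \<open>T\<close> of \<open>Y\<close> covers the closure by the countably many segments between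
  its points, up to at most one point above \<open>T\<close> and one below.\<close>

lemma countable_closure_if_countable_segments:
  fixes Y C :: "real set"
  assumes YC: "closure Y \<subseteq> C"
    and seg: "\<And>a b. a \<in> Y \<Longrightarrow> b \<in> Y \<Longrightarrow> countable (C \<inter> {a..b})"
  shows "countable (closure Y)"
proof -
  obtain T where T: "countable T" "T \<subseteq> Y" "Y \<subseteq> closure T" by (rule separable)
  define U where "U = (\<Union>a\<in>T. \<Union>b\<in>T. C \<inter> {a..b})"
  have "countable (C \<inter> {a..b})" if "a \<in> T" "b \<in> T" for a b
    using seg[of a b] T(2) that by blast
  then have "countable U" unfolding U_def using T(1) by (intro countable_UN) auto
  have clT: "closure Y \<subseteq> closure T" using T(3) by (simp add: closure_minimal)
  have above: "c = c'" if "c \<in> closure Y" "\<And>t. t \<in> T \<Longrightarrow> t < c" "c' \<in> closure Y" "\<And>t. t \<in> T \<Longrightarrow> t < c'" for c c'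
  proof -
    have "c \<in> closure {..c'}" "c' \<in> closure {..c}"
      using that clT closure_mono[of T "{..c}"] closure_mono[of T "{..c'}"] by (auto simp: subset_eq less_imp_le)
    then show ?thesis by simp
  qed
  have below: "c = c'" if "c \<in> closure Y" "\<And>t. t \<in> T \<Longrightarrow> c < t" "c' \<in> closure Y" "\<And>t. t \<in> T \<Longrightarrow> c' < t" for c c'
  proof -
    have "c \<in> closure {c'..}" "c' \<in> closure {c..}"
      using that clT closure_mono[of T "{c..}"] closure_mono[of T "{c'..}"] by (auto simp: subset_eq less_imp_le)
    then show ?thesis by simp
  qed
  define A where "A = {c \<in> closure Y. \<forall>t\<in>T. t < c}"
  define A' where "A' = {c \<in> closure Y. \<forall>t\<in>T. c < t}"
  have "countable A"
  proof (cases "A = {}")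
    case False
    then obtain c where "c \<in> A" by blast
    then have "A \<subseteq> {c}" using above by (auto simp: A_def)
    then show ?thesis by (rule countable_subset) simp
  qed simp
  moreover have "countable A'"
  proof (cases "A' = {}")
    case False
    then obtain c where "c \<in> A'" by blast
    then have "A' \<subseteq> {c}" using below by (auto simp: A'_def)
    then show ?thesis by (rule countable_subset) simp
  qed simp
  ultimately have "countable (U \<union> A \<union> A')" using \<open>countable U\<close> by simp
  moreover have "closure Y \<subseteq> U \<union> A \<union> A'"
  proof
    fix c assume c: "c \<in> closure Y"
    show "c \<in> U \<union> A \<union> A'"
    proof (cases "c \<in> A \<union> A'")
      case False
      then obtain a b where "a \<in> T" "a \<le> c" "b \<in> T" "c \<le> b"
        using c by (auto simp: A_def A'_def not_less)
      then show ?thesis using c YC by (auto simp: U_def)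
    qed auto
  qed
  ultimately show ?thesis by (rule countable_subset[rotated])
qed

text \<open>Call two points of \<open>X\<close> equivalent if only countably many points of the closure lie between
  them. The classes are convex and have countable closure, so there are several of them, and between
  two of them there is a third: otherwise the segment would be the union of two classes. Hence a
  system of representatives is densely ordered.\<close>

lemma uncountable_closure_contains_dense_order:
  fixes X :: "real set"
  assumes unc: "uncountable (closure X)"
  obtains Q u v where "Q \<subseteq> X" "u \<in> Q" "v \<in> Q" "u < v"
    "\<And>u v. u \<in> Q \<Longrightarrow> v \<in> Q \<Longrightarrow> u < v \<Longrightarrow> \<exists>w\<in>Q. u < w \<and> w < v"
proof -
  define C where "C = closure X"
  define E where "E a b \<longleftrightarrow> countable (C \<inter> {min a b..max a b})" for a b
  have E_refl: "E a a" for a by (simp add: E_def)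
  have E_sym: "E a b \<Longrightarrow> E b a" for a b by (simp add: E_def min.commute max.commute)
  have E_mono: "E a b" if "E c d" "min c d \<le> min a b" "max a b \<le> max c d" for a b c d
  proof -
    have "C \<inter> {min a b..max a b} \<subseteq> C \<inter> {min c d..max c d}"
      using that(2,3) by (intro Int_mono order_refl) (simp only: atLeastatMost_subset_iff, blast)
    then show ?thesis using that(1) unfolding E_def by (rule countable_subset)
  qed
  have E_trans: "E a c" if "E a b" "E b c" for a b c
  proof -
    have "C \<inter> {min a c..max a c} \<subseteq> (C \<inter> {min a b..max a b}) \<union> (C \<inter> {min b c..max b c})"
      by auto
    moreover have "countable ((C \<inter> {min a b..max a b}) \<union> (C \<inter> {min b c..max b c}))"
      using that by (simp add: E_def)
    ultimately show ?thesis unfolding E_def by (rule countable_subset)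
  qed
  have cls: "countable (closure Y)" if "Y \<subseteq> X" "\<And>a b. a \<in> Y \<Longrightarrow> b \<in> Y \<Longrightarrow> E a b" for Y
  proof (rule countable_closure_if_countable_segments)
    show "closure Y \<subseteq> C" unfolding C_def using that(1) by (rule closure_mono)
    fix a b assume "a \<in> Y" "b \<in> Y"
    then have "countable (C \<inter> {min a b..max a b})" using that(2) by (simp add: E_def)
    then show "countable (C \<inter> {a..b})" by (rule countable_subset[rotated]) auto
  qed
  have between: "\<exists>z\<in>X. a < z \<and> z < b \<and> \<not> E a z \<and> \<not> E z b" if ab: "a \<in> X" "b \<in> X" "a < b" "\<not> E a b" for a b
  proof (rule ccontr)
    assume none: "\<not> (\<exists>z\<in>X. a < z \<and> z < b \<and> \<not> E a z \<and> \<not> E z b)"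
    define Ya where "Ya = {z \<in> X. a \<le> z \<and> z \<le> b \<and> E a z}"
    define Yb where "Yb = {z \<in> X. a \<le> z \<and> z \<le> b \<and> E z b}"
    have "countable (closure Ya)"
      by (rule cls) (auto simp: Ya_def intro: E_trans[OF E_sym])
    moreover have "countable (closure Yb)"
      by (rule cls) (auto simp: Yb_def intro: E_trans[OF _ E_sym])
    moreover have "X \<inter> {a..b} \<subseteq> Ya \<union> Yb"
    proof
      fix z assume z: "z \<in> X \<inter> {a..b}"
      then consider "z = a" | "z = b" | "a < z" "z < b" by fastforce
      then show "z \<in> Ya \<union> Yb"
        by cases (use z none ab E_refl in \<open>auto simp: Ya_def Yb_def\<close>)
    qed
    moreover have "C \<inter> {a..b} \<subseteq> closure (X \<inter> {a..b}) \<union> {a, b}"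
    proof
      fix c assume c: "c \<in> C \<inter> {a..b}"
      show "c \<in> closure (X \<inter> {a..b}) \<union> {a, b}"
      proof (cases "c = a \<or> c = b")
        case False
        then have "c \<in> {a<..<b}" using c by auto
        then have "c \<in> closure ({a<..<b} \<inter> X)"
          using open_Int_closure_subset[of "{a<..<b}" X] c by (auto simp: C_def)
        moreover have "closure ({a<..<b} \<inter> X) \<subseteq> closure (X \<inter> {a..b})" by (rule closure_mono) auto
        ultimately show ?thesis by blast
      qed auto
    qed
    moreover have "closure (X \<inter> {a..b}) \<subseteq> closure Ya \<union> closure Yb"
      using closure_mono[OF \<open>X \<inter> {a..b} \<subseteq> Ya \<union> Yb\<close>] by simp
    ultimately have "C \<inter> {a..b} \<subseteq> closure Ya \<union> closure Yb \<union> {a, b}"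
      "countable (closure Ya \<union> closure Yb \<union> {a, b})" by auto
    then have "countable (C \<inter> {a..b})" by (rule countable_subset)
    then show False using ab by (simp add: E_def min_def max_def)
  qed
  define rep where "rep x = (SOME y. y \<in> X \<and> E x y)" for x
  have rep: "rep x \<in> X \<and> E x (rep x)" if "x \<in> X" for x
    unfolding rep_def by (rule someI[of _ x]) (simp add: that E_refl)
  have rep_eq: "rep x = rep y" if "E x y" for x y
  proof -
    have "E x z \<longleftrightarrow> E y z" for z using E_trans E_sym that by blast
    then show ?thesis by (simp add: rep_def)
  qed
  have inequiv: "\<not> E u v" if uv': "u \<in> rep ` X" "v \<in> rep ` X" "u \<noteq> v" for u v
  proof
    assume uv: "E u v"
    obtain x where x: "u = rep x" "x \<in> X" using uv'(1) by (rule imageE)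
    obtain y where y: "v = rep y" "y \<in> X" using uv'(2) by (rule imageE)
    have "E x u" "E y v" using rep x y by auto
    then have "E x y" using uv E_trans E_sym by blast
    then show False using rep_eq x y uv'(3) by simp
  qed
  have "\<exists>a\<in>X. \<exists>b\<in>X. \<not> E a b"
  proof (rule ccontr)
    assume "\<not> (\<exists>a\<in>X. \<exists>b\<in>X. \<not> E a b)"
    then have "countable (closure X)" by (intro cls) auto
    then show False using unc by blast
  qed
  then obtain a b where ab: "a \<in> X" "b \<in> X" "\<not> E a b" by blast
  have neq: "rep a \<noteq> rep b"
  proof
    assume eq: "rep a = rep b"
    have "E a (rep a)" "E b (rep a)" using rep[OF ab(1)] rep[OF ab(2)] eq by auto
    then show False using E_trans[OF _ E_sym] ab(3) by blast
  qed
  have dense: "\<exists>w\<in>rep ` X. u < w \<and> w < v" if uv: "u \<in> rep ` X" "v \<in> rep ` X" "u < v" for u v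
  proof -
    have X: "u \<in> X" "v \<in> X" using uv rep by auto
    have "\<not> E u v" using inequiv uv by auto
    then obtain z where z: "z \<in> X" "u < z" "z < v" "\<not> E u z" "\<not> E z v" using between X uv by blast
    have w: "E z (rep z)" using rep z by blast
    have "u < rep z"
    proof (rule ccontr)
      assume "\<not> u < rep z"
      then have "E u z" using E_mono[OF w, of u z] z(2) by (simp add: min_def max_def)
      then show False using z(4) by blast
    qed
    moreover have "rep z < v"
    proof (rule ccontr)
      assume "\<not> rep z < v"
      then have "E z v" using E_mono[OF w, of z v] z(3) by (simp add: min_def max_def)
      then show False using z(5) by blast
    qed
    ultimately show ?thesis using z(1) by blast
  qed
  have sub: "rep ` X \<subseteq> X" using rep by auto
  show ?thesis
  proof (cases "rep a < rep b")
    case True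
    then show ?thesis using that[of "rep ` X" "rep a" "rep b"] sub ab dense by blast
  next
    case False
    then have "rep b < rep a" using neq by linarith
    then show ?thesis using that[of "rep ` X" "rep b" "rep a"] sub ab dense by blast
  qed
qed

section \<open>Limit roots\<close>

context coordinate_rep
begin

text \<open>A form with Gram matrix \<open>b\<close> and a positive vector \<open>d\<close> in its radical is a sum of squares:
  \<open>B x x = - 1/2 (\<Sum>s. \<Sum>t. b\<^sub>s\<^sub>t d\<^sub>s d\<^sub>t (x\<^sub>s / d\<^sub>s - x\<^sub>t / d\<^sub>t)\<^sup>2)\<close>. The terms with \<open>s = t\<close> vanish, and
  \<open>b\<^sub>s\<^sub>t \<le> 0\<close> for \<open>s \<noteq> t\<close>.\<close>

lemma nonneg_radical_imp_psd:
  assumes irr: "irreducible_coxeter S m" and fin: "finite S"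
    and d: "d \<in> radical" "d \<in> cone" "d \<noteq> 0" and x: "supp x \<subseteq> S"
  shows "0 \<le> B x x"
proof -
  define b where "b s t = B (simple s) (simple t)" for s t
  define y where "y s = coord x s / coord d s" for s
  have dpos: "0 < coord d s" if "s \<in> S" for s using nonneg_radical_full_support[OF irr d that] .
  have xd: "coord x s = coord d s * y s" if "s \<in> S" for s using dpos[OF that] by (simp add: y_def)
  have row: "(\<Sum>t\<in>S. coord d t * b s t) = 0" if "s \<in> S" for s
  proof -
    have "(\<Sum>t\<in>S. coord d t * b s t) = B d (simple s)"
      using B_expand_left[OF fin, of d "simple s"] d(2)
      by (simp add: cone_iff b_def symmetric[of "simple s"])
    then show ?thesis using d(1) that by (simp add: radical_def)
  qed
  have b_sym: "b s t = b t s" for s t by (simp add: b_def symmetric)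
  have xx: "B x x = (\<Sum>s\<in>S. \<Sum>t\<in>S. coord d s * coord d t * b s t * (y s * y t))"
    unfolding B_expand[OF fin x x]
    by (intro sum.cong refl) (simp add: xd b_def)
  have sq1: "(\<Sum>s\<in>S. \<Sum>t\<in>S. coord d s * coord d t * b s t * (y s)\<^sup>2) = 0"
  proof (rule sum.neutral, rule ballI)
    fix s assume "s \<in> S"
    have "(\<Sum>t\<in>S. coord d s * coord d t * b s t * (y s)\<^sup>2) = coord d s * (y s)\<^sup>2 * (\<Sum>t\<in>S. coord d t * b s t)"
      by (simp add: sum_distrib_left mult_ac)
    then show "(\<Sum>t\<in>S. coord d s * coord d t * b s t * (y s)\<^sup>2) = 0" using row[OF \<open>s \<in> S\<close>] by simp
  qed
  have sq2: "(\<Sum>s\<in>S. \<Sum>t\<in>S. coord d s * coord d t * b s t * (y t)\<^sup>2) = 0"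
  proof -
    have "(\<Sum>s\<in>S. \<Sum>t\<in>S. coord d s * coord d t * b s t * (y t)\<^sup>2)
        = (\<Sum>t\<in>S. \<Sum>s\<in>S. coord d s * coord d t * b s t * (y t)\<^sup>2)" by (rule sum.swap)
    also have "\<dots> = (\<Sum>t\<in>S. \<Sum>s\<in>S. coord d t * coord d s * b t s * (y t)\<^sup>2)"
      by (intro sum.cong refl) (simp add: b_sym mult_ac)
    finally show ?thesis using sq1 by simp
  qed
  have "(\<Sum>s\<in>S. \<Sum>t\<in>S. coord d s * coord d t * b s t * (y s - y t)\<^sup>2) = - 2 * B x x"
  proof -
    have "(\<Sum>s\<in>S. \<Sum>t\<in>S. coord d s * coord d t * b s t * (y s - y t)\<^sup>2)
      = (\<Sum>s\<in>S. \<Sum>t\<in>S. coord d s * coord d t * b s t * (y s)\<^sup>2)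
      + (\<Sum>s\<in>S. \<Sum>t\<in>S. coord d s * coord d t * b s t * (y t)\<^sup>2)
      - 2 * (\<Sum>s\<in>S. \<Sum>t\<in>S. coord d s * coord d t * b s t * (y s * y t))"
      by (simp add: sum_distrib_left flip: sum.distrib sum_subtractf)
        (simp add: power2_diff algebra_simps)
    then show ?thesis by (simp add: sq1 sq2 xx)
  qed
  moreover have "(\<Sum>s\<in>S. \<Sum>t\<in>S. coord d s * coord d t * b s t * (y s - y t)\<^sup>2) \<le> 0"
  proof (intro sum_nonpos)
    fix s t assume st: "s \<in> S" "t \<in> S"
    show "coord d s * coord d t * b s t * (y s - y t)\<^sup>2 \<le> 0"
    proof (cases "s = t")
      case False
      have "coord d s * coord d t * b s t \<le> 0"
        using dpos[OF st(1)] dpos[OF st(2)] B_simple_distinct_le_0[OF st False]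
        by (simp add: b_def mult_nonneg_nonpos)
      then show ?thesis by (rule mult_nonpos_nonneg) simp
    qed simp
  qed
  ultimately show ?thesis by simp
qed

definition normalize :: "('a \<Rightarrow>\<^sub>0 real) \<Rightarrow> 'a \<Rightarrow>\<^sub>0 real" where
  "normalize x = (1 / height x) *\<^sub>R x"

lemma normalize_scale: "c \<noteq> 0 \<Longrightarrow> normalize (c *\<^sub>R x) = normalize x"
  by (simp add: normalize_def height_simps)

lemma height_normalize: "height x \<noteq> 0 \<Longrightarrow> height (normalize x) = 1"
  by (simp add: normalize_def height_simps)

definition root_sequence :: "(nat \<Rightarrow> 'a \<Rightarrow>\<^sub>0 real) \<Rightarrow> ('a \<Rightarrow>\<^sub>0 real) \<Rightarrow> bool" where
  "root_sequence \<gamma> e \<longleftrightarrow> (\<forall>n. \<gamma> n \<in> Pos) \<and> (\<lambda>n. normalize (\<gamma> n)) \<longlonglongrightarrow> e \<and>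
     filterlim (\<lambda>n. height (\<gamma> n)) at_top sequentially"

definition limit_roots :: "('a \<Rightarrow>\<^sub>0 real) set" where
  "limit_roots = {e. \<exists>\<gamma>. root_sequence \<gamma> e}"

definition unit_box :: "('a \<Rightarrow>\<^sub>0 real) set" where
  "unit_box = {x. supp x \<subseteq> S \<and> (\<forall>s. 0 \<le> coord x s \<and> coord x s \<le> 1)}"

lemma normalize_Pos_unit_box: "x \<in> Pos \<Longrightarrow> normalize x \<in> unit_box"
proof -
  assume x: "x \<in> Pos"
  have "normalize x \<in> cone" unfolding normalize_def
    using x height_Pos[OF x] by (intro cone_scale Pos_cone) auto
  moreover from this have "coord (normalize x) s \<le> 1" for s
    using coord_le_height[of "normalize x" s] height_normalize[of x] height_Pos[OF x] by simp
  ultimately show ?thesis by (auto simp: unit_box_def cone_iff)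
qed

lemma tendsto_height:
  assumes "finite S" "(f \<longlongrightarrow> l) F" "\<And>i. supp (f i) \<subseteq> S" "supp l \<subseteq> S"
  shows "((\<lambda>i. height (f i)) \<longlongrightarrow> height l) F"
  using assms by (simp add: height_def weighted_sum_eq[of S] tendsto_intros)

context
  assumes fin: "finite S"
begin

lemma compact_unit_box: "compact unit_box"
  unfolding unit_box_def by (rule compact_coordinate_box[OF fin])

lemma limit_root_basic:
  assumes "root_sequence \<gamma> e"
  shows "e \<in> unit_box" "e \<in> cone" "supp e \<subseteq> S" "height e = 1" "B e e = 0"
proof -
  have \<gamma>: "\<gamma> n \<in> Pos" "(\<lambda>n. normalize (\<gamma> n)) \<longlonglongrightarrow> e" for n
    using assms by (auto simp: root_sequence_def)
  have inf: "filterlim (\<lambda>n. height (\<gamma> n)) at_top sequentially"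
    using assms by (simp add: root_sequence_def)
  show box: "e \<in> unit_box"
    by (rule closed_sequentially[OF compact_imp_closed[OF compact_unit_box] _ \<gamma>(2)])
      (rule normalize_Pos_unit_box[OF \<gamma>(1)])
  then show "e \<in> cone" and keys: "supp e \<subseteq> S" by (auto simp: unit_box_def cone_iff)
  have keysn: "supp (normalize (\<gamma> n)) \<subseteq> S" for n
    using normalize_Pos_unit_box[OF \<gamma>(1)] by (auto simp: unit_box_def)
  have hn: "0 < height (\<gamma> n)" for n using height_Pos[OF \<gamma>(1)] .
  have "(\<lambda>n. height (normalize (\<gamma> n))) \<longlonglongrightarrow> height e"
    by (rule tendsto_height[OF fin \<gamma>(2) keysn keys])
  moreover have "height (normalize (\<gamma> n)) = 1" for n using height_normalize[of "\<gamma> n"] hn[of n] by simp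
  ultimately show "height e = 1" by (simp add: LIMSEQ_const_iff)
  have "(\<lambda>n. B (normalize (\<gamma> n)) (normalize (\<gamma> n))) \<longlonglongrightarrow> B e e"
    by (rule tendsto_B[OF fin \<gamma>(2) \<gamma>(2) keysn keysn keys keys])
  moreover have "B (normalize (\<gamma> n)) (normalize (\<gamma> n)) = inverse (height (\<gamma> n)) * inverse (height (\<gamma> n))" for n
    using \<gamma>(1)[of n] by (simp add: normalize_def B_simps Pos_norm divide_inverse)
  moreover have "(\<lambda>n. inverse (height (\<gamma> n)) * inverse (height (\<gamma> n))) \<longlonglongrightarrow> 0 * 0"
    by (intro tendsto_mult tendsto_inverse_0_at_top inf)
  ultimately show "B e e = 0" using LIMSEQ_unique by fastforce
qed

lemma limit_rootsD:
  assumes "e \<in> limit_roots"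
  shows "e \<in> unit_box" "e \<in> cone" "supp e \<subseteq> S" "height e = 1" "B e e = 0" "e \<noteq> 0"
proof -
  obtain \<gamma> where "root_sequence \<gamma> e" using assms by (auto simp: limit_roots_def)
  from limit_root_basic[OF this] show "e \<in> unit_box" "e \<in> cone" "supp e \<subseteq> S"
    "height e = 1" "B e e = 0" by auto
  then show "e \<noteq> 0" by (auto simp: height_simps)
qed

text \<open>Heights tend to infinity along a convergent sequence of distinct normalized roots, as only
  finitely many roots have bounded height.\<close>

lemma limit_roots_eq_limpts: "limit_roots = {e. e islimpt normalize ` Pos}"
proof (intro Set.set_eqI iffI)
  fix e assume "e \<in> limit_roots"
  then obtain \<gamma> where \<gamma>: "root_sequence \<gamma> e" by (auto simp: limit_roots_def)
  have Pos: "\<gamma> n \<in> Pos" for n using \<gamma> by (simp add: root_sequence_def)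
  have "normalize (\<gamma> n) \<noteq> e" for n
  proof
    assume e: "normalize (\<gamma> n) = e"
    have "B (normalize (\<gamma> n)) (normalize (\<gamma> n)) \<noteq> 0"
      using height_Pos[OF Pos[of n]] Pos[of n] by (simp add: normalize_def B_simps Pos_norm)
    then show False using limit_root_basic(5)[OF \<gamma>] e by simp
  qed
  then have "\<forall>n. normalize (\<gamma> n) \<in> normalize ` Pos - {e}" using Pos by simp
  moreover have "(\<lambda>n. normalize (\<gamma> n)) \<longlonglongrightarrow> e" using \<gamma> by (simp add: root_sequence_def)
  ultimately show "e \<in> {e. e islimpt normalize ` Pos}"
    unfolding mem_Collect_eq islimpt_sequential by (intro exI[of _ "\<lambda>n. normalize (\<gamma> n)"] conjI)
next
  fix e assume "e \<in> {e. e islimpt normalize ` Pos}"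
  then obtain f where f: "\<And>n. f n \<in> normalize ` Pos - {e}" "f \<longlonglongrightarrow> e"
    unfolding mem_Collect_eq islimpt_sequential by blast
  have "\<forall>n. \<exists>x. x \<in> Pos \<and> normalize x = f n" using f(1) by (metis DiffD1 imageE)
  then obtain \<gamma> where \<gamma>: "\<And>n. \<gamma> n \<in> Pos \<and> normalize (\<gamma> n) = f n" by (rule choice[THEN exE]) blast
  have "filterlim (\<lambda>n. height (\<gamma> n)) at_top sequentially"
    unfolding filterlim_at_top
  proof
    fix M :: real
    define A where "A = normalize ` {x \<in> Pos. height x \<le> M} - {e}"
    have "finite A" unfolding A_def using finite_roots_of_bounded_height[OF fin] by simp
    then have "open (- A)" by (simp add: finite_imp_closed open_Compl)
    moreover have "e \<in> - A" by (simp add: A_def)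
    ultimately have "\<forall>\<^sub>F n in sequentially. f n \<in> - A" by (rule topological_tendstoD[OF f(2)])
    then show "\<forall>\<^sub>F n in sequentially. M \<le> height (\<gamma> n)"
    proof eventually_elim
      fix n assume n: "f n \<in> - A"
      show "M \<le> height (\<gamma> n)"
      proof (rule ccontr)
        assume "\<not> M \<le> height (\<gamma> n)"
        then have "f n \<in> normalize ` {x \<in> Pos. height x \<le> M}"
          using \<gamma>[of n] by (intro image_eqI[of _ _ "\<gamma> n"]) auto
        then show False using n f(1)[of n] by (simp add: A_def)
      qed
    qed
  qed
  moreover have "(\<lambda>n. normalize (\<gamma> n)) = f" using \<gamma> by auto
  ultimately have "root_sequence \<gamma> e" using \<gamma> f(2) by (simp add: root_sequence_def)
  then show "e \<in> limit_roots" by (auto simp: limit_roots_def)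
qed

lemma keys_reflection: "supp x \<subseteq> S \<Longrightarrow> supp \<delta> \<subseteq> S \<Longrightarrow>
    supp (reflection B \<delta> x) \<subseteq> S"
  using keys_combination[of x \<delta> 1 "- (2 * B x \<delta>)"] by (simp add: reflection_def)

lemma tendsto_reflection:
  assumes "(f \<longlongrightarrow> l) F" "\<And>i. supp (f i) \<subseteq> S" "supp l \<subseteq> S"
    "supp \<delta> \<subseteq> S"
  shows "((\<lambda>i. reflection B \<delta> (f i)) \<longlongrightarrow> reflection B \<delta> l) F"
  unfolding reflection_def
  by (intro tendsto_intros tendsto_B[OF fin]) (use assms in auto)

text \<open>Limit roots are permuted, up to normalization, by the reflections: all but finitely many members
  of a root sequence stay positive under a given reflection.\<close>

lemma reflection_limit_root:
  assumes x: "x \<in> limit_roots" and \<delta>: "\<delta> \<in> Pos"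
  shows "0 < height (reflection B \<delta> x)" "normalize (reflection B \<delta> x) \<in> limit_roots"
proof -
  obtain \<gamma> where \<gamma>: "root_sequence \<gamma> x" using x by (auto simp: limit_roots_def)
  have Pos: "\<gamma> n \<in> Pos" "(\<lambda>n. normalize (\<gamma> n)) \<longlonglongrightarrow> x"
    "filterlim (\<lambda>n. height (\<gamma> n)) at_top sequentially" for n
    using \<gamma> by (auto simp: root_sequence_def)
  note xD = limit_rootsD[OF x]
  have keys: "supp (normalize (\<gamma> n)) \<subseteq> S" "supp \<delta> \<subseteq> S" for n
    using normalize_Pos_unit_box[OF Pos(1)] root_keys[OF Pos_root[OF \<delta>]] by (auto simp: unit_box_def)
  let ?N = "{z \<in> Pos. reflection B \<delta> z \<notin> Pos}"
  have N: "finite ?N" by (rule finite_reflection_inversions[OF \<delta>])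
  have "\<forall>\<^sub>F n in sequentially. Max (insert 0 (height ` ?N)) < height (\<gamma> n)"
    using Pos(3) by (simp add: filterlim_at_top_dense)
  then obtain n0 where n0: "\<And>n. n0 \<le> n \<Longrightarrow> Max (insert 0 (height ` ?N)) < height (\<gamma> n)"
    by (auto simp: eventually_sequentially)
  define y where "y n = reflection B \<delta> (normalize (\<gamma> (n + n0)))" for n
  define \<eta> where "\<eta> n = reflection B \<delta> (\<gamma> (n + n0))" for n
  have \<eta>Pos: "\<eta> n \<in> Pos" for n
  proof (rule ccontr)
    assume "\<eta> n \<notin> Pos"
    then have "\<gamma> (n + n0) \<in> ?N" using Pos(1) by (simp add: \<eta>_def)
    then have "height (\<gamma> (n + n0)) \<le> Max (insert 0 (height ` ?N))" using N by (intro Max_ge) auto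
    then show False using n0[of "n + n0"] by simp
  qed
  have hg: "0 < height (\<gamma> n)" for n using height_Pos[OF Pos(1)] .
  have y\<eta>: "y n = (1 / height (\<gamma> (n + n0))) *\<^sub>R \<eta> n" for n
    by (simp add: y_def \<eta>_def normalize_def reflection_scale)
  have y: "y \<longlonglongrightarrow> reflection B \<delta> x"
    unfolding y_def[abs_def]
    by (rule LIMSEQ_ignore_initial_segment) (rule tendsto_reflection[OF Pos(2) keys(1) xD(3) keys(2)])
  have keysy: "supp (y n) \<subseteq> S" for n
    unfolding y_def by (rule keys_reflection[OF keys])
  have keysx: "supp (reflection B \<delta> x) \<subseteq> S"
    by (rule keys_reflection[OF xD(3) keys(2)])
  have coordy: "0 \<le> coord (y n) s" for n s
    using Pos_coord[OF \<eta>Pos[of n], of s] hg[of "n + n0"] by (simp add: y\<eta>)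
  have "0 \<le> coord (reflection B \<delta> x) s" for s
    by (rule LIMSEQ_le_const[OF tendsto_lookup[OF y]]) (simp add: coordy)
  then have cone: "reflection B \<delta> x \<in> cone" using keysx by (simp add: cone_iff)
  have "reflection B \<delta> (reflection B \<delta> x) = x" using \<delta> by (simp add: reflection_involution Pos_norm)
  moreover have "reflection B \<delta> 0 = 0" by (simp add: reflection_def B_simps)
  ultimately have "reflection B \<delta> x \<noteq> 0" using xD(6) by metis
  then show h: "0 < height (reflection B \<delta> x)" by (rule height_pos[OF cone])
  have hy: "(\<lambda>n. height (y n)) \<longlonglongrightarrow> height (reflection B \<delta> x)"
    by (rule tendsto_height[OF fin y keysy keysx])
  have norm: "normalize (\<eta> n) = (1 / height (y n)) *\<^sub>R y n" for n
  proof -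
    have "normalize (y n) = normalize (\<eta> n)"
      unfolding y\<eta> using hg[of "n + n0"] by (intro normalize_scale) simp
    then show ?thesis by (simp only: normalize_def[of "y n"])
  qed
  have "(\<lambda>n. normalize (\<eta> n)) \<longlonglongrightarrow> normalize (reflection B \<delta> x)"
    unfolding norm normalize_def[of "reflection B \<delta> x"] using h by (intro tendsto_intros hy y) auto
  moreover have "filterlim (\<lambda>n. height (\<eta> n)) at_top sequentially"
  proof -
    have "filterlim (\<lambda>n. height (\<gamma> (n + n0))) at_top sequentially"
      using filterlim_compose[OF Pos(3) filterlim_add_const_nat_at_top] by simp
    from filterlim_tendsto_pos_mult_at_top[OF hy h this]
    show ?thesis using hg by (simp add: y\<eta> height_simps less_imp_neq[symmetric])
  qed
  ultimately have "root_sequence \<eta> (normalize (reflection B \<delta> x))"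
    using \<eta>Pos by (simp add: root_sequence_def)
  then show "normalize (reflection B \<delta> x) \<in> limit_roots" by (auto simp: limit_roots_def)
qed

text \<open>Reflecting in the members of a root sequence pushes every limit root that is not orthogonal
  to the limit \<open>e\<close> towards \<open>e\<close>.\<close>

lemma reflections_converge:
  assumes \<gamma>: "root_sequence \<gamma> e" and x: "x \<in> limit_roots" and xe: "B x e \<noteq> 0"
  shows "(\<lambda>n. normalize (reflection B (\<gamma> n) x)) \<longlonglongrightarrow> e"
proof -
  have Pos: "\<gamma> n \<in> Pos" "(\<lambda>n. normalize (\<gamma> n)) \<longlonglongrightarrow> e"
    "filterlim (\<lambda>n. height (\<gamma> n)) at_top sequentially" for n
    using \<gamma> by (auto simp: root_sequence_def)
  note xD = limit_rootsD[OF x] and eD = limit_root_basic[OF \<gamma>]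
  have hg: "0 < height (\<gamma> n)" for n using height_Pos[OF Pos(1)] .
  define g where "g n = normalize (\<gamma> n)" for n
  have keys: "supp (g n) \<subseteq> S" for n
    using normalize_Pos_unit_box[OF Pos(1)] by (auto simp: unit_box_def g_def)
  have g: "g \<longlonglongrightarrow> e" using Pos(2) by (simp add: g_def[abs_def])
  define i where "i n = inverse (height (\<gamma> n))" for n
  have i: "i \<longlonglongrightarrow> 0" unfolding i_def[abs_def] by (rule tendsto_inverse_0_at_top[OF Pos(3)])
  have i0: "0 < i n" for n using hg by (simp add: i_def)
  define v where "v n = (i n * i n) *\<^sub>R x - (2 * B x (g n)) *\<^sub>R g n" for n
  have gi: "\<gamma> n = (1 / i n) *\<^sub>R g n" for n
    using hg[of n] by (simp add: g_def normalize_def i_def)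
  have vr: "v n = (i n * i n) *\<^sub>R reflection B (\<gamma> n) x" for n
    using i0[of n] by (simp add: gi v_def reflection_def B_simps scaleR_diff_right)
  have "normalize (v n) = normalize (reflection B (\<gamma> n) x)" for n
    unfolding vr using i0[of n] by (intro normalize_scale) simp
  then have norm: "normalize (reflection B (\<gamma> n) x) = (1 / height (v n)) *\<^sub>R v n" for n
    by (subst \<open>\<And>n. normalize (v n) = normalize (reflection B (\<gamma> n) x)\<close>[symmetric]) (rule normalize_def)
  have "v \<longlonglongrightarrow> (0 * 0) *\<^sub>R x - (2 * B x e) *\<^sub>R e"
    unfolding v_def[abs_def]
    by (intro tendsto_intros i g tendsto_B[OF fin]) (use keys xD eD in auto)
  then have v: "v \<longlonglongrightarrow> (- 2 * B x e) *\<^sub>R e" by simp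
  have "supp (v n) \<subseteq> S" for n
    using keys_combination[OF xD(3) keys[of n], of "i n * i n" "- (2 * B x (g n))"] by (simp add: v_def)
  moreover have "supp ((- 2 * B x e) *\<^sub>R e) \<subseteq> S"
    using keys_combination[OF eD(3) eD(3), of "- 2 * B x e" 0] by simp
  ultimately have "(\<lambda>n. height (v n)) \<longlonglongrightarrow> height ((- 2 * B x e) *\<^sub>R e)"
    by (intro tendsto_height[OF fin v])
  then have hv: "(\<lambda>n. height (v n)) \<longlonglongrightarrow> - 2 * B x e" by (simp add: height_simps eD(4))
  have "(\<lambda>n. (1 / height (v n)) *\<^sub>R v n) \<longlonglongrightarrow> (1 / (- 2 * B x e)) *\<^sub>R ((- 2 * B x e) *\<^sub>R e)"
    using xe by (intro tendsto_intros hv v) auto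
  then show ?thesis unfolding norm using xe by simp
qed

end

end

section \<open>Indefinite systems of finite rank\<close>

context coordinate_rep
begin

context
  assumes fin: "finite S" and irr: "irreducible_coxeter S m"
    and indefinite: "\<exists>z. supp z \<subseteq> S \<and> B z z < 0"
begin

text \<open>A nonzero nonnegative vector in the radical would make the form positive semidefinite.\<close>

lemma limit_root_not_radical:
  assumes "e \<in> limit_roots"
  shows "e \<notin> radical"
proof
  assume e: "e \<in> radical"
  obtain z where z: "supp z \<subseteq> S" "B z z < 0" using indefinite by blast
  have "0 \<le> B z z"
    using nonneg_radical_imp_psd[OF irr fin e _ _ z(1)] limit_rootsD[OF fin assms] by blast
  then show False using z by simp
qed

text \<open>If only one limit root \<open>x\<close> failed to be orthogonal to the limit root \<open>e\<close>, then every root not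
  orthogonal to \<open>e\<close> would lie in the plane of \<open>e\<close> and \<open>x\<close>, since its reflection takes \<open>e\<close> to a
  multiple of \<open>x\<close>; by irreducibility all roots would, and the rank would be at most two.\<close>

lemma two_nonorthogonal_limit_roots:
  assumes e: "e \<in> limit_roots" and rank: "\<And>s t. \<not> S \<subseteq> {s, t}"
  shows "\<exists>x\<in>limit_roots. \<exists>y\<in>limit_roots. x \<noteq> y \<and> B x e \<noteq> 0 \<and> B y e \<noteq> 0"
proof (rule ccontr)
  assume none: "\<not> ?thesis"
  have unique: "x = y" if "x \<in> limit_roots" "y \<in> limit_roots" "B x e \<noteq> 0" "B y e \<noteq> 0" for x y
    using none that by blast
  note eD = limit_rootsD[OF fin e]
  obtain s0 where s0: "s0 \<in> S" "B e (simple s0) \<noteq> 0"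
    using limit_root_not_radical[OF e] eD(3) by (auto simp: radical_def)
  define b where "b = B e (simple s0)"
  have image: "normalize (reflection B \<delta> e) \<in> limit_roots" "B (normalize (reflection B \<delta> e)) e \<noteq> 0"
      "0 < height (reflection B \<delta> e)"
    if \<delta>: "\<delta> \<in> Pos" "B e \<delta> \<noteq> 0" for \<delta>
  proof -
    show "normalize (reflection B \<delta> e) \<in> limit_roots" "0 < height (reflection B \<delta> e)"
      using reflection_limit_root[OF fin e \<delta>(1)] by auto
    then show "B (normalize (reflection B \<delta> e)) e \<noteq> 0"
      using \<delta>(2) eD(5) symmetric[of \<delta> e] by (simp add: normalize_def reflection_def B_simps)
  qed
  define P where "P = {p *\<^sub>R e + q *\<^sub>R simple s0 | p q. True}"
  have P_add: "x + y \<in> P" if xy: "x \<in> P" "y \<in> P" for x y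
  proof -
    obtain p q where x: "x = p *\<^sub>R e + q *\<^sub>R simple s0" using xy(1) by (auto simp: P_def)
    obtain p' q' where y: "y = p' *\<^sub>R e + q' *\<^sub>R simple s0" using xy(2) by (auto simp: P_def)
    have "x + y = (p + p') *\<^sub>R e + (q + q') *\<^sub>R simple s0" by (simp add: x y algebra_simps)
    then show ?thesis unfolding P_def by blast
  qed
  have P_scale: "c *\<^sub>R x \<in> P" if xP: "x \<in> P" for x c
  proof -
    obtain p q where x: "x = p *\<^sub>R e + q *\<^sub>R simple s0" using xP by (auto simp: P_def)
    have "c *\<^sub>R x = (c * p) *\<^sub>R e + (c * q) *\<^sub>R simple s0" by (simp add: x algebra_simps)
    then show ?thesis unfolding P_def by blast
  qed
  have "1 *\<^sub>R e + 0 *\<^sub>R simple s0 \<in> P" "0 *\<^sub>R e + 1 *\<^sub>R simple s0 \<in> P" unfolding P_def by blast+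
  then have eP: "e \<in> P" and s0P: "simple s0 \<in> P" by simp_all
  have Pos_in_P: "\<delta> \<in> P" if \<delta>: "\<delta> \<in> Pos" "B e \<delta> \<noteq> 0" for \<delta>
  proof -
    let ?h = "height (reflection B \<delta> e)" and ?k = "height (reflection B (simple s0) e)"
    have s0': "simple s0 \<in> Pos" "B e (simple s0) \<noteq> 0" using s0 by (auto simp: simple_Pos)
    have eq: "normalize (reflection B \<delta> e) = normalize (reflection B (simple s0) e)"
      using unique image[OF \<delta>] image[OF s0'] by blast
    have "reflection B \<delta> e = ?h *\<^sub>R normalize (reflection B \<delta> e)"
      using image(3)[OF \<delta>] by (simp add: normalize_def)
    also have "\<dots> = (?h / ?k) *\<^sub>R reflection B (simple s0) e"
      unfolding eq by (simp add: normalize_def)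
    also have "\<dots> = (?h / ?k) *\<^sub>R (1 *\<^sub>R e + (- 2 * b) *\<^sub>R simple s0)"
      by (simp add: reflection_def b_def)
    also have "\<dots> \<in> P" by (intro P_scale P_add eP s0P)
    finally have "(1 / (2 * B e \<delta>)) *\<^sub>R (e + (- 1) *\<^sub>R reflection B \<delta> e) \<in> P"
      by (intro P_scale P_add eP)
    also have "(1 / (2 * B e \<delta>)) *\<^sub>R (e + (- 1) *\<^sub>R reflection B \<delta> e) = \<delta>"
      using \<delta>(2) by (simp add: reflection_def)
    finally show ?thesis .
  qed
  have root_in_P: "\<delta> \<in> P" if \<delta>: "\<delta> \<in> \<Phi>" "B e \<delta> \<noteq> 0" for \<delta>
    using root_Pos_cases[OF \<delta>(1)]
  proof
    assume "- \<delta> \<in> Pos"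
    moreover have "B e (- \<delta>) \<noteq> 0" using \<delta>(2) by (simp add: B_simps)
    ultimately have "- \<delta> \<in> P" by (rule Pos_in_P)
    then show ?thesis using P_scale[of "- \<delta>" "- 1"] by simp
  qed (rule Pos_in_P[OF _ \<delta>(2)])
  have orth: "B e (simple t) = 0 \<and> B (simple s0) (simple t) = 0" if t: "t \<in> S" "simple t \<notin> P" for t
  proof
    show et: "B e (simple t) = 0" using root_in_P[OF simple_root[OF t(1)]] t(2) by blast
    show "B (simple s0) (simple t) = 0"
    proof (rule ccontr)
      assume neq: "B (simple s0) (simple t) \<noteq> 0"
      define c where "c = - 2 * B (simple t) (simple s0)"
      define \<delta> where "\<delta> = simple t + c *\<^sub>R simple s0"
      have "\<delta> = reflection B (simple s0) (simple t)" by (simp add: \<delta>_def c_def reflection_def)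
      then have "\<delta> \<in> \<Phi>" using reflection_root simple_root s0 t by simp
      moreover have "B e \<delta> \<noteq> 0"
        using et s0(2) neq symmetric[of "simple t" "simple s0"] by (simp add: \<delta>_def c_def B_simps)
      ultimately have "\<delta> \<in> P" by (rule root_in_P)
      then have "\<delta> + (- c) *\<^sub>R simple s0 \<in> P" by (intro P_add P_scale s0P)
      then show False using t(2) by (simp add: \<delta>_def)
    qed
  qed
  have all_P: "simple t \<in> P" if t: "t \<in> S" for t
  proof (rule irreducible_closed_set[where P = "\<lambda>t. simple t \<in> P", OF irr s0(1) s0P _ t])
    fix p q assume pq: "p \<in> S" "q \<in> S" "simple p \<in> P" "3 \<le> m p q"
    show "simple q \<in> P"
    proof (rule ccontr)
      assume "simple q \<notin> P"
      note o = orth[OF pq(2) this]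
      obtain a c where "simple p = a *\<^sub>R e + c *\<^sub>R simple s0" using pq(3) by (auto simp: P_def)
      then have "B (simple p) (simple q) = 0" using o by (simp add: B_simps)
      then show False using bond_form_less_0[OF pq(1,2,4)] by simp
    qed
  qed
  obtain t where t: "t \<in> S" "t \<noteq> s0" using rank[of s0 s0] s0 by blast
  obtain u where u: "u \<in> S" "u \<noteq> s0" "u \<noteq> t" using rank[of s0 t] by blast
  obtain a c where "simple t = a *\<^sub>R e + c *\<^sub>R simple s0" using all_P[OF t(1)] by (auto simp: P_def)
  from arg_cong[OF this, of "\<lambda>x. coord x t"] arg_cong[OF this, of "\<lambda>x. coord x u"]
  have "a * coord e t = 1" "a * coord e u = 0" using t u by (simp_all add: lookup_add lookup_single)
  then have eu: "coord e u = 0" by auto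
  obtain a' c' where "simple u = a' *\<^sub>R e + c' *\<^sub>R simple s0" using all_P[OF u(1)] by (auto simp: P_def)
  from arg_cong[OF this, of "\<lambda>x. coord x u"]
  have "a' * coord e u = 1" using u by (simp add: lookup_add lookup_single)
  then show False using eu by simp
qed

text \<open>Take two limit roots \<open>x\<close> and \<open>y\<close> that are not orthogonal to \<open>e\<close>. Their images under the
  reflections of a root sequence of \<open>e\<close> tend to \<open>e\<close>. If \<open>e\<close> were isolated, both images would
  eventually equal \<open>e\<close> up to normalization, forcing \<open>x = y\<close>.\<close>

lemma limit_roots_perfect:
  assumes e: "e \<in> limit_roots" and rank: "\<And>s t. \<not> S \<subseteq> {s, t}"
  shows "e islimpt limit_roots"
proof (rule ccontr)
  assume "\<not> e islimpt limit_roots"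
  then obtain T where T: "open T" "e \<in> T" "\<And>y. y \<in> limit_roots \<Longrightarrow> y \<in> T \<Longrightarrow> y = e"
    unfolding islimpt_def by blast
  obtain \<gamma> where \<gamma>: "root_sequence \<gamma> e" using e by (auto simp: limit_roots_def)
  have Pos: "\<gamma> n \<in> Pos" for n using \<gamma> by (simp add: root_sequence_def)
  obtain x y where xy: "x \<in> limit_roots" "y \<in> limit_roots" "x \<noteq> y" "B x e \<noteq> 0" "B y e \<noteq> 0"
    using two_nonorthogonal_limit_roots[OF e rank] by blast
  have "\<forall>\<^sub>F n in sequentially. normalize (reflection B (\<gamma> n) x) \<in> T"
    by (rule topological_tendstoD[OF reflections_converge[OF fin \<gamma> xy(1,4)] T(1,2)])
  moreover have "\<forall>\<^sub>F n in sequentially. normalize (reflection B (\<gamma> n) y) \<in> T"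
    by (rule topological_tendstoD[OF reflections_converge[OF fin \<gamma> xy(2,5)] T(1,2)])
  ultimately have "\<forall>\<^sub>F n in sequentially. normalize (reflection B (\<gamma> n) x) \<in> T \<and>
      normalize (reflection B (\<gamma> n) y) \<in> T"
    by (rule eventually_conj)
  then obtain n where n: "normalize (reflection B (\<gamma> n) x) \<in> T" "normalize (reflection B (\<gamma> n) y) \<in> T"
    using eventually_happens'[OF sequentially_bot] by blast
  have pull: "z = height (reflection B (\<gamma> n) z) *\<^sub>R reflection B (\<gamma> n) e \<and>
      1 = height (reflection B (\<gamma> n) z) * height (reflection B (\<gamma> n) e)"
    if z: "z \<in> limit_roots" "normalize (reflection B (\<gamma> n) z) \<in> T" for z
  proof -
    let ?h = "height (reflection B (\<gamma> n) z)"
    note rl = reflection_limit_root[OF fin z(1) Pos[of n]]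
    have "normalize (reflection B (\<gamma> n) z) = e" using T(3) rl(2) z(2) by blast
    then have "?h *\<^sub>R e = reflection B (\<gamma> n) z" using rl(1) by (auto simp: normalize_def)
    then have "reflection B (\<gamma> n) (?h *\<^sub>R e) = z"
      using reflection_involution[OF Pos_norm[OF Pos[of n]]] by simp
    then have zz: "z = ?h *\<^sub>R reflection B (\<gamma> n) e" by (simp add: reflection_scale)
    have "height (?h *\<^sub>R reflection B (\<gamma> n) e) = 1"
      using limit_rootsD(4)[OF fin z(1)] arg_cong[OF zz, of height] by simp
    then have "1 = ?h * height (reflection B (\<gamma> n) e)" by (simp add: height_simps)
    with zz show ?thesis by (rule conjI)
  qed
  have "height (reflection B (\<gamma> n) e) \<noteq> 0" using pull[OF xy(1) n(1)] by auto
  then have "height (reflection B (\<gamma> n) x) = height (reflection B (\<gamma> n) y)"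
    using pull[OF xy(1) n(1)] pull[OF xy(2) n(2)] by (metis mult_right_cancel)
  then show False using pull[OF xy(1) n(1)] pull[OF xy(2) n(2)] xy(3) by metis
qed

lemma uncountable_limit_roots:
  assumes inf: "infinite Pos" and rank: "\<And>s t. \<not> S \<subseteq> {s, t}"
  shows "uncountable limit_roots"
proof -
  have sub: "limit_roots \<subseteq> unit_box" using limit_rootsD(1)[OF fin] by blast
  have "inj_on normalize Pos"
  proof (rule inj_onI)
    fix x y assume xy: "x \<in> Pos" "y \<in> Pos" "normalize x = normalize y"
    have "x = height x *\<^sub>R normalize x" using height_Pos[OF xy(1)] by (simp add: normalize_def)
    also have "\<dots> = (height x / height y) *\<^sub>R y" by (simp add: xy(3)) (simp add: normalize_def)
    finally show "x = y" by (rule Pos_proportional[OF xy(1,2)])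
  qed
  then have "infinite (normalize ` Pos)" using inf finite_imageD by blast
  moreover have "normalize ` Pos \<subseteq> unit_box" using normalize_Pos_unit_box by blast
  ultimately obtain e where "e islimpt normalize ` Pos"
    using Heine_Borel_imp_Bolzano_Weierstrass[OF compact_unit_box[OF fin]] by blast
  then have nonempty: "limit_roots \<noteq> {}" by (auto simp: limit_roots_eq_limpts[OF fin])
  have closed: "closed limit_roots" unfolding limit_roots_eq_limpts[OF fin] by (rule closed_limpts)
  have perfect: "{e. e islimpt limit_roots} = limit_roots"
    using closed limit_roots_perfect[OF _ rank] by (auto simp: closed_limpt)
  let ?X = "top_of_set (unit_box :: ('a \<Rightarrow>\<^sub>0 real) set)"
  have "?X derived_set_of limit_roots = limit_roots"
  proof -
    have "euclidean derived_set_of limit_roots = {e. e islimpt limit_roots}"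
      by (auto simp: derived_set_of_def islimpt_def)
    then show ?thesis
      using sub perfect by (simp add: derived_set_of_subtopology Int_absorb1)
  qed
  moreover have "locally_compact_space ?X \<and> Hausdorff_space ?X"
    using compact_unit_box[OF fin]
    by (auto simp: Hausdorff_space_subtopology compact_space_subtopology intro!: compact_imp_locally_compact_space)
  ultimately have "(UNIV :: real set) \<lesssim> limit_roots" using nonempty by (intro lepoll_perfect_set) auto
  then show ?thesis using uncountable_UNIV_real countable_lepoll by blast
qed

text \<open>The limit roots have finitely many coordinates, so one coordinate takes uncountably many values
  on them. These values are limits of slopes for the functional reading off that coordinate.\<close>

theorem indefinite_not_scattered:
  assumes inf: "infinite Pos" and rank: "\<And>s t. \<not> S \<subseteq> {s, t}"
  shows "\<exists>r. reflection_order S B simple r \<and> \<not> scattered_on Pos r"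
proof -
  have "\<exists>s\<in>S. uncountable ((\<lambda>e. coord e s) ` limit_roots)"
  proof (rule ccontr)
    assume none: "\<not> ?thesis"
    have cnt: "countable ((\<lambda>e. coord e s) ` limit_roots)" if "s \<in> S" for s using none that by blast
    have "limit_roots \<subseteq> vec ` PiE S (\<lambda>s. (\<lambda>e. coord e s) ` limit_roots)"
    proof
      fix e assume e: "e \<in> limit_roots"
      have "e = vec (restrict (coord e) S)"
        unfolding vec_def using poly_mapping_expand[OF fin limit_rootsD(3)[OF fin e]] by simp
      then show "e \<in> vec ` PiE S (\<lambda>s. (\<lambda>e. coord e s) ` limit_roots)"
        by (rule image_eqI[of _ vec]) (use e in auto)
    qed
    moreover have "countable (PiE S (\<lambda>s. (\<lambda>e. coord e s) ` limit_roots))"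
      using fin cnt by (rule countable_PiE)
    ultimately have "countable limit_roots" using countable_image countable_subset by metis
    then show False using uncountable_limit_roots[OF inf rank] by blast
  qed
  then obtain s where s: "s \<in> S" "uncountable ((\<lambda>e. coord e s) ` limit_roots)" by blast
  define X where "X = (\<lambda>x. coord x s / height x) ` Pos"
  have "(\<lambda>e. coord e s) ` limit_roots \<subseteq> closure X"
  proof
    fix c assume "c \<in> (\<lambda>e. coord e s) ` limit_roots"
    then obtain \<gamma> e where \<gamma>: "root_sequence \<gamma> e" and c: "c = coord e s" by (auto simp: limit_roots_def)
    have "(\<lambda>n. coord (normalize (\<gamma> n)) s) \<longlonglongrightarrow> c"
      unfolding c using \<gamma> by (intro tendsto_lookup) (simp add: root_sequence_def)
    moreover have "coord (normalize (\<gamma> n)) s \<in> X" for n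
      using \<gamma> unfolding X_def by (intro image_eqI[of _ _ "\<gamma> n"]) (auto simp: normalize_def root_sequence_def)
    ultimately show "c \<in> closure X" unfolding closure_sequential
      by (intro exI[of _ "\<lambda>n. coord (normalize (\<gamma> n)) s"]) blast
  qed
  then have "uncountable (closure X)" using s(2) countable_subset by blast
  then obtain Q u v where Q: "Q \<subseteq> X" "u \<in> Q" "v \<in> Q" "u < v"
    "\<And>u v. u \<in> Q \<Longrightarrow> v \<in> Q \<Longrightarrow> u < v \<Longrightarrow> \<exists>w\<in>Q. u < w \<and> w < v"
    by (rule uncountable_closure_contains_dense_order) (rule that; assumption)
  have "linear (\<lambda>x. coord x s)" by (intro linearI) (simp_all add: lookup_add)
  from dense_slopes_imp_not_scattered[OF this Q(1)[unfolded X_def] Q(2-5)] show ?thesis .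
qed

end

lemma rank_two_standard_form_nonneg:
  assumes "S \<subseteq> {s, t}" "S \<noteq> {}"
  shows "0 \<le> standard_form S m x x"
proof -
  have fin: "finite S" using assms(1) by (rule finite_subset) simp
  show ?thesis
  proof (cases "\<exists>p\<in>S. \<exists>q\<in>S. p \<noteq> q")
    case False
    obtain p where "p \<in> S" using assms(2) by blast
    then have "S = {p}" using False by blast
    then show ?thesis using coeff_diagonal[OF \<open>p \<in> S\<close>] by (simp add: standard_form_def)
  next
    case True
    then have S: "S = {s, t}" "s \<noteq> t" using assms(1) by auto
    define c where "c = standard_coeff m s t"
    have c: "- 1 \<le> c" "c \<le> 1" "standard_coeff m t s = c"
      using coeff_symmetric[of s t] S by (auto simp: c_def standard_coeff_def split: enat.splits)
    have "standard_form S m x x = x s * x s + x t * x t + 2 * c * (x s * x t)"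
      using S c(3) coeff_diagonal[of s] coeff_diagonal[of t]
      by (simp add: standard_form_def c_def[symmetric] algebra_simps)
    also have "\<dots> \<ge> 0"
    proof -
      have "0 \<le> (x s + c * x t)\<^sup>2 + (1 - c\<^sup>2) * (x t)\<^sup>2"
        using c(1,2) by (intro add_nonneg_nonneg mult_nonneg_nonneg) (auto simp: abs_square_le_1 abs_le_iff)
      then show ?thesis by (simp add: power2_eq_square algebra_simps)
    qed
    finally show ?thesis .
  qed
qed

theorem scattered_iff_affine:
  assumes inf: "infinite (carrier W)" and irr: "irreducible_coxeter S m"
  shows "(\<forall>r. reflection_order S B simple r \<longrightarrow> scattered_on Pos r) \<longleftrightarrow> affine_weyl S m"
proof
  assume scattered: "\<forall>r. reflection_order S B simple r \<longrightarrow> scattered_on Pos r"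
  have fin: "finite S" using infinite_rank_not_scattered scattered by blast
  have "0 \<le> standard_form S m x x" for x
  proof (rule ccontr)
    assume "\<not> 0 \<le> standard_form S m x x"
    then have neg: "standard_form S m x x < 0" by simp
    obtain z where z: "z \<in> cone" "B z z < 0"
      by (rule indefinite_vector[OF fin neg]) (rule that; assumption)
    have "S \<noteq> {}" using irr by (simp add: irreducible_coxeter_def)
    then have rank: "\<not> S \<subseteq> {s, t}" for s t using rank_two_standard_form_nonneg[of s t x] neg by auto
    have "\<exists>z. supp z \<subseteq> S \<and> B z z < 0" using z by (auto simp: cone_iff)
    moreover have "infinite Pos" using finite_Pos_imp_finite_group[OF fin] inf by blast
    ultimately have "\<exists>r. reflection_order S B simple r \<and> \<not> scattered_on Pos r"
      by (intro indefinite_not_scattered[OF fin irr _ _ rank])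
    then show False using scattered by blast
  qed
  moreover have "\<not> (\<forall>x. (\<exists>s\<in>S. x s \<noteq> 0) \<longrightarrow> 0 < standard_form S m x x)"
  proof
    assume pos: "\<forall>x. (\<exists>s\<in>S. x s \<noteq> 0) \<longrightarrow> 0 < standard_form S m x x"
    have "finite (carrier W)" by (rule positive_definite_imp_finite[OF fin]) (use pos in blast)
    then show False using inf by blast
  qed
  ultimately show "affine_weyl S m" using fin by (simp add: affine_weyl_def)
next
  assume "affine_weyl S m"
  then show "\<forall>r. reflection_order S B simple r \<longrightarrow> scattered_on Pos r"
    using affine_scattered[OF irr] by blast
qed

end

section \<open>Images of convex orders\<close>

text \<open>The defining property of reflection orders, for an arbitrary set of vectors.\<close>

definition convex_order :: "'v::real_vector set \<Rightarrow> 'v rel \<Rightarrow> bool" where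
  "convex_order P r \<longleftrightarrow> r \<subseteq> P \<times> P \<and> strict_linear_order_on P r \<and>
     (\<forall>x y (a::real) (b::real). (x, y) \<in> r \<longrightarrow> 0 < a \<longrightarrow> 0 < b \<longrightarrow> a *\<^sub>R x + b *\<^sub>R y \<in> P \<longrightarrow>
        (x, a *\<^sub>R x + b *\<^sub>R y) \<in> r \<and> (a *\<^sub>R x + b *\<^sub>R y, y) \<in> r)"

lemma reflection_order_iff: "reflection_order S B \<alpha> r \<longleftrightarrow> convex_order (positive_roots S B \<alpha>) r"
  by (simp add: reflection_order_def convex_order_def)

text \<open>The image of a convex order is convex if no new relation \<open>z = a x + b y\<close> appears in the image.\<close>

lemma all_scattered_if_image:
  fixes f :: "'u::real_vector \<Rightarrow> 'v::real_vector"
  assumes inj: "inj_on f P"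
    and comb: "\<And>x y z a b. x \<in> P \<Longrightarrow> y \<in> P \<Longrightarrow> z \<in> P \<Longrightarrow> x \<noteq> y \<Longrightarrow> 0 < a \<Longrightarrow> 0 < b \<Longrightarrow>
      f z = a *\<^sub>R f x + b *\<^sub>R f y \<Longrightarrow> z = a *\<^sub>R x + b *\<^sub>R y"
    and image: "\<And>r. convex_order (f ` P) r \<Longrightarrow> scattered_on (f ` P) r"
    and r: "convex_order P r"
  shows "scattered_on P r"
proof -
  let ?R = "map_prod f f ` r"
  have sub: "r \<subseteq> P \<times> P" and tr: "trans r" "irrefl r" and tot: "total_on P r"
    and conv: "\<And>x y a b. (x, y) \<in> r \<Longrightarrow> 0 < a \<Longrightarrow> 0 < b \<Longrightarrow> a *\<^sub>R x + b *\<^sub>R y \<in> P \<Longrightarrow>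
      (x, a *\<^sub>R x + b *\<^sub>R y) \<in> r \<and> (a *\<^sub>R x + b *\<^sub>R y, y) \<in> r"
    using r by (auto simp: convex_order_def strict_linear_order_on_def)
  have iff: "(f x, f y) \<in> ?R \<longleftrightarrow> (x, y) \<in> r" if xy: "x \<in> P" "y \<in> P" for x y
  proof
    assume "(f x, f y) \<in> ?R"
    then obtain x' y' where x'y': "(x', y') \<in> r" "f x = f x'" "f y = f y'" by auto
    have "x' \<in> P" "y' \<in> P" using x'y'(1) sub by auto
    then have "x = x'" "y = y'" using x'y' xy inj by (auto dest: inj_onD)
    then show "(x, y) \<in> r" using x'y' by simp
  qed (auto intro: image_eqI[of _ _ "(x, y)"])
  have subR: "?R \<subseteq> f ` P \<times> f ` P" using sub by auto
  have "convex_order (f ` P) ?R" unfolding convex_order_def strict_linear_order_on_def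
  proof (intro conjI allI impI subR)
    show "trans ?R"
    proof (rule transI)
      fix p q s assume pqs: "(p, q) \<in> ?R" "(q, s) \<in> ?R"
      then obtain x y z where xyz: "x \<in> P" "y \<in> P" "z \<in> P" "p = f x" "q = f y" "s = f z"
        using subR by blast
      then have "(x, z) \<in> r" using pqs iff tr(1) by (auto dest: transD)
      then show "(p, s) \<in> ?R" using xyz iff by simp
    qed
    show "irrefl ?R" using sub tr(2) inj by (auto simp: irrefl_def dest: inj_onD)
    show "total_on (f ` P) ?R"
    proof (rule total_onI)
      fix p q assume "p \<in> f ` P" "q \<in> f ` P" "p \<noteq> q"
      then obtain x y where xy: "x \<in> P" "y \<in> P" "p = f x" "q = f y" "x \<noteq> y" by blast
      then show "(p, q) \<in> ?R \<or> (q, p) \<in> ?R" using tot iff by (simp add: total_on_def)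
    qed
    fix p q a b assume pq: "(p, q) \<in> ?R" and ab: "(0::real) < a" "(0::real) < b"
      and P: "a *\<^sub>R p + b *\<^sub>R q \<in> f ` P"
    obtain x y where xy: "(x, y) \<in> r" "p = f x" "q = f y" using pq by auto
    have xyP: "x \<in> P" "y \<in> P" "x \<noteq> y" using xy(1) sub tr(2) by (auto simp: irrefl_def)
    obtain z where z: "z \<in> P" "a *\<^sub>R p + b *\<^sub>R q = f z" using P by blast
    have "z = a *\<^sub>R x + b *\<^sub>R y" using comb[OF xyP(1,2) z(1) xyP(3) ab] z xy by simp
    then have "(x, z) \<in> r \<and> (z, y) \<in> r" using conv[OF xy(1) ab] z(1) by simp
    then show "(p, a *\<^sub>R p + b *\<^sub>R q) \<in> ?R" "(a *\<^sub>R p + b *\<^sub>R q, q) \<in> ?R"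
      unfolding z(2) using xy iff xyP z(1) by auto
  qed
  from image[OF this] show ?thesis unfolding scattered_on_def
  proof (rule contrapos_nn)
    assume "\<exists>D\<subseteq>P. dense_order_on D r"
    then obtain D where D: "D \<subseteq> P" "dense_order_on D r" by blast
    have iffD: "(f x, f y) \<in> ?R \<longleftrightarrow> (x, y) \<in> r" if "x \<in> D" "y \<in> D" for x y
      by (rule iff) (use that D(1) in auto)
    have "dense_order_on (f ` D) ?R" unfolding dense_order_on_def
    proof (intro conjI ballI impI)
      obtain x y where "x \<in> D" "y \<in> D" "x \<noteq> y" using D(2) unfolding dense_order_on_def by blast
      moreover from this have "f x \<noteq> f y" using inj D(1) by (auto dest: inj_onD)
      ultimately show "\<exists>p\<in>f ` D. \<exists>q\<in>f ` D. p \<noteq> q"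
        by (intro bexI[of _ "f x"] bexI[of _ "f y"]) auto
    next
      fix p q assume "p \<in> f ` D" "q \<in> f ` D" and pq: "(p, q) \<in> ?R"
      then obtain x y where xy: "x \<in> D" "y \<in> D" "p = f x" "q = f y" by auto
      then have "(x, y) \<in> r" using pq iffD by simp
      then obtain z where z: "z \<in> D" "(x, z) \<in> r" "(z, y) \<in> r"
        using D(2) xy unfolding dense_order_on_def by blast
      then show "\<exists>s\<in>f ` D. (p, s) \<in> ?R \<and> (s, q) \<in> ?R"
        using xy iffD by (intro bexI[of _ "f z"]) auto
    qed
    then show "\<exists>D\<subseteq>f ` P. dense_order_on D ?R" using D(1) by blast
  qed
qed

section \<open>Lifting to linearly independent simple roots\<close>

context coxeter_rep
begin

definition proj :: "('a \<Rightarrow>\<^sub>0 real) \<Rightarrow> 'v" where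
  "proj x = (\<Sum>s\<in>supp x. coord x s *\<^sub>R \<alpha> s)"

definition form :: "('a \<Rightarrow>\<^sub>0 real) \<Rightarrow> ('a \<Rightarrow>\<^sub>0 real) \<Rightarrow> real" where
  "form x y = B (proj x) (proj y)"

lemma proj_eq:
  "finite F \<Longrightarrow> supp x \<subseteq> F \<Longrightarrow> proj x = (\<Sum>s\<in>F. coord x s *\<^sub>R \<alpha> s)"
  unfolding proj_def by (intro sum.mono_neutral_left) (auto simp: in_keys_iff)

lemma linear_proj: "linear proj"
proof (rule linearI)
  fix x y :: "'a \<Rightarrow>\<^sub>0 real" and r :: real
  let ?F = "supp x \<union> supp y"
  have "supp (x + y) \<subseteq> ?F" by (rule Poly_Mapping.keys_add)
  then show "proj (x + y) = proj x + proj y"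
    by (simp add: proj_eq[of ?F] lookup_add scaleR_add_left sum.distrib)
  have "supp (r *\<^sub>R x) \<subseteq> supp x" by (auto simp: in_keys_iff)
  then show "proj (r *\<^sub>R x) = r *\<^sub>R proj x"
    by (simp add: proj_eq[of "supp x"] scaleR_sum_right)
qed

lemmas proj_simps = linear_add[OF linear_proj] linear_diff[OF linear_proj] linear_cmul[OF linear_proj]
  linear_neg[OF linear_proj] linear_0[OF linear_proj]

lemma proj_simple: "proj (simple s) = \<alpha> s"
  by (simp add: proj_def)

lemma bilinear_form: "bilinear form"
  unfolding bilinear_def form_def by (intro allI conjI linearI) (simp_all add: proj_simps B_simps)

lemma coordinate_rep_form: "coordinate_rep W S m form"
proof -
  have "root_basis S m form simple"
  proof
    show "bilinear form" by (rule bilinear_form)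
    show "form x y = form y x" for x y by (simp add: form_def symmetric)
    show "inj_on simple S" by (rule inj_onI) (metis lookup_single_eq lookup_single_not_eq zero_neq_one)
    show "form (simple s) (simple t) = - cos (pi / real k)"
      if "s \<in> S" "t \<in> S" "m s t = enat k" for s t k
      using finite_bond[OF that] by (simp add: form_def proj_simple)
    show "form (simple s) (simple t) \<le> - 1" if "s \<in> S" "t \<in> S" "m s t = \<infinity>" for s t
      using infinite_bond[OF that] by (simp add: form_def proj_simple)
    fix F and k :: "'a \<Rightarrow> real"
    assume F: "finite F" "(\<Sum>s\<in>F. k s *\<^sub>R simple s) = 0"
    show "\<forall>s\<in>F. k s = 0"
    proof
      fix t assume "t \<in> F"
      have "coord (\<Sum>s\<in>F. k s *\<^sub>R simple s) t = (\<Sum>s\<in>F. if s = t then k t else 0)"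
        unfolding lookup_sum_left by (intro sum.cong) (auto simp: lookup_single when_def)
      then show "k t = 0" using F \<open>t \<in> F\<close> by simp
    qed
  qed
  then show ?thesis
    by (simp add: coordinate_rep_def coxeter_rep_def coxeter_system_axioms)
qed

interpretation C: coordinate_rep W S m form
  by (rule coordinate_rep_form)

lemma proj_reflection: "proj (reflection form a x) = reflection B (proj a) (proj x)"
  by (simp add: reflection_def proj_simps form_def)

lemma proj_act: "proj (C.act w x) = act w (proj x)"
  by (induction w) (simp_all add: C.act_Cons act_Cons proj_reflection proj_simple)

lemma proj_cone: "x \<in> C.cone \<Longrightarrow> proj x \<in> cone"
  unfolding proj_def C.cone_iff by (intro coneI) auto

lemma proj_cone_eq_0:
  assumes "x \<in> C.cone" "proj x = 0"
  shows "x = 0"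
proof (rule poly_mapping_eqI)
  fix s
  have "\<forall>s\<in>supp x. coord x s = 0"
    using assms by (intro positively_independent) (auto simp: C.cone_iff proj_def)
  then show "coord x s = coord 0 s"
    by (cases "s \<in> supp x") (auto simp: in_keys_iff)
qed

lemma proj_Pos: "x \<in> C.Pos \<Longrightarrow> proj x \<in> Pos"
proof -
  assume x: "x \<in> C.Pos"
  obtain w t where "w \<in> lists S" "t \<in> S" "x = C.act w (simple t)"
    using C.rootE[OF C.Pos_root[OF x]] .
  then have "proj x \<in> \<Phi>" by (simp add: proj_act proj_simple act_root simple_root)
  then show ?thesis using proj_cone[OF C.Pos_cone[OF x]] by (simp add: Pos_eq)
qed

lemma Pos_eq_image: "Pos = proj ` C.Pos"
proof
  show "proj ` C.Pos \<subseteq> Pos" using proj_Pos by blast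
  show "Pos \<subseteq> proj ` C.Pos"
  proof
    fix y assume y: "y \<in> Pos"
    obtain w t where w: "w \<in> lists S" "t \<in> S" "y = act w (\<alpha> t)" using rootE[OF Pos_root[OF y]] .
    define x where "x = C.act w (simple t)"
    have yx: "y = proj x" by (simp add: x_def proj_act proj_simple w)
    have "x \<in> C.\<Phi>" unfolding x_def by (intro C.act_root C.simple_root w)
    then have "x \<in> C.Pos \<or> - x \<in> C.Pos" by (rule C.root_Pos_cases)
    moreover have "- x \<notin> C.Pos"
    proof
      assume "- x \<in> C.Pos"
      then have "- y \<in> cone" using proj_cone[OF C.Pos_cone] yx by (force simp: proj_simps)
      then show False using Pos_not_minus[OF y] by blast
    qed
    ultimately show "y \<in> proj ` C.Pos" using yx by blast
  qed
qed

text \<open>A word that fixes all simple roots in \<open>V\<close> keeps them positive in coordinates, hence is trivial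
  in \<open>W\<close>. So relations between reflections lift from \<open>V\<close> to coordinates.\<close>

lemma act_lift:
  assumes u: "u \<in> lists S" and v: "v \<in> lists S"
    and eq: "\<And>s. s \<in> S \<Longrightarrow> act u (\<alpha> s) = act v (\<alpha> s)"
  shows "C.act u = C.act v"
proof -
  let ?w = "rev v @ u"
  have w: "?w \<in> lists S" using u v by simp
  have "C.act ?w (simple s) \<in> C.cone" if s: "s \<in> S" for s
  proof -
    have "proj (C.act ?w (simple s)) = act (rev v) (act u (\<alpha> s))"
      by (simp add: proj_act proj_simple act_append)
    also have "\<dots> = \<alpha> s" by (simp add: eq[OF s] act_rev' v)
    finally have p: "proj (C.act ?w (simple s)) = \<alpha> s" .
    show ?thesis
      using C.act_simple_sign[OF w s]
    proof
      assume "- C.act ?w (simple s) \<in> C.cone"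
      from proj_cone[OF this] have "- \<alpha> s \<in> cone" using p by (simp add: proj_simps)
      then show ?thesis using Pos_not_minus[OF simple_Pos[OF s]] by blast
    qed
  qed
  then have "word_prod W ?w = word_prod W []"
    using C.act_preserves_cone_imp_trivial[OF w] by (simp add: word_prod_Nil)
  then have "C.act ?w = C.act []" using w by (intro C.act_cong) auto
  then have "C.act v (C.act (rev v) (C.act u x)) = C.act v x" for x
    by (simp add: fun_eq_iff C.act_append)
  then show ?thesis using C.act_rev[OF v] by (simp add: fun_eq_iff)
qed

text \<open>If two roots have the same image, so do their reflections, which then agree in coordinates.\<close>

lemma inj_proj: "inj_on proj C.Pos"
proof (rule inj_onI)
  fix x y assume xy: "x \<in> C.Pos" "y \<in> C.Pos" "proj x = proj y"
  obtain u where u: "u \<in> lists S" "C.act u = reflection form x"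
    using C.reflection_word[OF C.Pos_root[OF xy(1)]] .
  obtain v where v: "v \<in> lists S" "C.act v = reflection form y"
    using C.reflection_word[OF C.Pos_root[OF xy(2)]] .
  have "act u (\<alpha> s) = act v (\<alpha> s)" for s
    using proj_act[of u "simple s"] proj_act[of v "simple s"]
    by (simp add: u v proj_reflection xy(3) proj_simple)
  then have "C.act u = C.act v" using u v by (intro act_lift)
  then have "reflection form y x = reflection form x x" using u v by simp
  also have "\<dots> = - x" using xy by (simp add: C.reflection_self C.Pos_norm)
  finally have "2 *\<^sub>R x = (2 * form x y) *\<^sub>R y"
    by (simp add: reflection_def scaleR_2 algebra_simps)
  then have "(1 / 2) *\<^sub>R (2 *\<^sub>R x) = (1 / 2) *\<^sub>R ((2 * form x y) *\<^sub>R y)" by (simp only:)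
  then have "x = form x y *\<^sub>R y" by simp
  then show "x = y" by (rule C.Pos_proportional[OF xy(1,2)])
qed

text \<open>If the form is nondegenerate on the plane of \<open>x\<close> and \<open>y\<close>, then \<open>s\<^sub>x s\<^sub>y s\<^sub>z\<close> reverses the orientation of
  the plane, so it is an involution there and equals its inverse \<open>s\<^sub>z s\<^sub>y s\<^sub>x\<close>. Comparing coefficients shows
  that the identity is a polynomial consequence of \<open>B z z = 1\<close>, so that it holds on all planes.\<close>

lemma coplanar_reflections_commute:
  assumes "B x x = 1" "B y y = 1" "z = a *\<^sub>R x + b *\<^sub>R y" "B z z = 1"
  shows "reflection B x (reflection B y (reflection B z v)) = reflection B z (reflection B y (reflection B x v))"
proof -
  define c p q where "c = B x y" and "p = B v x" and "q = B v y"
  define r where "r = a * p + b * q"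
  have yx: "B y x = c" by (simp add: c_def symmetric)
  have n: "a * a + b * b + 2 * a * b * c = 1"
    using assms by (simp add: B_simps yx flip: c_def) (simp add: algebra_simps)
  have vz: "B v z = r" and zx: "B z x = a + b * c" and zy: "B z y = a * c + b"
    by (simp_all add: assms B_simps yx r_def flip: c_def p_def q_def)
  have xz: "B x z = a + b * c" and yz: "B y z = a * c + b" using zx zy by (simp_all add: symmetric)
  define k1 where "k1 = q - 2 * r * (a * c + b)"
  define k2 where "k2 = p - 2 * r * (a + b * c) - 2 * k1 * c"
  have L: "reflection B x (reflection B y (reflection B z v))
      = v - (2 * r) *\<^sub>R z - (2 * k1) *\<^sub>R y - (2 * k2) *\<^sub>R x"
    by (simp add: reflection_def B_simps vz zy zx yx k1_def k2_def flip: c_def p_def q_def)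
  define l1 where "l1 = q - 2 * p * c"
  define l2 where "l2 = r - 2 * p * (a + b * c) - 2 * l1 * (a * c + b)"
  have R: "reflection B z (reflection B y (reflection B x v))
      = v - (2 * p) *\<^sub>R x - (2 * l1) *\<^sub>R y - (2 * l2) *\<^sub>R z"
    by (simp add: reflection_def B_simps vz xz yz l1_def l2_def flip: c_def p_def q_def)
  have "r * a + k2 = p + l2 * a" "r * b + k1 = l1 + l2 * b"
    using n unfolding k1_def k2_def l1_def l2_def r_def by algebra+
  then have "(r * a + k2) *\<^sub>R x + (r * b + k1) *\<^sub>R y = (p + l2 * a) *\<^sub>R x + (l1 + l2 * b) *\<^sub>R y" by simp
  then have "2 *\<^sub>R ((r * a + k2) *\<^sub>R x + (r * b + k1) *\<^sub>R y) = 2 *\<^sub>R ((p + l2 * a) *\<^sub>R x + (l1 + l2 * b) *\<^sub>R y)"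
    by simp
  then show ?thesis unfolding L R by (simp add: assms(3) algebra_simps)
qed

text \<open>Linear relations between three positive roots of \<open>V\<close> lift to coordinates. If the lifts \<open>x\<close>, \<open>y\<close>,
  \<open>z\<close> were independent, comparing coefficients in \<open>s\<^sub>x s\<^sub>y s\<^sub>z = s\<^sub>z s\<^sub>y s\<^sub>x\<close> would put \<open>z - x\<close> or \<open>z + x\<close> into
  the radical, and up to sign this vector would be nonnegative. It would then span the radical, which
  also contains the nonzero vector \<open>z - a x - b y\<close>. So a nonnegative nonzero vector would map to
  zero in \<open>V\<close>, against positive independence.\<close>

lemma relation_lifts:
  assumes irr: "irreducible_coxeter S m"
    and pos: "x \<in> C.Pos" "y \<in> C.Pos" "z \<in> C.Pos"
    and rel: "proj z = a *\<^sub>R proj x + b *\<^sub>R proj y" and ab: "0 < a" "0 < b"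
  shows "\<exists>p q r. (p \<noteq> 0 \<or> q \<noteq> 0 \<or> r \<noteq> 0) \<and> p *\<^sub>R x + q *\<^sub>R y + r *\<^sub>R z = 0"
proof (rule ccontr)
  assume "\<not> ?thesis"
  then have indep: "p = 0 \<and> q = 0 \<and> r = 0" if "p *\<^sub>R x + q *\<^sub>R y + r *\<^sub>R z = 0" for p q r
    using that by blast
  have norm: "form x x = 1" "form y y = 1" "form z z = 1" using pos C.Pos_norm by auto
  obtain ux where ux: "ux \<in> lists S" "C.act ux = reflection form x"
    using C.reflection_word[OF C.Pos_root[OF pos(1)]] .
  obtain uy where uy: "uy \<in> lists S" "C.act uy = reflection form y"
    using C.reflection_word[OF C.Pos_root[OF pos(2)]] .
  obtain uz where uz: "uz \<in> lists S" "C.act uz = reflection form z"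
    using C.reflection_word[OF C.Pos_root[OF pos(3)]] .
  have "act (ux @ uy @ uz) (\<alpha> s) = act (uz @ uy @ ux) (\<alpha> s)" for s
  proof -
    have "act (ux @ uy @ uz) (\<alpha> s) = proj (C.act (ux @ uy @ uz) (simple s))"
      by (simp add: proj_act proj_simple)
    also have "\<dots> = reflection B (proj x) (reflection B (proj y) (reflection B (proj z) (\<alpha> s)))"
      by (simp add: C.act_append ux uy uz proj_reflection proj_simple)
    also have "\<dots> = reflection B (proj z) (reflection B (proj y) (reflection B (proj x) (\<alpha> s)))"
      using norm rel by (intro coplanar_reflections_commute) (simp_all add: form_def)
    also have "\<dots> = proj (C.act (uz @ uy @ ux) (simple s))"
      by (simp add: C.act_append ux uy uz proj_reflection proj_simple)
    also have "\<dots> = act (uz @ uy @ ux) (\<alpha> s)" by (simp add: proj_act proj_simple)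
    finally show ?thesis .
  qed
  then have "C.act (ux @ uy @ uz) = C.act (uz @ uy @ ux)" using ux uy uz by (intro act_lift) auto
  then have comm: "reflection form x (reflection form y (reflection form z v))
      = reflection form z (reflection form y (reflection form x v))" for v
    by (simp add: fun_eq_iff C.act_append ux uy uz)
  define c e f where "c = form x y" and "e = form z x" and "f = form z y"
  have sym: "form y x = c" "form x z = e" "form y z = f" by (simp_all add: c_def e_def f_def C.symmetric)
  have coeffs: "form v z * f = form v x * c" "form v x * e + (form v y - 2 * form v x * c) * f = 0" for v
  proof -
    define p q r where "p = form v x" and "q = form v y" and "r = form v z"
    have L: "reflection form x (reflection form y (reflection form z v))
      = v - (2 * r) *\<^sub>R z - (2 * (q - 2 * r * f)) *\<^sub>R y - (2 * (p - 2 * r * e - 2 * (q - 2 * r * f) * c)) *\<^sub>R x"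
      by (simp add: reflection_def C.B_simps sym flip: p_def q_def r_def c_def e_def f_def)
    have R: "reflection form z (reflection form y (reflection form x v))
      = v - (2 * p) *\<^sub>R x - (2 * (q - 2 * p * c)) *\<^sub>R y - (2 * (r - 2 * p * e - 2 * (q - 2 * p * c) * f)) *\<^sub>R z"
      by (simp add: reflection_def C.B_simps sym flip: p_def q_def r_def c_def e_def f_def)
    have "(2 * p - 2 * (p - 2 * r * e - 2 * (q - 2 * r * f) * c)) *\<^sub>R x
        + (2 * (q - 2 * p * c) - 2 * (q - 2 * r * f)) *\<^sub>R y
        + (2 * (r - 2 * p * e - 2 * (q - 2 * p * c) * f) - 2 * r) *\<^sub>R z
        = reflection form x (reflection form y (reflection form z v))
        - reflection form z (reflection form y (reflection form x v))"
      unfolding L R by (simp only: scaleR_diff_left) (simp add: algebra_simps)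
    also have "\<dots> = 0" using comm by simp
    finally have "2 * (q - 2 * p * c) - 2 * (q - 2 * r * f) = 0"
      "2 * (r - 2 * p * e - 2 * (q - 2 * p * c) * f) - 2 * r = 0"
      using indep by blast+
    then show "form v z * f = form v x * c" "form v x * e + (form v y - 2 * form v x * c) * f = 0"
      by (simp_all flip: p_def q_def r_def add: algebra_simps)
  qed
  have e: "e = a + b * c"
    by (simp add: e_def c_def form_def rel B_simps symmetric[of "proj y"])
      (use norm in \<open>simp add: form_def\<close>)
  have fz: "f = e * c" using coeffs(1)[of z] norm by (simp flip: e_def)
  have fx: "e * f = c" using coeffs(1)[of x] norm sym by simp
  have c0: "c \<noteq> 0"
  proof
    assume "c = 0"
    then have "e = 0" using coeffs(2)[of x] norm sym fz by simp
    then show False using e \<open>c = 0\<close> ab by simp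
  qed
  have "e * e * c = 1 * c" using fz fx by (simp add: mult.assoc)
  then have "e * e = 1" using mult_right_cancel[OF c0, of "e * e" 1] by simp
  then have e1: "e = 1 \<or> e = - 1" by (simp add: square_eq_1_iff)
  have proportional: "form v z = e * form v x" for v
  proof -
    have "(form v z * e) * c = form v x * c" using coeffs(1)[of v] by (simp add: fz mult_ac)
    then have "form v z * e = form v x" using mult_right_cancel[OF c0, of "form v z * e" "form v x"] by simp
    then have "form v z * (e * e) = e * form v x" by (simp add: mult_ac)
    then show ?thesis using \<open>e * e = 1\<close> by simp
  qed
  define d where "d = z - e *\<^sub>R x"
  have keys: "supp x \<subseteq> S" "supp y \<subseteq> S" "supp z \<subseteq> S"
    using pos C.root_keys C.Pos_root by auto
  have form_d: "form v d = 0" for v using proportional[of v] by (simp add: d_def C.B_simps)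
  have d: "d \<in> C.radical"
    using C.keys_combination[OF keys(3,1), of 1 "- e"] form_d C.symmetric
    by (simp add: C.radical_def d_def)
  have d0: "d \<noteq> 0"
  proof
    assume "d = 0"
    then have "(- e) *\<^sub>R x + 0 *\<^sub>R y + 1 *\<^sub>R z = 0" by (simp add: d_def)
    from indep[OF this] show False by simp
  qed
  have "d \<in> C.cone \<or> - d \<in> C.cone"
    using e1
  proof
    assume "e = - 1"
    then show ?thesis using C.cone_add[OF C.Pos_cone[OF pos(3)] C.Pos_cone[OF pos(1)]] by (simp add: d_def)
  next
    assume e: "e = 1"
    \<comment> \<open>\<open>s\<^sub>z s\<^sub>x\<close> acts as a translation by multiples of \<open>d\<close>, so all \<open>x + 2 n d\<close> are roots.\<close>
    have root: "x + (2 * real n) *\<^sub>R d \<in> C.\<Phi>" for n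
    proof (induction n)
      case 0
      then show ?case using C.Pos_root[OF pos(1)] by simp
    next
      case (Suc n)
      define v where "v = x + (2 * real n) *\<^sub>R d"
      have vx: "form v x = 1" using norm form_d[of x] C.symmetric[of d x] by (simp add: v_def C.B_simps)
      have vz: "form v z = 1" using proportional[of v] vx e by simp
      have "reflection form z (reflection form x v) \<in> C.\<Phi>"
        using Suc unfolding v_def[symmetric] by (intro C.reflection_root C.Pos_root[OF pos(1)] C.Pos_root[OF pos(3)])
      also have "reflection form z (reflection form x v) = v - 2 *\<^sub>R x + 2 *\<^sub>R z"
        using vx vz sym(2) e by (simp add: reflection_def C.B_simps)
      also have "\<dots> = x + (2 * real (Suc n)) *\<^sub>R d" using e by (simp add: v_def d_def algebra_simps)
      finally show ?case .
    qed
    show ?thesis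
    proof (cases "\<exists>s. 0 < coord d s")
      case True
      then obtain s where s: "0 < coord d s" by blast
      have nonneg: "0 \<le> coord x t + 2 * real (Suc n) * coord d t" for n t
      proof -
        have "0 < coord (x + (2 * real (Suc n)) *\<^sub>R d) s"
          using s C.Pos_coord[OF pos(1), of s] by (simp add: lookup_add add_nonneg_pos del: of_nat_Suc)
        then have "x + (2 * real (Suc n)) *\<^sub>R d \<in> C.Pos" by (rule C.root_PosI[OF root])
        from C.Pos_coord[OF this, of t] show ?thesis by (simp add: lookup_add del: of_nat_Suc)
      qed
      have "0 \<le> coord d t" for t
      proof (rule ccontr)
        assume "\<not> 0 \<le> coord d t"
        then have neg: "0 < - coord d t" by simp
        obtain n where "coord x t < real n * (- coord d t)" using ex_less_of_nat_mult[OF neg] by blast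
        also have "\<dots> \<le> (2 * real (Suc n)) * (- coord d t)" using neg by (intro mult_right_mono) auto
        finally show False using nonneg[of t n] by (simp del: of_nat_Suc)
      qed
      then show ?thesis using d by (simp add: C.cone_iff C.radical_def)
    next
      case False
      then have "0 \<le> coord (- d) t" for t by (simp add: not_less)
      then show ?thesis using d by (simp add: C.cone_iff C.radical_def)
    qed
  qed
  moreover have "- d \<in> C.radical" "- d \<noteq> 0" using C.radical_scale[OF d, of "- 1"] d0 by simp_all
  ultimately obtain \<delta> where \<delta>: "\<delta> \<in> C.radical" "\<delta> \<in> C.cone" "\<delta> \<noteq> 0" using d d0 by blast
  define \<kappa> where "\<kappa> = (- a) *\<^sub>R x + (- b) *\<^sub>R y + 1 *\<^sub>R z"
  have proj_\<kappa>: "proj \<kappa> = 0" by (simp add: \<kappa>_def proj_simps rel)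
  have "supp (1 *\<^sub>R ((- a) *\<^sub>R x + (- b) *\<^sub>R y) + 1 *\<^sub>R z) \<subseteq> S"
    by (intro C.keys_combination keys)
  then have "supp \<kappa> \<subseteq> S" by (simp add: \<kappa>_def)
  then have \<kappa>: "\<kappa> \<in> C.radical" using proj_\<kappa> by (simp add: C.radical_def form_def B_simps)
  obtain k where k: "\<kappa> = k *\<^sub>R \<delta>" by (rule C.nonneg_radical_spans[OF irr \<delta> \<kappa>])
  have "\<kappa> \<noteq> 0" using indep[of "- a" "- b" 1] by (auto simp: \<kappa>_def)
  then have "k \<noteq> 0" using k by auto
  then have "proj \<delta> = 0" using proj_\<kappa> k by (simp add: proj_simps)
  then show False using proj_cone_eq_0 \<delta> by blast
qed

text \<open>A positive root of \<open>V\<close> that is a combination of two others is the same combination in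
  coordinates: the relation lifts up to coefficients, and these are unique as distinct positive
  roots of \<open>V\<close> are linearly independent. The converse is clear.\<close>

theorem all_scattered_iff:
  assumes irr: "irreducible_coxeter S m"
  shows "(\<forall>r. reflection_order S B \<alpha> r \<longrightarrow> scattered_on Pos r) \<longleftrightarrow>
    (\<forall>r. reflection_order S form simple r \<longrightarrow> scattered_on C.Pos r)"
proof (intro iffI allI impI)
  fix r assume all: "\<forall>r. reflection_order S B \<alpha> r \<longrightarrow> scattered_on Pos r"
    and r: "reflection_order S form simple r"
  show "scattered_on C.Pos r"
  proof (rule all_scattered_if_image[OF inj_proj _ _ r[unfolded reflection_order_iff]])
    show "scattered_on (proj ` C.Pos) r" if "convex_order (proj ` C.Pos) r" for r
      using all that by (simp add: reflection_order_iff Pos_eq_image)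
    fix x y z a b assume xyz: "x \<in> C.Pos" "y \<in> C.Pos" "z \<in> C.Pos" "x \<noteq> y"
      and ab: "0 < a" "0 < b" and rel: "proj z = a *\<^sub>R proj x + b *\<^sub>R proj y"
    obtain k l n where kln: "k \<noteq> 0 \<or> l \<noteq> 0 \<or> n \<noteq> 0" "k *\<^sub>R x + l *\<^sub>R y + n *\<^sub>R z = 0"
      using relation_lifts[OF irr xyz(1-3) rel ab] by blast
    have "n \<noteq> 0" using kln C.Pos_independent[OF xyz(1,2,4), of k l] by auto
    define k' l' where "k' = - k / n" and "l' = - l / n"
    have "n *\<^sub>R z = (- k) *\<^sub>R x + (- l) *\<^sub>R y" using kln(2) by (simp add: add_eq_0_iff algebra_simps)
    then have "(1 / n) *\<^sub>R (n *\<^sub>R z) = (1 / n) *\<^sub>R ((- k) *\<^sub>R x + (- l) *\<^sub>R y)" by simp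
    then have z: "z = k' *\<^sub>R x + l' *\<^sub>R y" using \<open>n \<noteq> 0\<close> by (simp add: k'_def l'_def scaleR_diff_right)
    have "proj z = k' *\<^sub>R proj x + l' *\<^sub>R proj y" by (simp add: z proj_simps)
    then have "(a - k') *\<^sub>R proj x + (b - l') *\<^sub>R proj y = 0" using rel by (simp add: algebra_simps)
    moreover have "proj x \<noteq> proj y" using xyz inj_proj by (auto dest: inj_onD)
    ultimately have "a - k' = 0" "b - l' = 0"
      using Pos_independent[OF proj_Pos[OF xyz(1)] proj_Pos[OF xyz(2)]] by blast+
    then show "z = a *\<^sub>R x + b *\<^sub>R y" using z by simp
  qed
next
  fix r assume all: "\<forall>r. reflection_order S form simple r \<longrightarrow> scattered_on C.Pos r"
    and r: "reflection_order S B \<alpha> r"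
  define lift where "lift = inv_into C.Pos proj"
  have image: "lift ` Pos = C.Pos"
    unfolding lift_def Pos_eq_image by (simp add: inv_into_image_cancel inj_proj)
  have proj_lift: "proj (lift v) = v" if "v \<in> Pos" for v
    using that unfolding lift_def Pos_eq_image by (rule f_inv_into_f)
  show "scattered_on Pos r"
  proof (rule all_scattered_if_image[where f = lift, OF _ _ _ r[unfolded reflection_order_iff]])
    show "inj_on lift Pos" by (rule inj_on_inverseI[of _ proj]) (rule proj_lift)
    show "scattered_on (lift ` Pos) r" if "convex_order (lift ` Pos) r" for r
      using all that by (simp add: reflection_order_iff image)
    fix x y z a b assume xyz: "x \<in> Pos" "y \<in> Pos" "z \<in> Pos" "lift z = a *\<^sub>R lift x + b *\<^sub>R lift y"
    show "z = a *\<^sub>R x + b *\<^sub>R y"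
      using arg_cong[OF xyz(4), of proj] xyz(1-3) by (simp add: proj_simps proj_lift)
  qed
qed

end

theorem theorem4p2:
  fixes W :: "('a, 'b) monoid_scheme"
    and S :: "'a set"
    and m :: "'a \<Rightarrow> 'a \<Rightarrow> enat"
    and B :: "'v::real_vector \<Rightarrow> 'v \<Rightarrow> real"
    and \<alpha> :: "'a \<Rightarrow> 'v"
  assumes "coxeter_system W S m"
    and "infinite (carrier W)"
    and "irreducible_coxeter S m"
    and "root_basis S m B \<alpha>"
  shows "(\<forall>r. reflection_order S B \<alpha> r \<longrightarrow> scattered_on (positive_roots S B \<alpha>) r)
         \<longleftrightarrow> affine_weyl S m"
proof -
  interpret coxeter_rep W S m B \<alpha> using assms by (simp add: coxeter_rep_def)
  show ?thesis
    using all_scattered_iff[OF assms(3)]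
      coordinate_rep.scattered_iff_affine[OF coordinate_rep_form assms(2,3)] by simp
qed

end
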